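(* Let $U\subset\mathbb{R}$ be an open set and let $f:U\to\mathbb{R}$ be a measurable function. Let $A=\{x\in U: f \text{ is differentiable at } x\}$, and let $B$ be the set of points $x\in U$ for which there exists $\delta=\delta(x)>0$ such that $\sup\{|\Delta_2(f)(x,h)|: |h|<\delta\}<\infty$ and $$\int_{\Gamma(x)\cap\{0<t<\delta\}}\Delta_2^2(f)(s,t)\,\frac{ds\,dt}{t^2}<\infty.$$ Then $A$ and $B$ differ at most by a set of Lebesgue measure zero, i.e. the symmetric difference of $A$ and $B$ has Lebesgue measure zero.
   Context: For $t\neq 0$ with $s-t,s,s+t\in U$, $\Delta_2(f)(s,t)=\frac{f(s+t)+f(s-t)-2f(s)}{2|t|}$ and $\Delta_2^2(f)=(\Delta_2(f))^2$; the supremum is over $h\ne 0$ for which $\Delta_2(f)(x,h)$ is defined. For $x\in U$, $h_0=h_0(x)=\min\{1,\operatorname{dist}(x,\mathbb{R}\setminus U)/2\}$ (with $h_0=1$ if $U=\mathbb{R}$) and $\Gamma(x)=\{(s,t)\in\mathbb{R}^2: |s-x|<t<h_0\}$. *)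

theory Defs
  imports "HOL-Analysis.Analysis"
begin

definition Delta2 :: "(real \<Rightarrow> real) \<Rightarrow> real \<Rightarrow> real \<Rightarrow> real" where
  "Delta2 f s t = (f (s + t) + f (s - t) - 2 * f s) / (2 * \<bar>t\<bar>)"

text \<open>A function \<open>U \<rightarrow> \<real>\<close> is represented by a total function of which only the values on \<open>U\<close>
  matter; \<open>Delta2_dom U s\<close> is the set of \<open>t\<close> for which the difference at \<open>(s, t)\<close> is defined.\<close>

definition Delta2_dom :: "real set \<Rightarrow> real \<Rightarrow> real set" where
  "Delta2_dom U s = {t. t \<noteq> 0 \<and> s - t \<in> U \<and> s \<in> U \<and> s + t \<in> U}"

text \<open>The case \<open>U = UNIV\<close> is separate because \<open>infdist x {} = 0\<close>.\<close>

definition h0 :: "real set \<Rightarrow> real \<Rightarrow> real" where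
  "h0 U x = (if U = UNIV then 1 else min 1 (infdist x (- U) / 2))"

text \<open>For \<open>x \<in> U\<close> and \<open>(s, t) \<in> Gamma_cone U x\<close> one has \<open>\<bar>s \<plusminus> t - x\<bar> < 2 * t < infdist x (- U)\<close> if
  \<open>U \<noteq> UNIV\<close>, so \<open>t \<in> Delta2_dom U s\<close> holds throughout \<open>Gamma_cone U x\<close>.\<close>

definition Gamma_cone :: "real set \<Rightarrow> real \<Rightarrow> (real \<times> real) set" where
  "Gamma_cone U x = {(s, t). \<bar>s - x\<bar> < t \<and> t < h0 U x}"

definition diff_points :: "real set \<Rightarrow> (real \<Rightarrow> real) \<Rightarrow> real set" where
  "diff_points U f = {x \<in> U. f differentiable (at x)}"

definition square_points :: "real set \<Rightarrow> (real \<Rightarrow> real) \<Rightarrow> real set" where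
  "square_points U f = {x \<in> U. \<exists>\<delta>>0.
     (SUP h\<in>{h \<in> Delta2_dom U x. \<bar>h\<bar> < \<delta>}. ereal \<bar>Delta2 f x h\<bar>) < \<infinity> \<and>
     (\<integral>\<^sup>+(s, t)\<in>Gamma_cone U x \<inter> {(s, t). 0 < t \<and> t < \<delta>}.
        ennreal ((Delta2 f s t)\<^sup>2 / t\<^sup>2) \<partial>lebesgue) < \<infinity>}"

end

theory Submission
  imports Defs
begin

text \<open>
  Almost every point in question is a pointwise Lipschitz point of \<open>f\<close>, and almost every pointwise Lipschitz point is
  a point of differentiability: on a closed set of such points \<open>f\<close> agrees with a Lipschitz function \<open>g\<close>, and
  \<open>f - g\<close> is bounded by the distance to that set.

  At almost all points of such a set the square integral of \<open>f\<close> is finite: for \<open>g\<close> it is controlled by the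
  parallelogram identity \<open>\<Delta>\<^sub>2\<^sup>2 + slope\<^sup>2 = (slope\<^sub>1\<^sup>2 + slope\<^sub>2\<^sup>2) / 2\<close> for an interval and its two halves, and for
  \<open>f - g\<close> by a Marcinkiewicz integral.

  Conversely, the slopes of \<open>f\<close> over the intervals of a dyadic grid form a martingale with increments \<open>\<plusminus> \<Delta>\<^sub>2\<close>. The square
  integral over the cone at \<open>x\<close> is the average, over scales and translations of the grid, of the square function of
  this martingale at \<open>x\<close>. Hence, for almost every grid, the slopes over the cells around \<open>x\<close> are bounded, so that
  \<open>f(a) - f(x) = O(d)\<close> at the ends \<open>a\<close> of the cells of length \<open>d\<close> (approximate continuity identifies the limit).
  As these ends are spread uniformly around \<open>x\<close>, this bounds \<open>f(v) - f(x)\<close> for most \<open>v\<close> near \<open>x\<close>. To reach every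
  \<open>y\<close> near \<open>x\<close>, reflect it in a nearby point \<open>u\<close> at which the second differences are bounded, such that \<open>u\<close> and
  \<open>2u - y\<close> are good points. The set of such \<open>u\<close> need not be measurable, hence density points of arbitrary sets.
\<close>

section \<open>Density points of arbitrary sets\<close>

text \<open>The square integral does not see changes of \<open>f\<close> on a null set, but
  differentiability does: adding 1 on a dense null set destroys it wherever it held. So two
  functions run through the proof: \<open>f\<close> itself, extended by 0 outside \<open>U\<close>,
  for all pointwise conditions, and a Borel representative \<open>g\<close> for all integrals.
  Bounded second differences carry almost-everywhere information to every point near
  \<open>x\<close>.

  The cone and its weight come from counting intervals: \<open>(s, t)\<close> lies in the cone at
  \<open>x\<close> exactly if \<open>x\<close> lies in the open interval with midpoint
  \<open>s\<close> and half-length \<open>t\<close>. In \<open>ds dt / t^2\<close>, the part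
  \<open>ds / t\<close> averages over the translates of a grid and \<open>dt / t\<close> over its
  scales.

  The order of choices matters. The martingale estimate holds for a fixed grid and almost every
  \<open>x\<close>, while the conclusion needs a fixed \<open>x\<close> and almost every translate,
  at one scale common to almost all \<open>x\<close>. Fubini makes these exchanges, and it is
  applied to \<open>g\<close>.\<close>

lemma outer_measure_value:
  fixes N :: "real set"
  assumes "bounded N"
  obtains \<alpha> :: real where "\<alpha> \<ge> 0"
    "\<And>T. T \<in> sets lebesgue \<Longrightarrow> N \<subseteq> T \<Longrightarrow> ennreal \<alpha> \<le> emeasure lebesgue T"
    "\<And>e. e > 0 \<Longrightarrow> \<exists>T. open T \<and> N \<subseteq> T \<and> emeasure lebesgue T \<le> ennreal (\<alpha> + e)"
    "\<alpha> = 0 \<Longrightarrow> negligible N"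
proof -
  \<comment> \<open>The infimum over open supersets is the Lebesgue outer measure of
    \<open>N\<close>. Boundedness makes it finite, so that later inequalities can be cancelled in
    the reals.\<close>
  define \<A> where "\<A> = {emeasure lebesgue T |T. open T \<and> N \<subseteq> T}"
  obtain r where "N \<subseteq> ball 0 r"
    using bounded_subset_ballD[OF assms] by blast
  moreover have "emeasure lebesgue (ball (0::real) r) < \<infinity>"
    using emeasure_lborel_ball_finite[of "0::real" r] by simp
  ultimately have "Inf \<A> < \<infinity>"
    unfolding \<A>_def Inf_less_iff by blast
  then obtain \<alpha> where \<alpha>: "Inf \<A> = ennreal \<alpha>" "\<alpha> \<ge> 0"
    by (metis ennreal_cases infinity_ennreal_def less_irrefl)
  have eps: "\<exists>T. open T \<and> N \<subseteq> T \<and> emeasure lebesgue T \<le> ennreal (\<alpha> + e)" if "e > 0" for e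
  proof -
    have "Inf \<A> < ennreal (\<alpha> + e)"
      using \<alpha> that by (simp add: ennreal_lessI)
    then show ?thesis
      unfolding \<A>_def Inf_less_iff by (blast intro: less_imp_le)
  qed
  show thesis
  proof
    show "ennreal \<alpha> \<le> emeasure lebesgue T" if T: "T \<in> sets lebesgue" "N \<subseteq> T" for T
    proof (rule ennreal_le_epsilon)
      fix e :: real assume "e > 0"
      then obtain V where V: "open V" "T \<subseteq> V" "(V - T) \<in> lmeasurable" "emeasure lebesgue (V - T) < ennreal e"
        using sets_lebesgue_outer_open T by metis
      have "ennreal \<alpha> \<le> emeasure lebesgue V"
        unfolding \<alpha>(1)[symmetric] \<A>_def
        using V(1,2) T(2) by (intro Inf_lower CollectI exI[of _ V]) auto
      also have "V = T \<union> (V - T)" using V by auto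
      also have "emeasure lebesgue (T \<union> (V - T)) \<le> emeasure lebesgue T + emeasure lebesgue (V - T)"
        using T V by (intro emeasure_subadditive) auto
      also have "\<dots> \<le> emeasure lebesgue T + ennreal e"
        using V by (intro add_left_mono) auto
      finally show "ennreal \<alpha> \<le> emeasure lebesgue T + ennreal e" .
    qed
    show "negligible N" if "\<alpha> = 0"
      unfolding negligible_outer
    proof (intro allI impI)
      fix e :: real assume "e > 0"
      then obtain T where T: "open T" "N \<subseteq> T" "emeasure lebesgue T \<le> ennreal (e/2)"
        using eps[of "e/2"] \<open>\<alpha> = 0\<close> by auto
      then have "T \<in> lmeasurable"
        using le_less_trans[OF T(3)] by (intro fmeasurableI) (auto simp del: emeasure_completion)
      moreover have "measure lebesgue T \<le> e/2"
        unfolding measure_def using enn2real_mono[OF T(3)] \<open>e > 0\<close> by simp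
      ultimately show "\<exists>T. N \<subseteq> T \<and> T \<in> lmeasurable \<and> measure lebesgue T < e"
        using T \<open>e > 0\<close> by (intro exI[of _ T]) auto
    qed
  qed (use \<alpha> eps in auto)
qed

lemma emeasure_lebesgue_cball_real: "0 \<le> r \<Longrightarrow> emeasure lebesgue (cball (x::real) r) = ennreal (2 * r)"
  by (simp add: cball_eq_atLeastAtMost)

lemma negligible_bounded_partsI:
  fixes S :: "real set"
  assumes "\<And>n::nat. negligible (S \<inter> {-real n..real n})"
  shows "negligible S"
proof -
  have "S = (\<Union>n::nat. S \<inter> {-real n..real n})"
  proof (intro equalityI subsetI)
    fix x assume "x \<in> S"
    moreover obtain n :: nat where "\<bar>x\<bar> \<le> real n" using real_arch_simple by blast
    ultimately show "x \<in> (\<Union>n::nat. S \<inter> {-real n..real n})" by (auto simp: abs_le_iff intro!: exI[of _ n])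
  qed auto
  moreover have "negligible (\<Union>n::nat. S \<inter> {-real n..real n})"
    by (rule negligible_countable_Union) (use assms in auto)
  ultimately show ?thesis by simp
qed

text \<open>A Vitali cover of the exceptional set by
  balls with a relatively large part outside \<open>S\<close> would lower its outer measure by a fixed factor.\<close>

lemma negligible_non_density_bounded:
  fixes S :: "real set" and \<epsilon> :: real
  assumes "\<epsilon> > 0" "bounded S"
  shows "negligible {x \<in> S. \<forall>d>0. \<exists>r D. 0 < r \<and> r < d \<and> D \<in> sets lebesgue \<and> D \<subseteq> cball x r \<and>
                               D \<inter> S = {} \<and> ennreal (\<epsilon> * r) \<le> emeasure lebesgue D}"
    (is "negligible ?N")
proof -
  define N where "N = ?N"
  have "N \<subseteq> S" unfolding N_def by (rule Collect_subset)
  have ND: "\<exists>r D. 0 < r \<and> r < d \<and> D \<in> sets lebesgue \<and> D \<subseteq> cball x r \<and>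
      D \<inter> S = {} \<and> ennreal (\<epsilon> * r) \<le> emeasure lebesgue D" if "x \<in> N" "d > 0" for x d
    using that unfolding N_def by blast
  have "bounded N" using assms(2) \<open>N \<subseteq> S\<close> by (rule bounded_subset)
  then obtain \<alpha> where \<alpha>: "\<alpha> \<ge> 0"
    "\<And>T. T \<in> sets lebesgue \<Longrightarrow> N \<subseteq> T \<Longrightarrow> ennreal \<alpha> \<le> emeasure lebesgue T"
    "\<And>e. e > 0 \<Longrightarrow> \<exists>T. open T \<and> N \<subseteq> T \<and> emeasure lebesgue T \<le> ennreal (\<alpha> + e)"
    "\<alpha> = 0 \<Longrightarrow> negligible N"
    using outer_measure_value[OF \<open>bounded N\<close>] by blast
  \<comment> \<open>The selected balls lie in \<open>T\<close>, so they have measure at most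
    \<open>\<alpha> + e\<close>. Removing their sets \<open>D\<close> costs at least the fraction
    \<open>\<epsilon>/2\<close> of this measure (a ball of radius \<open>r\<close> has length
    \<open>2 * r\<close>) but no point of \<open>N\<close>, so the rest still has measure at least
    \<open>\<alpha>\<close>.\<close>
  have key: "\<alpha> + (\<epsilon>/2) * \<alpha> \<le> \<alpha> + e" if "e > 0" for e
  proof -
    obtain T where T: "open T" "N \<subseteq> T" "emeasure lebesgue T \<le> ennreal (\<alpha> + e)"
      using \<alpha>(3)[OF \<open>e > 0\<close>] by blast
    \<comment> \<open>Each index carries its set \<open>D\<close> along with the ball, so that
      selecting disjoint balls also selects disjoint sets \<open>D\<close>.\<close>
    define K where "K = {(x::real, r::real, D). 0 < r \<and> D \<in> sets lebesgue \<and> D \<subseteq> cball x r \<and>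
                            D \<inter> S = {} \<and> ennreal (\<epsilon> * r) \<le> emeasure lebesgue D \<and> cball x r \<subseteq> T}"
    let ?B = "\<lambda>i::real \<times> real \<times> real set. cball (fst i) (fst (snd i))"
    let ?D = "\<lambda>i::real \<times> real \<times> real set. snd (snd i)"
    obtain C where C: "countable C" "C \<subseteq> K"
      "pairwise (\<lambda>i j. disjnt (?B i) (?B j)) C" "negligible (N - (\<Union>i\<in>C. ?B i))"
    proof (rule Vitali_covering_theorem_cballs[of K "\<lambda>i. fst (snd i)" N fst])
      show "0 < fst (snd i)" if "i \<in> K" for i using that by (auto simp: K_def)
      fix x d :: real assume x: "x \<in> N" "0 < d"
      obtain d' where d': "d' > 0" "cball x d' \<subseteq> T"
        using T x by (meson open_contains_cball subsetD)
      have "min d d' > 0" using x d' by auto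
      then obtain r D where "0 < r" "r < min d d'" "D \<in> sets lebesgue" "D \<subseteq> cball x r"
           "D \<inter> S = {}" "ennreal (\<epsilon> * r) \<le> emeasure lebesgue D"
        using ND[OF x(1)] by blast
      moreover have "cball x r \<subseteq> T" using \<open>r < min d d'\<close> by (intro subset_trans[OF _ d'(2)] subset_cball) simp
      ultimately show "\<exists>i. i \<in> K \<and> x \<in> ?B i \<and> fst (snd i) < d"
        by (intro exI[of _ "(x, r, D)"]) (auto simp: K_def)
    qed blast
    have KD: "0 < fst (snd i)" "?D i \<in> sets lebesgue" "?D i \<subseteq> ?B i" "?D i \<inter> S = {}"
      "ennreal (\<epsilon> * fst (snd i)) \<le> emeasure lebesgue (?D i)" "?B i \<subseteq> T" if "i \<in> C" for i
      using subsetD[OF C(2) that] by (auto simp: K_def case_prod_beta simp del: emeasure_completion)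
    have disjB: "disjoint_family_on ?B C" and disjD: "disjoint_family_on ?D C"
      using C(3) KD(3) unfolding pairwise_def disjoint_family_on_def disjnt_def by blast+
    define UB where "UB = (\<Union>i\<in>C. ?B i)"
    define UD where "UD = (\<Union>i\<in>C. ?D i)"
    have meas: "UB \<in> sets lebesgue" "UD \<in> sets lebesgue"
      unfolding UB_def UD_def using C KD(2) by (auto intro!: sets.countable_UN' )
    have eB: "emeasure lebesgue UB = (\<integral>\<^sup>+i. emeasure lebesgue (?B i) \<partial>count_space C)"
      unfolding UB_def using C(1) disjB by (intro emeasure_UN_countable) auto
    have eD: "emeasure lebesgue UD = (\<integral>\<^sup>+i. emeasure lebesgue (?D i) \<partial>count_space C)"
      unfolding UD_def using C(1) disjD KD(2) by (intro emeasure_UN_countable) auto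
    have BD: "ennreal (\<epsilon>/2) * emeasure lebesgue UB \<le> emeasure lebesgue UD"
      unfolding eB eD
    proof (subst nn_integral_cmult[symmetric], simp, rule nn_integral_mono)
      fix i assume "i \<in> space (count_space C)"
      then have i: "i \<in> C" by simp
      have "ennreal (\<epsilon> / 2) * emeasure lebesgue (?B i) = ennreal (\<epsilon> * fst (snd i))"
        using KD(1)[OF i] assms by (subst emeasure_lebesgue_cball_real) (auto simp: ennreal_mult[symmetric])
      then show "ennreal (\<epsilon> / 2) * emeasure lebesgue (?B i) \<le> emeasure lebesgue (?D i)"
        using KD(5)[OF i] by simp
    qed
    have null: "N - UB \<in> null_sets lebesgue"
      using C(4) by (simp add: UB_def negligible_iff_null_sets)
    have "UB \<subseteq> T"
      unfolding UB_def by (rule UN_least) (rule KD(6))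
    have "UD \<subseteq> UB" unfolding UD_def UB_def by (intro UN_mono KD(3)) auto
    have "UD \<inter> S = {}" using KD(4) by (auto simp: UD_def)
    have "N \<subseteq> (UB - UD) \<union> (N - UB)" using \<open>UD \<inter> S = {}\<close> \<open>N \<subseteq> S\<close> by blast
    then have "ennreal \<alpha> \<le> emeasure lebesgue ((UB - UD) \<union> (N - UB))"
      using meas null by (intro \<alpha>(2)) auto
    also have "\<dots> = emeasure lebesgue (UB - UD)"
      using meas null by (intro emeasure_Un_null_set) auto
    finally have 1: "ennreal \<alpha> \<le> emeasure lebesgue (UB - UD)" .
    have 2: "ennreal \<alpha> \<le> emeasure lebesgue UB"
      using meas by (intro order_trans[OF 1 emeasure_mono]) auto
    have "ennreal \<alpha> + ennreal (\<epsilon>/2) * ennreal \<alpha> \<le> emeasure lebesgue (UB - UD) + emeasure lebesgue UD"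
      by (rule add_mono[OF 1 order_trans[OF mult_left_mono[OF 2] BD]]) simp
    also have "\<dots> = emeasure lebesgue UB"
      using meas \<open>UD \<subseteq> UB\<close> by (subst plus_emeasure) (auto simp: Un_absorb2 simp del: emeasure_completion)
    also have "\<dots> \<le> emeasure lebesgue T"
      using \<open>UB \<subseteq> T\<close> T(1) by (intro emeasure_mono) auto
    also have "\<dots> \<le> ennreal (\<alpha> + e)" by fact
    finally show ?thesis
      using \<alpha>(1) assms that by (simp add: ennreal_mult[symmetric] ennreal_plus[symmetric] del: ennreal_plus)
  qed
  have "(\<epsilon>/2) * \<alpha> \<le> 0"
    by (rule field_le_epsilon) (use key in auto)
  then have "\<alpha> = 0" using assms \<alpha>(1) by (simp add: mult_le_0_iff)
  then show ?thesis using \<alpha>(4) by (simp add: N_def)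
qed

text \<open>A non-measurable \<open>S\<close> has no measure to compare with that of a ball, so
  density is tested by measurable sets: at almost every point of \<open>S\<close>, a set
  \<open>D\<close> occupying a fixed proportion of a small ball must meet \<open>S\<close>. The
  applications only ever need such a point of \<open>D\<close> in \<open>S\<close>.\<close>

lemma negligible_non_density:
  fixes S :: "real set" and \<epsilon> :: real
  assumes "\<epsilon> > 0"
  shows "negligible {x \<in> S. \<forall>d>0. \<exists>r D. 0 < r \<and> r < d \<and> D \<in> sets lebesgue \<and> D \<subseteq> cball x r \<and>
                               D \<inter> S = {} \<and> ennreal (\<epsilon> * r) \<le> emeasure lebesgue D}"
proof (rule negligible_bounded_partsI)
  fix n :: nat
  define P where "P = (\<lambda>(S::real set) x. \<forall>d>0. \<exists>r D. 0 < r \<and> r < d \<and> D \<in> sets lebesgue \<and> D \<subseteq> cball x r \<and>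
                               D \<inter> S = {} \<and> ennreal (\<epsilon> * r) \<le> emeasure lebesgue D)"
  define S' where "S' = S \<inter> {-real n..real n}"
  have "P S' x" if "P S x" for x
    unfolding P_def
  proof (intro allI impI)
    fix d :: real assume "d > 0"
    then obtain r D where "0 < r" "r < d" "D \<in> sets lebesgue" "D \<subseteq> cball x r"
      "D \<inter> S = {}" "ennreal (\<epsilon> * r) \<le> emeasure lebesgue D"
      using \<open>P S x\<close> unfolding P_def by blast
    moreover have "D \<inter> S' = {}" using \<open>D \<inter> S = {}\<close> unfolding S'_def by blast
    ultimately show "\<exists>r D. 0 < r \<and> r < d \<and> D \<in> sets lebesgue \<and> D \<subseteq> cball x r \<and>
        D \<inter> S' = {} \<and> ennreal (\<epsilon> * r) \<le> emeasure lebesgue D" by blast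
  qed
  then have "{x \<in> S. P S x} \<inter> {-real n..real n} \<subseteq> {x \<in> S'. P S' x}"
    by (auto simp: S'_def)
  moreover have "bounded S'" unfolding S'_def by (rule bounded_subset[of "{-real n..real n}"]) auto
  then have "negligible {x \<in> S'. P S' x}"
    unfolding P_def by (rule negligible_non_density_bounded[OF assms])
  ultimately have "negligible ({x \<in> S. P S x} \<inter> {-real n..real n})"
    by (rule negligible_subset[rotated])
  then show "negligible ({x \<in> S. \<forall>d>0. \<exists>r D. 0 < r \<and> r < d \<and> D \<in> sets lebesgue \<and> D \<subseteq> cball x r \<and>
      D \<inter> S = {} \<and> ennreal (\<epsilon> * r) \<le> emeasure lebesgue D} \<inter> {-real n..real n})"
    unfolding P_def .
qed

section \<open>Vitali covers by intervals and slopes of monotone functions\<close>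

text \<open>Vitali's theorem asks a ball to contain the point, not to be centred there. Reading each
  interval as the ball around its midpoint therefore allows slopes over intervals with
  \<open>x\<close> in any position.\<close>

lemma Vitali_covering_intervals:
  fixes N T :: "real set" and P :: "real \<Rightarrow> real \<Rightarrow> bool"
  assumes "open T" "N \<subseteq> T"
    and "\<And>x d. x \<in> N \<Longrightarrow> d > 0 \<Longrightarrow> \<exists>u v. u \<le> x \<and> x \<le> v \<and> u < v \<and> v - u < d \<and> P u v"
  obtains C :: "(real \<times> real) set" where "countable C"
    "\<And>i. i \<in> C \<Longrightarrow> fst i < snd i \<and> P (fst i) (snd i) \<and> {fst i..snd i} \<subseteq> T"
    "disjoint_family_on (\<lambda>i. {fst i..snd i}) C"
    "N - (\<Union>i\<in>C. {fst i..snd i}) \<in> null_sets lebesgue"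
proof -
  define K where "K = {i::real \<times> real. fst i < snd i \<and> P (fst i) (snd i) \<and> {fst i..snd i} \<subseteq> T}"
  define c where "c = (\<lambda>i::real \<times> real. (fst i + snd i) / 2)"
  define r where "r = (\<lambda>i::real \<times> real. (snd i - fst i) / 2)"
  have cb: "cball (c i) (r i) = {fst i..snd i}" for i
    by (auto simp: cball_eq_atLeastAtMost c_def r_def field_simps)
  obtain C where C: "countable C" "C \<subseteq> K"
     "pairwise (\<lambda>i j. disjnt (cball (c i) (r i)) (cball (c j) (r j))) C"
     "negligible (N - (\<Union>i \<in> C. cball (c i) (r i)))"
  proof (rule Vitali_covering_theorem_cballs[of K r N c])
    show "0 < r i" if "i \<in> K" for i using that by (auto simp: K_def r_def)
    fix x d :: real assume x: "x \<in> N" "0 < d"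
    obtain d' where d': "d' > 0" "cball x d' \<subseteq> T"
      using assms(1,2) x by (meson open_contains_cball subsetD)
    have "min d d' > 0" using x d' by auto
    with assms(3)[OF x(1)] obtain u v where uv: "u \<le> x" "x \<le> v" "u < v" "v - u < min d d'" "P u v"
      by blast
    have "{u..v} \<subseteq> cball x d'" using uv by (auto simp: cball_eq_atLeastAtMost)
    then have "(u, v) \<in> K" using uv d' by (auto simp: K_def)
    then show "\<exists>i. i \<in> K \<and> x \<in> cball (c i) (r i) \<and> r i < d"
      unfolding cb by (intro exI[of _ "(u, v)"]) (use uv in \<open>auto simp: r_def\<close>)
  qed blast
  show thesis
  proof
    show "countable C" by fact
    show "fst i < snd i \<and> P (fst i) (snd i) \<and> {fst i..snd i} \<subseteq> T" if "i \<in> C" for i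
      using that C(2) by (auto simp: K_def)
    show "disjoint_family_on (\<lambda>i. {fst i..snd i}) C"
      using C(3) unfolding cb pairwise_def disjoint_family_on_def disjnt_def by blast
    show "N - (\<Union>i\<in>C. {fst i..snd i}) \<in> null_sets lebesgue"
      using C(4) unfolding cb by (simp add: negligible_iff_null_sets)
  qed
qed

text \<open>Two nested Vitali covers are compared in the Stieltjes measure of \<open>g\<close>.
  Disjoint intervals of slope at most \<open>p\<close> cover almost all of \<open>N\<close>, and
  inside them disjoint intervals of slope at least \<open>q\<close> do so again. Hence
  \<open>q * \<alpha> \<le> p * (\<alpha> + e)\<close> for the outer measure
  \<open>\<alpha>\<close>, which forces \<open>\<alpha> = 0\<close>.\<close>

lemma negligible_oscillating_slopes_bounded:
  fixes g :: "real \<Rightarrow> real"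
  assumes mono: "\<And>x y. x \<le> y \<Longrightarrow> g x \<le> g y" and cont: "continuous_on UNIV g"
    and pq: "0 \<le> p" "p < q" and "bounded N"
    and low: "\<And>x d. x \<in> N \<Longrightarrow> d > 0 \<Longrightarrow>
      \<exists>u v. u \<le> x \<and> x \<le> v \<and> u < v \<and> v - u < d \<and> g v - g u \<le> p * (v - u)"
    and high: "\<And>x d. x \<in> N \<Longrightarrow> d > 0 \<Longrightarrow>
      \<exists>u v. u \<le> x \<and> x \<le> v \<and> u < v \<and> v - u < d \<and> q * (v - u) \<le> g v - g u"
  shows "negligible N"
proof -
  obtain \<alpha> where \<alpha>: "\<alpha> \<ge> 0"
    "\<And>T. T \<in> sets lebesgue \<Longrightarrow> N \<subseteq> T \<Longrightarrow> ennreal \<alpha> \<le> emeasure lebesgue T"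
    "\<And>e. e > 0 \<Longrightarrow> \<exists>T. open T \<and> N \<subseteq> T \<and> emeasure lebesgue T \<le> ennreal (\<alpha> + e)"
    "\<alpha> = 0 \<Longrightarrow> negligible N"
    using outer_measure_value[OF \<open>bounded N\<close>] by blast
  define \<mu> where "\<mu> = interval_measure g"
  have \<mu>: "emeasure \<mu> {u..v} = ennreal (g v - g u)" if "u \<le> v" for u v
    unfolding \<mu>_def by (rule emeasure_interval_measure_Icc[OF that mono cont])
  have sets_\<mu>[simp]: "sets \<mu> = sets borel" by (simp add: \<mu>_def)
  have key: "q * \<alpha> \<le> p * (\<alpha> + e)" if "e > 0" for e
  proof -
    obtain T where T: "open T" "N \<subseteq> T" "emeasure lebesgue T \<le> ennreal (\<alpha> + e)"
      using \<alpha>(3)[OF \<open>e > 0\<close>] by blast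
    obtain C where C: "countable C"
      "\<And>i. i \<in> C \<Longrightarrow> fst i < snd i \<and> g (snd i) - g (fst i) \<le> p * (snd i - fst i) \<and> {fst i..snd i} \<subseteq> T"
      "disjoint_family_on (\<lambda>i. {fst i..snd i}) C"
      "N - (\<Union>i\<in>C. {fst i..snd i}) \<in> null_sets lebesgue"
      using Vitali_covering_intervals[OF T(1,2), of "\<lambda>u v. g v - g u \<le> p * (v - u)"] low by blast
    \<comment> \<open>The second cover needs an open set, so the endpoints of the first are dropped;
      they are countably many and hence null.\<close>
    define V where "V = (\<Union>i\<in>C. {fst i<..<snd i})"
    have "open V" by (auto simp: V_def)
    have high': "\<exists>u v. u \<le> x \<and> x \<le> v \<and> u < v \<and> v - u < d \<and> q * (v - u) \<le> g v - g u"
      if "x \<in> N \<inter> V" "d > 0" for x d using high[of x d] that by auto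
    obtain C' where C': "countable C'"
      "\<And>i. i \<in> C' \<Longrightarrow> fst i < snd i \<and> q * (snd i - fst i) \<le> g (snd i) - g (fst i) \<and> {fst i..snd i} \<subseteq> V"
      "disjoint_family_on (\<lambda>i. {fst i..snd i}) C'"
      "N \<inter> V - (\<Union>i\<in>C'. {fst i..snd i}) \<in> null_sets lebesgue"
      using Vitali_covering_intervals[OF \<open>open V\<close> _ high', of "N \<inter> V"] by blast
    define UB where "UB = (\<Union>i\<in>C. {fst i..snd i})"
    define UB' where "UB' = (\<Union>i\<in>C'. {fst i..snd i})"
    have meas: "UB \<in> sets borel" "UB' \<in> sets borel"
      unfolding UB_def UB'_def using C(1) C'(1) by (auto intro!: sets.countable_UN')
    have "fst ` C \<union> snd ` C \<in> null_sets lebesgue"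
      using C(1) by (simp add: countable_imp_null_set_lborel null_sets_completionI)
    then have null: "(N - UB) \<union> (fst ` C \<union> snd ` C) \<union> (N \<inter> V - UB') \<in> null_sets lebesgue" (is "?Z \<in> _")
      using C(4) C'(4) by (simp add: UB_def UB'_def null_sets.Un)
    have "N \<subseteq> UB' \<union> ?Z"
    proof
      fix x assume "x \<in> N"
      show "x \<in> UB' \<union> ?Z"
      proof (cases "x \<in> UB - V")
        case True
        then obtain i where "i \<in> C" "fst i \<le> x" "x \<le> snd i" "\<not> (fst i < x \<and> x < snd i)"
          unfolding UB_def V_def by auto
        then have "x = fst i \<or> x = snd i" by auto
        then show ?thesis using \<open>i \<in> C\<close> by blast
      qed (use \<open>x \<in> N\<close> in blast)
    qed
    then have "ennreal \<alpha> \<le> emeasure lebesgue (UB' \<union> ?Z)"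
      using meas null by (intro \<alpha>(2)) auto
    also have "\<dots> = emeasure lebesgue UB'"
      using meas null by (intro emeasure_Un_null_set) auto
    finally have "ennreal \<alpha> \<le> emeasure lborel UB'"
      using meas by simp
    then have "ennreal q * ennreal \<alpha> \<le> ennreal q * emeasure lborel UB'"
      by (intro mult_left_mono) auto
    also have "emeasure lborel UB' = (\<integral>\<^sup>+i. emeasure lborel {fst i..snd i} \<partial>count_space C')"
      unfolding UB'_def using C' by (intro emeasure_UN_countable) auto
    also have "ennreal q * \<dots> \<le> (\<integral>\<^sup>+i. emeasure \<mu> {fst i..snd i} \<partial>count_space C')"
    proof (subst nn_integral_cmult[symmetric], simp, rule nn_integral_mono)
      fix i assume "i \<in> space (count_space C')"
      then have i: "fst i < snd i" "q * (snd i - fst i) \<le> g (snd i) - g (fst i)" using C'(2) by auto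
      then show "ennreal q * emeasure lborel {fst i..snd i} \<le> emeasure \<mu> {fst i..snd i}"
        using pq by (simp add: \<mu> ennreal_mult[symmetric] ennreal_leI)
    qed
    also have "\<dots> = emeasure \<mu> UB'"
      unfolding UB'_def using C' by (intro emeasure_UN_countable[symmetric]) auto
    also have "\<dots> \<le> emeasure \<mu> UB"
    proof (rule emeasure_mono)
      have "V \<subseteq> UB" unfolding V_def UB_def by (intro UN_mono) auto
      moreover have "UB' \<subseteq> V" unfolding UB'_def using C'(2) by (intro UN_least) blast
      ultimately show "UB' \<subseteq> UB" by blast
    qed (use meas in auto)
    also have "\<dots> = (\<integral>\<^sup>+i. emeasure \<mu> {fst i..snd i} \<partial>count_space C)"
      unfolding UB_def using C by (intro emeasure_UN_countable) auto
    also have "\<dots> \<le> (\<integral>\<^sup>+i. ennreal p * emeasure lborel {fst i..snd i} \<partial>count_space C)"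
    proof (rule nn_integral_mono)
      fix i assume "i \<in> space (count_space C)"
      then have i: "fst i < snd i" "g (snd i) - g (fst i) \<le> p * (snd i - fst i)" using C(2) by auto
      then show "emeasure \<mu> {fst i..snd i} \<le> ennreal p * emeasure lborel {fst i..snd i}"
        using pq by (simp add: \<mu> ennreal_mult[symmetric] ennreal_leI)
    qed
    also have "\<dots> = ennreal p * emeasure lborel UB"
      unfolding UB_def using C by (subst emeasure_UN_countable) (auto simp: nn_integral_cmult)
    also have "\<dots> \<le> ennreal p * ennreal (\<alpha> + e)"
    proof (rule mult_left_mono)
      have "emeasure lborel UB = emeasure lebesgue UB" using meas by simp
      also have "\<dots> \<le> emeasure lebesgue T"
        using C(2) T(1) by (intro emeasure_mono) (auto simp: UB_def)
      finally show "emeasure lborel UB \<le> ennreal (\<alpha> + e)" using T(3) by simp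
    qed auto
    finally show ?thesis
      using pq \<alpha>(1) that by (simp add: ennreal_mult[symmetric] del: ennreal_plus)
  qed
  have "q * \<alpha> \<le> p * \<alpha> + e" if "e > 0" for e
  proof -
    have "q * \<alpha> \<le> p * (\<alpha> + e / (p + 1))" using key[of "e / (p + 1)"] that pq by simp
    also have "\<dots> = p * \<alpha> + e * (p / (p + 1))" by (simp add: field_simps)
    also have "e * (p / (p + 1)) \<le> e * 1" using that pq by (intro mult_left_mono) (auto simp: field_simps)
    finally show ?thesis by simp
  qed
  then have "q * \<alpha> \<le> p * \<alpha>"
    by (rule field_le_epsilon)
  then have "\<alpha> = 0" using pq \<alpha>(1) by (simp add: mult_le_cancel_right)
  then show ?thesis by (rule \<alpha>(4))
qed

section \<open>Pointwise Lipschitz points\<close>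

lemma DERIV_from_interval_slopes:
  fixes g :: "real \<Rightarrow> real"
  assumes "\<And>\<epsilon>. \<epsilon> > 0 \<Longrightarrow> \<exists>d>0. \<forall>u v. u \<le> x \<and> x \<le> v \<and> u < v \<and> v - u < d \<longrightarrow>
      (l - \<epsilon>) * (v - u) \<le> g v - g u \<and> g v - g u \<le> (l + \<epsilon>) * (v - u)"
  shows "(g has_real_derivative l) (at x)"
  unfolding DERIV_def LIM_def
proof (intro allI impI)
  fix r :: real assume "r > 0"
  then obtain d where d: "d > 0" "\<And>u v. u \<le> x \<Longrightarrow> x \<le> v \<Longrightarrow> u < v \<Longrightarrow> v - u < d \<Longrightarrow>
      (l - r/2) * (v - u) \<le> g v - g u \<and> g v - g u \<le> (l + r/2) * (v - u)"
    using assms[of "r/2"] by auto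
  have "dist ((g (x + h) - g x) / h) l < r" if h: "h \<noteq> 0" "\<bar>h\<bar> < d" for h
  proof -
    have "l - r/2 \<le> (g (x + h) - g x) / h \<and> (g (x + h) - g x) / h \<le> l + r/2"
    proof (cases "h > 0")
      case True
      then show ?thesis using d(2)[of x "x + h"] h by (simp add: field_simps)
    next
      case False
      then have "h < 0" using h by simp
      then show ?thesis using d(2)[of "x + h" x] h by (simp add: field_simps)
    qed
    then show ?thesis using \<open>r > 0\<close> by (simp add: dist_real_def abs_less_iff)
  qed
  then show "\<exists>s>0. \<forall>h. h \<noteq> 0 \<and> dist h 0 < s \<longrightarrow> dist ((g (x + h) - g x) / h) l < r"
    using d(1) by (auto simp: dist_real_def)
qed

text \<open>Where the derivative fails to exist, slopes below some rational \<open>p\<close> and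
  above some rational \<open>q > p\<close> both recur on arbitrarily short intervals around
  \<open>x\<close>, and each pair accounts for a null set only. The Lipschitz bound keeps the
  candidate for the derivative finite.\<close>

lemma mono_lipschitz_differentiable_AE:
  fixes g :: "real \<Rightarrow> real"
  assumes mono: "\<And>x y. x \<le> y \<Longrightarrow> g x \<le> g y"
    and lip: "\<And>x y. x \<le> y \<Longrightarrow> g y - g x \<le> L * (y - x)"
  shows "negligible {x. \<not> g differentiable (at x)}"
proof -
  have "\<bar>g x - g y\<bar> \<le> L * \<bar>x - y\<bar>" for x y
    using lip[of x y] lip[of y x] mono[of x y] mono[of y x] by (auto simp: abs_if)
  moreover have "L \<ge> 0" using mono[of 0 1] lip[of 0 1] by simp
  ultimately have "L-lipschitz_on UNIV g"
    by (intro lipschitz_onI) (auto simp: dist_real_def)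
  then have cont: "continuous_on UNIV g" by (rule lipschitz_on_continuous_on)
  define Low where "Low = (\<lambda>p x. \<forall>d>0. \<exists>u v. u \<le> x \<and> x \<le> v \<and> u < v \<and> v - u < d \<and> g v - g u \<le> p * (v - u))"
  define High where "High = (\<lambda>q x. \<forall>d>0. \<exists>u v. u \<le> x \<and> x \<le> v \<and> u < v \<and> v - u < d \<and> q * (v - u) \<le> g v - g u)"
  define N where "N = (\<lambda>p q. {x. Low p x \<and> High q x})"
  have N: "negligible (N p q)" if "0 \<le> p" "p < q" for p q
  proof (rule negligible_bounded_partsI)
    fix n :: nat
    show "negligible (N p q \<inter> {-real n..real n})"
    proof (rule negligible_oscillating_slopes_bounded[OF mono cont that])
      show "bounded (N p q \<inter> {-real n..real n})" by (rule bounded_subset[of "{-real n..real n}"]) auto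
    qed (auto simp: N_def Low_def High_def)
  qed
  have "{x. \<not> g differentiable (at x)} \<subseteq> (\<Union>p\<in>\<rat>\<inter>{0..}. \<Union>q\<in>\<rat>\<inter>{p<..}. N p q)"
  proof (clarify, rule ccontr)
    fix x assume nd: "\<not> g differentiable (at x)" and "x \<notin> (\<Union>p\<in>\<rat>\<inter>{0..}. \<Union>q\<in>\<rat>\<inter>{p<..}. N p q)"
    then have notboth: "\<not> (Low p x \<and> High q x)" if "p \<in> \<rat>" "q \<in> \<rat>" "0 \<le> p" "p < q" for p q
      using that by (auto simp: N_def)
    \<comment> \<open>The lower limit of the slopes over shrinking intervals containing
      \<open>x\<close>: \<open>\<not> Low p x\<close> says that these slopes eventually exceed
      \<open>p\<close>.\<close>
    define l where "l = Sup {p. \<not> Low p x}"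
    have neg: "\<not> Low p x" if "p < 0" for p
    proof -
      have "\<not> (g v - g u \<le> p * (v - u))" if "u < v" for u v
        using mono[of u v] that mult_neg_pos[OF \<open>p < 0\<close>, of "v - u"] by simp
      then show ?thesis unfolding Low_def by (intro notI) (drule spec[of _ 1], auto)
    qed
    have ub: "p \<le> L" if "\<not> Low p x" for p
    proof (rule ccontr)
      assume "\<not> p \<le> L"
      have "g v - g u \<le> p * (v - u)" if "u < v" for u v
      proof -
        have "L * (v - u) \<le> p * (v - u)" using that \<open>\<not> p \<le> L\<close> by (intro mult_right_mono) auto
        then show ?thesis using lip[of u v] that by linarith
      qed
      then have "Low p x" unfolding Low_def
      proof (intro allI impI)
        fix d :: real assume "d > 0"
        then show "\<exists>u v. u \<le> x \<and> x \<le> v \<and> u < v \<and> v - u < d \<and> g v - g u \<le> p * (v - u)"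
          using \<open>\<And>u v. u < v \<Longrightarrow> g v - g u \<le> p * (v - u)\<close>[of x "x + d/2"]
          by (intro exI[of _ x] exI[of _ "x + d/2"]) auto
      qed
      with that show False by simp
    qed
    have bdd: "bdd_above {p. \<not> Low p x}" using ub by (auto intro!: bdd_aboveI)
    have "l \<ge> 0"
    proof (rule field_le_epsilon)
      fix e :: real assume "e > 0"
      then show "0 \<le> l + e" using cSup_upper[OF _ bdd, of "-e"] neg[of "-e"] by (simp add: l_def)
    qed
    have "(g has_real_derivative l) (at x)"
    proof (rule DERIV_from_interval_slopes)
      fix \<epsilon> :: real assume "\<epsilon> > 0"
      obtain p where p: "\<not> Low p x" "l - \<epsilon> < p"
        using less_cSup_iff[OF _ bdd, of "l - \<epsilon>"] neg[of "-1"] \<open>\<epsilon> > 0\<close> by (auto simp: l_def)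
      \<comment> \<open>Two rationals just above \<open>l\<close> bring in the countable family:
        slopes below \<open>p'\<close> recur by the choice of \<open>l\<close>, so slopes above
        \<open>q\<close> cannot recur, as \<open>x\<close> lies outside
        \<open>N p' q\<close>.\<close>
      obtain p' where p': "p' \<in> \<rat>" "l < p'" "p' < l + \<epsilon> / 2"
        using Rats_dense_in_real[of l "l + \<epsilon>/2"] \<open>\<epsilon> > 0\<close> by auto
      obtain q where q: "q \<in> \<rat>" "l + \<epsilon> / 2 < q" "q < l + \<epsilon>"
        using Rats_dense_in_real[of "l + \<epsilon>/2" "l + \<epsilon>"] \<open>\<epsilon> > 0\<close> by auto
      have "Low p' x" using cSup_upper[OF _ bdd, of p'] p' by (auto simp: l_def)
      then have "\<not> High q x" using notboth[of p' q] p' q \<open>l \<ge> 0\<close> by auto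
      then obtain d1 where d1: "d1 > 0" "\<And>u v. u \<le> x \<Longrightarrow> x \<le> v \<Longrightarrow> u < v \<Longrightarrow> v - u < d1 \<Longrightarrow> g v - g u < q * (v - u)"
        unfolding High_def by (meson not_le)
      obtain d2 where d2: "d2 > 0" "\<And>u v. u \<le> x \<Longrightarrow> x \<le> v \<Longrightarrow> u < v \<Longrightarrow> v - u < d2 \<Longrightarrow> p * (v - u) < g v - g u"
        using p(1) unfolding Low_def by (meson not_le)
      have "(l - \<epsilon>) * (v - u) \<le> g v - g u \<and> g v - g u \<le> (l + \<epsilon>) * (v - u)"
        if "u \<le> x" "x \<le> v" "u < v" "v - u < min d1 d2" for u v
      proof -
        have "(l - \<epsilon>) * (v - u) \<le> p * (v - u)" "q * (v - u) \<le> (l + \<epsilon>) * (v - u)"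
          using that p(2) q(3) by (auto intro!: mult_right_mono)
        moreover have "v - u < d1" "v - u < d2" using that by auto
        ultimately show ?thesis using d1(2)[of u v] d2(2)[of u v] that by linarith
      qed
      then show "\<exists>d>0. \<forall>u v. u \<le> x \<and> x \<le> v \<and> u < v \<and> v - u < d \<longrightarrow>
          (l - \<epsilon>) * (v - u) \<le> g v - g u \<and> g v - g u \<le> (l + \<epsilon>) * (v - u)"
        using d1(1) d2(1) by (intro exI[of _ "min d1 d2"]) auto
    qed
    then show False using nd real_differentiable_def by blast
  qed
  moreover have "negligible (\<Union>p\<in>\<rat>\<inter>{0..}. \<Union>q\<in>\<rat>\<inter>{p<..}. N p q)"
  proof -
    have c: "countable (\<rat> \<inter> A)" for A :: "real set" using countable_rat by (rule countable_subset[rotated]) auto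
    have "negligible (\<Union>q\<in>\<rat>\<inter>{p<..}. N p q)" if "0 \<le> p" for p
      using N[OF that] c by (intro negligible_countable_Union countable_image) auto
    then show ?thesis using c by (intro negligible_countable_Union countable_image) auto
  qed
  ultimately show ?thesis by (rule negligible_subset[rotated])
qed

text \<open>Adding \<open>L * x\<close> makes \<open>g\<close> increasing and at most doubles the
  Lipschitz constant.\<close>

lemma lipschitz_differentiable_AE:
  fixes g :: "real \<Rightarrow> real"
  assumes lip: "\<And>x y. \<bar>g x - g y\<bar> \<le> L * \<bar>x - y\<bar>"
  shows "negligible {x. \<not> g differentiable (at x)}"
proof -
  let ?h = "\<lambda>x. g x + L * x"
  have "negligible {x. \<not> ?h differentiable (at x)}"
  proof (rule mono_lipschitz_differentiable_AE)
    fix x y :: real assume "x \<le> y"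
    then have "\<bar>x - y\<bar> = y - x" by simp
    then have "\<bar>g x - g y\<bar> \<le> L * (y - x)" using lip[of x y] by simp
    then show "?h x \<le> ?h y" "?h y - ?h x \<le> (2 * L) * (y - x)" by (auto simp: algebra_simps)
  qed
  moreover have "g differentiable (at x)" if "?h differentiable (at x)" for x
  proof -
    have "(\<lambda>x. ?h x - L * x) differentiable (at x)"
      by (intro differentiable_diff that differentiable_mult differentiable_const differentiable_ident)
    then show ?thesis by simp
  qed
  ultimately show ?thesis by (elim negligible_subset) auto
qed

text \<open>McShane's extension: the lower envelope of the cones of slope \<open>M\<close> whose
  vertices lie on the graph of \<open>f\<close> over \<open>F\<close>.\<close>

lemma lipschitz_extension_real:
  fixes f :: "real \<Rightarrow> real"
  assumes "\<And>x y. x \<in> F \<Longrightarrow> y \<in> F \<Longrightarrow> \<bar>f x - f y\<bar> \<le> M * \<bar>x - y\<bar>" "M \<ge> 0" 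
  obtains g where "\<And>x. x \<in> F \<Longrightarrow> g x = f x" "\<And>x y. \<bar>g x - g y\<bar> \<le> M * \<bar>x - y\<bar>"
proof (cases "F = {}")
  case True
  with assms that[of "\<lambda>_. 0"] show ?thesis by simp
next
  case False
  then obtain z where z: "z \<in> F" by blast
  define g where "g = (\<lambda>y. Inf ((\<lambda>x. f x + M * \<bar>x - y\<bar>) ` F))"
  have tri: "M * \<bar>x - y\<bar> \<le> M * \<bar>x - w\<bar> + M * \<bar>w - y\<bar>" for x y w
    unfolding distrib_left[symmetric] using \<open>M \<ge> 0\<close> by (intro mult_left_mono) auto
  have bdd: "bdd_below ((\<lambda>x. f x + M * \<bar>x - y\<bar>) ` F)" for y
  proof (rule bdd_belowI2)
    fix x assume "x \<in> F"
    then show "f z - M * \<bar>z - y\<bar> \<le> f x + M * \<bar>x - y\<bar>"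
      using assms(1)[OF z \<open>x \<in> F\<close>] tri[of z x y] by (simp add: abs_minus_commute)
  qed
  have up: "g y \<le> f x + M * \<bar>x - y\<bar>" if "x \<in> F" for x y
    unfolding g_def using bdd that by (intro cINF_lower) auto
  have lo: "c \<le> g y" if "\<And>x. x \<in> F \<Longrightarrow> c \<le> f x + M * \<bar>x - y\<bar>" for c y
    unfolding g_def using that False by (intro cINF_greatest) auto
  have one: "g y \<le> g w + M * \<bar>y - w\<bar>" for y w
  proof -
    have "g y - M * \<bar>y - w\<bar> \<le> g w"
      using up[of _ y] tri[of _ y w] by (intro lo) (smt (verit) abs_minus_commute)
    then show ?thesis by simp
  qed
  show ?thesis
  proof (rule that[of g])
    show "g x = f x" if "x \<in> F" for x
    proof (rule antisym)
      show "g x \<le> f x" using up[OF that, of x] by simp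
      show "f x \<le> g x" using assms(1)[OF that] by (intro lo) (smt (verit) abs_minus_commute)
    qed
    show "\<bar>g x - g y\<bar> \<le> M * \<bar>x - y\<bar>" for x y
      using one[of x y] one[of y x] unfolding abs_minus_commute[of y x] by (intro abs_leI) linarith+
  qed
qed

text \<open>Fixing both the constant and the radius gives closed sets, whatever \<open>f\<close> is.
  The pointwise Lipschitz points are the union of countably many of them, with
  \<open>M = Suc m\<close> and \<open>d = 1 / Suc m\<close>.\<close>

definition lip_points :: "(real \<Rightarrow> real) \<Rightarrow> real \<Rightarrow> real \<Rightarrow> real set" where
  "lip_points f M d = {x. \<forall>y. \<bar>y - x\<bar> < d \<longrightarrow> \<bar>f y - f x\<bar> \<le> M * \<bar>y - x\<bar>}"

text \<open>The bound at \<open>X n\<close>, evaluated at the limit \<open>x\<close>, makes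
  \<open>f\<close> continuous along the sequence although \<open>f\<close> is arbitrary elsewhere;
  the bounds at \<open>X n\<close> then pass to the limit. This supplies measurable sets without any
  measurability of \<open>f\<close>.\<close>

lemma closed_lip_points:
  assumes "d > 0" "M \<ge> 0"
  shows "closed (lip_points f M d)"
  unfolding closed_sequential_limits
proof (intro allI impI, elim conjE)
  fix X x assume X: "\<forall>n::nat. X n \<in> lip_points f M d" and lim: "X \<longlonglongrightarrow> x"
  have ev: "eventually (\<lambda>n. \<bar>X n - y\<bar> < d) sequentially" if "\<bar>x - y\<bar> < d" for y
  proof -
    have "(\<lambda>n. \<bar>X n - y\<bar>) \<longlonglongrightarrow> \<bar>x - y\<bar>" using lim by (intro tendsto_intros)
    then show ?thesis using that by (rule order_tendstoD)
  qed
  have ab: "(\<lambda>n. M * \<bar>y - X n\<bar>) \<longlonglongrightarrow> M * \<bar>y - x\<bar>" for y using lim by (intro tendsto_intros)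
  have "(\<lambda>n. \<bar>f x - f (X n)\<bar>) \<longlonglongrightarrow> 0"
  proof (rule tendsto_sandwich[of "\<lambda>_. 0" _ _ "\<lambda>n. M * \<bar>x - X n\<bar>"])
    show "(\<lambda>n. M * \<bar>x - X n\<bar>) \<longlonglongrightarrow> 0" using ab[of x] by simp
    show "eventually (\<lambda>n. \<bar>f x - f (X n)\<bar> \<le> M * \<bar>x - X n\<bar>) sequentially"
      using ev[of x] assms(1) by (auto elim!: eventually_mono) (use X in \<open>auto simp: lip_points_def abs_minus_commute\<close>)
  qed auto
  then have fX: "(\<lambda>n. f x - f (X n)) \<longlonglongrightarrow> 0"
    by (simp add: tendsto_rabs_zero_iff)
  then have "(\<lambda>n. f x - (f x - f (X n))) \<longlonglongrightarrow> f x - 0"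
    by (intro tendsto_intros)
  then have fX: "(\<lambda>n. f (X n)) \<longlonglongrightarrow> f x" by simp
  show "x \<in> lip_points f M d"
    unfolding lip_points_def
  proof (intro CollectI allI impI)
    fix y assume y: "\<bar>y - x\<bar> < d"
    have "eventually (\<lambda>n. \<bar>f y - f (X n)\<bar> \<le> M * \<bar>y - X n\<bar>) sequentially"
      using ev[of y] y by (auto simp: abs_minus_commute elim!: eventually_mono) (use X in \<open>auto simp: lip_points_def abs_minus_commute\<close>)
    moreover have "(\<lambda>n. \<bar>f y - f (X n)\<bar>) \<longlonglongrightarrow> \<bar>f y - f x\<bar>" using fX by (intro tendsto_intros)
    ultimately show "\<bar>f y - f x\<bar> \<le> M * \<bar>y - x\<bar>"
      using ab[of y] by (intro tendsto_le[OF sequentially_bot]) 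
  qed
qed

lemma lip_points_local_lipschitz:
  assumes "x \<in> lip_points f M d" "\<bar>y - x\<bar> < d"
  shows "\<bar>f y - f x\<bar> \<le> M * \<bar>y - x\<bar>"
  using assms by (auto simp: lip_points_def)

text \<open>On a window shorter than \<open>d\<close>, any two points of the set lie within the
  radius of each other's bound, so the pointwise bounds combine into a Lipschitz bound for
  \<open>f\<close> on the set.\<close>

lemma lip_points_interval_extension:
  assumes "d > 0" "M \<ge> 0"
  obtains g where "\<And>x. x \<in> lip_points f M d \<inter> {c..c + d/2} \<Longrightarrow> g x = f x"
    "\<And>x y. \<bar>g x - g y\<bar> \<le> M * \<bar>x - y\<bar>"
proof (rule lipschitz_extension_real[of "lip_points f M d \<inter> {c..c + d/2}" f M])
  fix x y assume "x \<in> lip_points f M d \<inter> {c..c + d/2}" "y \<in> lip_points f M d \<inter> {c..c + d/2}"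
  then have "\<bar>x - y\<bar> < d" using assms(1) by (auto simp: abs_if)
  then show "\<bar>f x - f y\<bar> \<le> M * \<bar>x - y\<bar>"
    using lip_points_local_lipschitz[of y f M d x] \<open>y \<in> _\<close> by auto
qed (use assms that in auto)

text \<open>Stepanov's theorem on one of the closed sets. At a density point \<open>x\<close> of
  \<open>F\<close>, the distance from \<open>x + h\<close> to \<open>F\<close> is
  \<open>o(h)\<close>; hence \<open>b = f - g\<close>, which is bounded by a multiple of this
  distance, has derivative 0 there.\<close>

lemma lip_points_differentiable_AE:
  fixes f :: "real \<Rightarrow> real"
  assumes "d > 0" "M \<ge> 0"
  shows "negligible {x \<in> lip_points f M d. \<not> f differentiable (at x)}"
proof -
  have local: "negligible ({x \<in> lip_points f M d. \<not> f differentiable (at x)} \<inter> {c..c + d/2})" for c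
  proof -
    define F where "F = lip_points f M d \<inter> {c..c + d/2}"
    obtain g where g: "\<And>x. x \<in> F \<Longrightarrow> g x = f x" "\<And>x y. \<bar>g x - g y\<bar> \<le> M * \<bar>x - y\<bar>"
      unfolding F_def using lip_points_interval_extension[OF assms] by metis
    define b where "b = (\<lambda>y. f y - g y)"
    have b: "\<bar>b y\<bar> \<le> 2 * M * \<bar>y - z\<bar>" if "z \<in> F" "\<bar>y - z\<bar> < d" for y z
      using lip_points_local_lipschitz[of z f M d y] g(1)[of z] g(2)[of y z] that unfolding F_def b_def by auto
    define Z where "Z = (\<lambda>k::nat. {x \<in> F. \<forall>d>0. \<exists>r D. 0 < r \<and> r < d \<and> D \<in> sets lebesgue \<and> D \<subseteq> cball x r \<and>
        D \<inter> F = {} \<and> ennreal (inverse (real (Suc k)) * r) \<le> emeasure lebesgue D})"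
    have "negligible (Z k)" for k unfolding Z_def by (rule negligible_non_density) auto
    then have "negligible ((\<Union>k. Z k) \<union> {x. \<not> g differentiable (at x)})"
      by (intro negligible_Un negligible_countable_Union lipschitz_differentiable_AE[OF g(2)]) auto
    moreover have "f differentiable (at x)"
      if x: "x \<in> F" "x \<notin> (\<Union>k. Z k)" "g differentiable (at x)" for x
    proof -
      have "(b has_real_derivative 0) (at x)"
        unfolding DERIV_def LIM_def
      proof (intro allI impI)
        fix r :: real assume "r > 0"
        have "r / (2 * M + 1) > 0" using \<open>r > 0\<close> assms by simp
        then obtain k where k: "inverse (real (Suc k)) < r / (2 * M + 1)" using reals_Archimedean by blast
        define \<epsilon> where "\<epsilon> = inverse (real (Suc k))"
        have \<epsilon>: "\<epsilon> > 0" "\<epsilon> \<le> 1" "(2 * M + 1) * \<epsilon> < r" using k assms by (auto simp: \<epsilon>_def field_simps)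
        have "\<not> (\<forall>d>0. \<exists>r D. 0 < r \<and> r < d \<and> D \<in> sets lebesgue \<and> D \<subseteq> cball x r \<and>
           D \<inter> F = {} \<and> ennreal (\<epsilon> * r) \<le> emeasure lebesgue D)"
          using x by (auto simp: Z_def \<epsilon>_def simp del: emeasure_completion)
        then obtain d' where d': "d' > 0" and dens: "\<And>r D. 0 < r \<Longrightarrow> r < d' \<Longrightarrow> D \<in> sets lebesgue \<Longrightarrow>
           D \<subseteq> cball x r \<Longrightarrow> ennreal (\<epsilon> * r) \<le> emeasure lebesgue D \<Longrightarrow> D \<inter> F \<noteq> {}"
          by blast
        have "dist ((b (x + h) - b x) / h) 0 < r" if h: "h \<noteq> 0" "\<bar>h\<bar> < min (d'/2) d" for h
        proof -
          \<comment> \<open>The small ball has length \<open>2 * \<epsilon> * \<bar>h\<bar>\<close>,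
            exactly the proportion \<open>\<epsilon>\<close> of the radius
            \<open>2 * \<bar>h\<bar>\<close> of a ball around \<open>x\<close> containing it, so
            density puts a point of \<open>F\<close> within
            \<open>\<epsilon> * \<bar>h\<bar>\<close> of \<open>x + h\<close>.\<close>
          have "cball (x + h) (\<epsilon> * \<bar>h\<bar>) \<inter> F \<noteq> {}"
          proof (rule dens[of "2 * \<bar>h\<bar>"])
            have "\<epsilon> * \<bar>h\<bar> \<le> \<bar>h\<bar>" using \<epsilon> by (simp add: mult_left_le_one_le)
            then show "cball (x + h) (\<epsilon> * \<bar>h\<bar>) \<subseteq> cball x (2 * \<bar>h\<bar>)"
              by (auto simp: cball_eq_atLeastAtMost)
            show "ennreal (\<epsilon> * (2 * \<bar>h\<bar>)) \<le> emeasure lebesgue (cball (x + h) (\<epsilon> * \<bar>h\<bar>))"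
              using \<epsilon> by (subst emeasure_lebesgue_cball_real) (auto intro: ennreal_leI)
          qed (use h in auto)
          then obtain z where z: "z \<in> F" "\<bar>x + h - z\<bar> \<le> \<epsilon> * \<bar>h\<bar>"
            by (auto simp: dist_real_def)
          have "\<epsilon> * \<bar>h\<bar> \<le> \<bar>h\<bar>" using \<epsilon> by (simp add: mult_left_le_one_le)
          then have "\<bar>x + h - z\<bar> < d" using z(2) h(2) by (simp add: min_less_iff_conj)
          then have "\<bar>b (x + h)\<bar> \<le> 2 * M * \<bar>x + h - z\<bar>" by (intro b z)
          also have "\<dots> \<le> 2 * M * (\<epsilon> * \<bar>h\<bar>)" using z assms by (intro mult_left_mono) auto
          also have "\<dots> \<le> ((2 * M + 1) * \<epsilon>) * \<bar>h\<bar>" using \<epsilon> by (simp add: algebra_simps)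
          also have "\<dots> < r * \<bar>h\<bar>" using \<epsilon> h by (intro mult_strict_right_mono) auto
          finally have "\<bar>b (x + h)\<bar> < r * \<bar>h\<bar>" .
          moreover have "b x = 0" using g(1)[OF x(1)] by (simp add: b_def)
          ultimately show ?thesis using h by (simp add: dist_real_def field_simps)
        qed
        then show "\<exists>s>0. \<forall>h. h \<noteq> 0 \<and> dist h 0 < s \<longrightarrow> dist ((b (x + h) - b x) / h) 0 < r"
          using d' assms(1) by (intro exI[of _ "min (d'/2) d"]) (auto simp: dist_real_def)
      qed
      then have "b differentiable (at x)" using real_differentiable_def by blast
      then have "(\<lambda>y. b y + g y) differentiable (at x)" using x(3) by (rule differentiable_add)
      then show ?thesis by (simp add: b_def)
    qed
    then have "{x \<in> lip_points f M d. \<not> f differentiable (at x)} \<inter> {c..c + d/2} \<subseteq>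
      (\<Union>k. Z k) \<union> {x. \<not> g differentiable (at x)}"
      unfolding F_def by blast
    ultimately show ?thesis by (rule negligible_subset)
  qed
  have "{x \<in> lip_points f M d. \<not> f differentiable (at x)} \<subseteq>
     (\<Union>n::int. {x \<in> lip_points f M d. \<not> f differentiable (at x)} \<inter> {of_int n * (d/2)..of_int n * (d/2) + d/2})"
  proof
    fix x assume x: "x \<in> {x \<in> lip_points f M d. \<not> f differentiable (at x)}"
    define n where "n = \<lfloor>x / (d/2)\<rfloor>"
    have "of_int n \<le> x / (d/2)" "x / (d/2) \<le> of_int n + 1" unfolding n_def by linarith+
    then have "x \<in> {of_int n * (d/2)..of_int n * (d/2) + d/2}" using assms(1) by (auto simp: field_simps)
    with x show "x \<in> (\<Union>n::int. {x \<in> lip_points f M d. \<not> f differentiable (at x)} \<inter> {of_int n * (d/2)..of_int n * (d/2) + d/2})"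
      by blast
  qed
  moreover have "negligible (\<Union>n::int. {x \<in> lip_points f M d. \<not> f differentiable (at x)} \<inter> {of_int n * (d/2)..of_int n * (d/2) + d/2})"
    by (rule negligible_countable_Union) (use local in auto)
  ultimately show ?thesis by (rule negligible_subset[rotated])
qed

section \<open>Square functions of Lipschitz functions\<close>

lemma dyadic_interval_cover: "(\<Union>n::nat. {1 / 2 ^ n..<2 / 2 ^ n}) = {0<..<2::real}"
proof (intro equalityI subsetI)
  fix t :: real assume "t \<in> (\<Union>n::nat. {1 / 2 ^ n..<2 / 2 ^ n})"
  then obtain n :: nat where n: "1 / 2 ^ n \<le> t" "t < 2 / 2 ^ n" by auto
  have "(0::real) < 1 / 2 ^ n" "2 / 2 ^ n \<le> (2::real)" by (auto simp: field_simps)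
  with n show "t \<in> {0<..<2}" by auto
next
  fix t :: real assume t: "t \<in> {0<..<2}"
  define k where "k = (LEAST n::nat. 1 / 2 ^ n \<le> t)"
  obtain n :: nat where "(1/2) ^ n < t" using real_arch_pow_inv[of t "1/2"] t by auto
  then have "1 / 2 ^ n \<le> t" by (simp add: power_divide)
  then have k: "1 / 2 ^ k \<le> t" unfolding k_def by (rule LeastI)
  have "t < 2 / 2 ^ k"
  proof (cases k)
    case 0 then show ?thesis using t by simp
  next
    case (Suc m)
    then have "\<not> (1 / 2 ^ m \<le> t)" using not_less_Least[of m "\<lambda>n. 1 / 2 ^ n \<le> t"] by (simp add: k_def)
    then show ?thesis using Suc by simp
  qed
  with k show "t \<in> (\<Union>n::nat. {1 / 2 ^ n..<2 / 2 ^ n})" by auto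
qed

lemma dyadic_interval_disjoint: "disjoint_family (\<lambda>n::nat. {1 / 2 ^ n..<2 / 2 ^ n :: real})"
proof -
  have "{1 / 2 ^ n..<2 / 2 ^ n} \<inter> {1 / 2 ^ m..<2 / 2 ^ m :: real} = {}" if "n < m" for n m :: nat
  proof -
    have "(2::real) ^ Suc n \<le> 2 ^ m" using that by (intro power_increasing) auto
    then have "2 / 2 ^ m \<le> (1::real) / 2 ^ n" by (simp add: field_simps)
    then show ?thesis by auto
  qed
  then show ?thesis unfolding disjoint_family_on_def by (metis Int_commute linorder_neqE_nat)
qed

text \<open>The measure \<open>dt / t\<close> is invariant under dilations, so its integral over all
  small scales folds onto the single octave \<open>[1, 2)\<close>. This serves both directions: to
  telescope energies over dyadic scales, and to find scales at which a dyadic sum is finite.\<close>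

lemma nn_integral_dyadic:
  fixes h :: "real \<Rightarrow> ennreal"
  assumes [measurable]: "h \<in> borel_measurable borel"
  shows "(\<integral>\<^sup>+\<tau>. (\<Sum>n. h (\<tau> / 2 ^ n)) * ennreal (1 / \<tau>) * indicator {1..<2} \<tau> \<partial>lborel)
       = (\<integral>\<^sup>+t. h t * ennreal (1 / t) * indicator {0<..<2} t \<partial>lborel)"
proof -
  have "(\<integral>\<^sup>+t. h t * ennreal (1 / t) * indicator {0<..<2} t \<partial>lborel)
      = (\<integral>\<^sup>+t. (\<Sum>n. h t * ennreal (1 / t) * indicator {1 / 2 ^ n..<2 / 2 ^ n} t) \<partial>lborel)"
    by (simp add: suminf_indicator[OF dyadic_interval_disjoint] dyadic_interval_cover)
  also have "\<dots> = (\<Sum>n. \<integral>\<^sup>+t. h t * ennreal (1 / t) * indicator {1 / 2 ^ n..<2 / 2 ^ n} t \<partial>lborel)"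
    by (rule nn_integral_suminf) auto
  also have "\<dots> = (\<Sum>n. \<integral>\<^sup>+\<tau>. h (\<tau> / 2 ^ n) * (ennreal (1 / \<tau>) * indicator {1..<2} \<tau>) \<partial>lborel)"
  proof (intro suminf_cong)
    fix n :: nat
    have comb: "a * (x * b * i) = x * (c * j)" if "(a * b) * i = c * j" for a b c i j x :: ennreal
      using that by (metis mult.assoc mult.left_commute)
    have "(\<integral>\<^sup>+t. h t * ennreal (1 / t) * indicator {1 / 2 ^ n..<2 / 2 ^ n} t \<partial>lborel) =
      ennreal (1 / 2 ^ n) * (\<integral>\<^sup>+\<tau>. h (\<tau> / 2 ^ n) * ennreal (1 / (\<tau> / 2 ^ n)) * indicator {1 / 2 ^ n..<2 / 2 ^ n} (\<tau> / 2 ^ n) \<partial>lborel)"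
      by (subst nn_integral_real_affine[where c="1 / 2 ^ n" and t=0]) (auto simp: field_simps)
    also have "\<dots> = (\<integral>\<^sup>+\<tau>. ennreal (1 / 2 ^ n) * (h (\<tau> / 2 ^ n) * ennreal (1 / (\<tau> / 2 ^ n)) * indicator {1 / 2 ^ n..<2 / 2 ^ n} (\<tau> / 2 ^ n)) \<partial>lborel)"
      by (rule nn_integral_cmult[symmetric]) auto
    also have "\<dots> = (\<integral>\<^sup>+\<tau>. h (\<tau> / 2 ^ n) * (ennreal (1 / \<tau>) * indicator {1..<2} \<tau>) \<partial>lborel)"
    proof (intro nn_integral_cong)
      fix \<tau> :: real
      have "\<tau> / 2 ^ n \<in> {1 / 2 ^ n..<2 / 2 ^ n} \<longleftrightarrow> \<tau> \<in> {1..<2}" by (auto simp: divide_simps)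
      moreover have "ennreal (1 / 2 ^ n) * ennreal (1 / (\<tau> / 2 ^ n)) = ennreal (1 / \<tau>)" if "\<tau> \<in> {1..<2}"
        using that by (subst ennreal_mult[symmetric]) auto
      ultimately have "(ennreal (1 / 2 ^ n) * ennreal (1 / (\<tau> / 2 ^ n))) * indicator {1 / 2 ^ n..<2 / 2 ^ n} (\<tau> / 2 ^ n)
         = ennreal (1 / \<tau>) * indicator {1..<2} \<tau>"
        by (auto simp only: indicator_def of_bool_eq mult_zero_right)
      then show "ennreal (1 / 2 ^ n) * (h (\<tau> / 2 ^ n) * ennreal (1 / (\<tau> / 2 ^ n)) * indicator {1 / 2 ^ n..<2 / 2 ^ n} (\<tau> / 2 ^ n))
         = h (\<tau> / 2 ^ n) * (ennreal (1 / \<tau>) * indicator {1..<2} \<tau>)"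
        using comb by blast
    qed
    finally show "(\<integral>\<^sup>+t. h t * ennreal (1 / t) * indicator {1 / 2 ^ n..<2 / 2 ^ n} t \<partial>lborel) =
      (\<integral>\<^sup>+\<tau>. h (\<tau> / 2 ^ n) * (ennreal (1 / \<tau>) * indicator {1..<2} \<tau>) \<partial>lborel)" .
  qed
  also have "\<dots> = (\<integral>\<^sup>+\<tau>. (\<Sum>n. h (\<tau> / 2 ^ n) * (ennreal (1 / \<tau>) * indicator {1..<2} \<tau>)) \<partial>lborel)"
    by (rule nn_integral_suminf[symmetric]) auto
  finally show ?thesis by (simp add: ac_simps ennreal_suminf_multc)
qed

lemma nn_integral_shift:
  fixes h :: "real \<Rightarrow> ennreal"
  assumes "h \<in> borel_measurable borel"
  shows "(\<integral>\<^sup>+s. h (s + t) \<partial>lborel) = (\<integral>\<^sup>+s. h s \<partial>lborel)"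
  using nn_integral_real_affine[OF assms, of 1 t] by (simp add: add.commute)

definition slope_energy :: "(real \<Rightarrow> real) \<Rightarrow> real \<Rightarrow> ennreal" where
  "slope_energy g t = (\<integral>\<^sup>+s. ennreal (((g (s + t) - g s) / t)\<^sup>2) \<partial>lborel)"

definition diff2_energy :: "(real \<Rightarrow> real) \<Rightarrow> real \<Rightarrow> ennreal" where
  "diff2_energy g t = (\<integral>\<^sup>+s. ennreal ((Delta2 g s t)\<^sup>2) \<partial>lborel)"

lemma borel_measurable_Delta2 [measurable]:
  assumes [measurable]: "g \<in> borel_measurable borel" "u \<in> borel_measurable M" "v \<in> borel_measurable M"
  shows "(\<lambda>x. Delta2 g (u x) (v x)) \<in> borel_measurable M"
  unfolding Delta2_def by measurable

text \<open>Summed over \<open>t / 2 ^ n\<close> this parallelogram identity telescopes; it replaces Plancherel's theorem.\<close>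

lemma energy_identity:
  assumes [measurable]: "g \<in> borel_measurable borel" and "t > 0"
  shows "diff2_energy g t + slope_energy g (2 * t) = slope_energy g t"
proof -
  let ?p = "\<lambda>s. ennreal (((g (s + t) - g s) / t)\<^sup>2)"
  have "slope_energy g (2 * t) = (\<integral>\<^sup>+s. ennreal (((g (s + t) - g (s - t)) / (2 * t))\<^sup>2) \<partial>lborel)"
    unfolding slope_energy_def
    by (subst nn_integral_shift[where t="-t", symmetric]) (auto simp: algebra_simps)
  then have "diff2_energy g t + slope_energy g (2 * t)
    = (\<integral>\<^sup>+s. ennreal ((Delta2 g s t)\<^sup>2) + ennreal (((g (s + t) - g (s - t)) / (2 * t))\<^sup>2) \<partial>lborel)"
    unfolding diff2_energy_def by (simp add: nn_integral_add)
  also have "\<dots> = (\<integral>\<^sup>+s. ennreal (1/2) * ?p s + ennreal (1/2) * ?p (s + (- t)) \<partial>lborel)"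
  proof (intro nn_integral_cong)
    fix s
    have "(Delta2 g s t)\<^sup>2 + ((g (s + t) - g (s - t)) / (2 * t))\<^sup>2
      = 1/2 * ((g (s + t) - g s) / t)\<^sup>2 + 1/2 * ((g s - g (s - t)) / t)\<^sup>2"
      using \<open>t > 0\<close> by (simp add: Delta2_def field_simps power2_eq_square)
    then have "ennreal ((Delta2 g s t)\<^sup>2) + ennreal (((g (s + t) - g (s - t)) / (2 * t))\<^sup>2)
      = ennreal (1/2 * ((g (s + t) - g s) / t)\<^sup>2 + 1/2 * ((g s - g (s - t)) / t)\<^sup>2)"
      by (simp flip: ennreal_plus)
    also have "\<dots> = ennreal (1/2 * ((g (s + t) - g s) / t)\<^sup>2) + ennreal (1/2 * ((g s - g (s - t)) / t)\<^sup>2)"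
      by (rule ennreal_plus) auto
    also have "\<dots> = ennreal (1/2) * ennreal (((g (s + t) - g s) / t)\<^sup>2) + ennreal (1/2) * ennreal (((g s - g (s - t)) / t)\<^sup>2)"
      by (intro arg_cong2[where f="(+)"] ennreal_mult) auto
    also have "\<dots> = ennreal (1/2) * ?p s + ennreal (1/2) * ?p (s + (- t))" by simp
    finally show "ennreal ((Delta2 g s t)\<^sup>2) + ennreal (((g (s + t) - g (s - t)) / (2 * t))\<^sup>2)
      = ennreal (1/2) * ?p s + ennreal (1/2) * ?p (s + (- t))" .
  qed
  also have "\<dots> = ennreal (1/2) * (\<integral>\<^sup>+s. ?p s \<partial>lborel) + ennreal (1/2) * (\<integral>\<^sup>+s. ?p (s + (- t)) \<partial>lborel)"
    by (subst nn_integral_add) (auto simp: nn_integral_cmult)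
  also have "(\<integral>\<^sup>+s. ?p (s + (- t)) \<partial>lborel) = (\<integral>\<^sup>+s. ?p s \<partial>lborel)"
    by (rule nn_integral_shift) auto
  also have "ennreal (1/2) * (\<integral>\<^sup>+s. ?p s \<partial>lborel) + ennreal (1/2) * (\<integral>\<^sup>+s. ?p s \<partial>lborel) = slope_energy g t"
    unfolding slope_energy_def distrib_right[symmetric] by (subst ennreal_plus[symmetric]) auto
  finally show ?thesis .
qed

lemma slope_energy_le:
  assumes lip: "\<And>x y. \<bar>g x - g y\<bar> \<le> L * \<bar>x - y\<bar>"
    and const: "\<And>y. y \<le> c \<Longrightarrow> g y = g c" "\<And>y. e \<le> y \<Longrightarrow> g y = g e" and "c \<le> e" "t > 0"
  shows "slope_energy g t \<le> ennreal (L\<^sup>2 * (e - c + t))"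
proof -
  have "slope_energy g t \<le> (\<integral>\<^sup>+s. ennreal (L\<^sup>2) * indicator {c - t..e} s \<partial>lborel)"
    unfolding slope_energy_def
  proof (intro nn_integral_mono)
    fix s
    have "\<bar>(g (s + t) - g s) / t\<bar> \<le> L" using lip[of "s + t" s] \<open>t > 0\<close> by (simp add: field_simps)
    then have "\<bar>(g (s + t) - g s) / t\<bar>\<^sup>2 \<le> L\<^sup>2" by (intro power_mono) auto
    then have "((g (s + t) - g s) / t)\<^sup>2 \<le> L\<^sup>2" by (simp only: power2_abs)
    moreover have "g (s + t) = g s" if "s \<notin> {c - t..e}"
    proof (cases "s < c - t")
      case True then show ?thesis using const(1)[of s] const(1)[of "s + t"] \<open>t > 0\<close> by simp
    next
      case False then show ?thesis using that const(2)[of s] const(2)[of "s + t"] \<open>t > 0\<close> by simp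
    qed
    ultimately show "ennreal (((g (s + t) - g s) / t)\<^sup>2) \<le> ennreal (L\<^sup>2) * indicator {c - t..e} s"
      by (cases "s \<in> {c - t..e}") (auto intro: ennreal_leI)
  qed
  also have "\<dots> = ennreal (L\<^sup>2 * (e - c + t))"
    using \<open>c \<le> e\<close> \<open>t > 0\<close> by (simp add: nn_integral_cmult_indicator ennreal_mult[symmetric] algebra_simps)
  finally show ?thesis .
qed

text \<open>Along the scales \<open>\<tau> / 2 ^ n\<close> the energies telescope, so each partial
  sum is at most the slope energy at the finest scale. The function is kept constant outside
  \<open>[c, e]\<close> because the slope energy over the whole line could otherwise be
  infinite.\<close>

lemma lipschitz_square_integral:
  assumes lip: "\<And>x y. \<bar>g x - g y\<bar> \<le> L * \<bar>x - y\<bar>"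
    and const: "\<And>y. y \<le> c \<Longrightarrow> g y = g c" "\<And>y. e \<le> y \<Longrightarrow> g y = g e" and "c \<le> e"
  shows "(\<integral>\<^sup>+t. diff2_energy g t * ennreal (1 / t) * indicator {0<..<2} t \<partial>lborel) \<le> ennreal (L\<^sup>2 * (e - c + 4))"
proof -
  have "0 \<le> L" using order_trans[OF abs_ge_zero lip[of 1 0]] by simp
  then have "L-lipschitz_on UNIV g" using lip by (intro lipschitz_onI) (auto simp: dist_real_def)
  then have "continuous_on UNIV g" by (rule lipschitz_on_continuous_on)
  then have g [measurable]: "g \<in> borel_measurable borel" by (rule borel_measurable_continuous_onI)
  have [measurable]: "diff2_energy g \<in> borel_measurable borel" unfolding diff2_energy_def by measurable
  let ?C = "ennreal (L\<^sup>2 * (e - c + 4))"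
  have "(\<integral>\<^sup>+t. diff2_energy g t * ennreal (1 / t) * indicator {0<..<2} t \<partial>lborel) =
     (\<integral>\<^sup>+\<tau>. (\<Sum>n. diff2_energy g (\<tau> / 2 ^ n)) * ennreal (1 / \<tau>) * indicator {1..<2} \<tau> \<partial>lborel)"
    by (rule nn_integral_dyadic[symmetric]) fact
  also have "\<dots> \<le> (\<integral>\<^sup>+\<tau>. ?C * indicator {1..<2::real} \<tau> \<partial>lborel)"
  proof (intro nn_integral_mono)
    fix \<tau> :: real
    have "(\<Sum>n. diff2_energy g (\<tau> / 2 ^ n)) \<le> ?C" if \<tau>: "\<tau> \<in> {1..<2}"
    proof (rule suminf_le_const)
      show "(\<Sum>n<k. diff2_energy g (\<tau> / 2 ^ n)) \<le> ?C" for k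
      proof -
        have "(\<Sum>n<k. diff2_energy g (\<tau> / 2 ^ n)) + slope_energy g (2 * \<tau>) = slope_energy g (2 * \<tau> / 2 ^ k)"
        proof (induction k)
          case (Suc k)
          have "(\<Sum>n<Suc k. diff2_energy g (\<tau> / 2 ^ n)) + slope_energy g (2 * \<tau>)
            = diff2_energy g (\<tau> / 2 ^ k) + ((\<Sum>n<k. diff2_energy g (\<tau> / 2 ^ n)) + slope_energy g (2 * \<tau>))"
            by (simp add: ac_simps)
          also have "\<dots> = diff2_energy g (\<tau> / 2 ^ k) + slope_energy g (2 * (\<tau> / 2 ^ k))"
            by (simp add: Suc)
          also have "\<dots> = slope_energy g (\<tau> / 2 ^ k)"
            using \<tau> by (intro energy_identity g) auto
          finally show ?case by simp
        qed auto
        moreover have "slope_energy g (2 * \<tau> / 2 ^ k) \<le> ?C"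
        proof (rule order_trans[OF slope_energy_le[OF lip const \<open>c \<le> e\<close>]])
          show "0 < 2 * \<tau> / 2 ^ k" using \<tau> by simp
          \<comment> \<open>The finest slope interval is no longer than
            \<open>2 * \<tau> < 4\<close>; this is the 4 in the bound.\<close>
          have "2 * \<tau> / 2 ^ k \<le> 2 * \<tau> / 1" using \<tau> by (intro divide_left_mono) auto
          then have "2 * \<tau> / 2 ^ k \<le> 4" using \<tau> by simp
          then show "ennreal (L\<^sup>2 * (e - c + 2 * \<tau> / 2 ^ k)) \<le> ?C"
            by (intro ennreal_leI mult_left_mono) auto
        qed
        ultimately have "(\<Sum>n<k. diff2_energy g (\<tau> / 2 ^ n)) + slope_energy g (2 * \<tau>) \<le> ?C" by simp
        then show ?thesis by (rule order_trans[OF add_increasing2[OF zero_le order_refl]])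
      qed
    qed auto
    moreover have "ennreal (1 / \<tau>) \<le> 1" if "\<tau> \<in> {1..<2}"
      using that by (auto simp: ennreal_le_1)
    ultimately show "(\<Sum>n. diff2_energy g (\<tau> / 2 ^ n)) * ennreal (1 / \<tau>) * indicator {1..<2} \<tau> \<le> ?C * indicator {1..<2} \<tau>"
      using mult_mono[of "\<Sum>n. diff2_energy g (\<tau> / 2 ^ n)" ?C "ennreal (1 / \<tau>)" 1] by (auto simp: indicator_def)
  qed
  also have "\<dots> = ?C" by (simp add: nn_integral_cmult_indicator)
  finally show ?thesis .
qed

lemma AE_lborel_affine_notin:
  assumes "N \<in> null_sets lborel" "c \<noteq> (0::real)"
  shows "AE s in lborel. a + c * s \<notin> N"
proof -
  have N[measurable]: "N \<in> sets borel" using assms by auto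
  have "ennreal \<bar>c\<bar> * (\<integral>\<^sup>+s. indicator N (a + c * s) \<partial>lborel) = (\<integral>\<^sup>+s. indicator N s \<partial>lborel)"
    by (rule nn_integral_real_affine[symmetric]) (use assms in auto)
  also have "\<dots> = 0" using assms(1) by (auto simp: null_sets_def)
  finally have "(\<integral>\<^sup>+s. indicator N (a + c * s) \<partial>lborel) = (0::ennreal)" using assms(2) by simp
  then have "AE s in lborel. indicator N (a + c * s) = (0::ennreal)"
    by (subst (asm) nn_integral_0_iff_AE) auto
  then show ?thesis by (elim eventually_mono) (auto simp: indicator_def split: if_splits)
qed

text \<open>The condition \<open>\<bar>s - x\<bar> < t\<close> already forces \<open>t > 0\<close>,
  and the single height \<open>\<delta>\<close> takes over the cut-offs by \<open>\<delta>\<close>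
  and by \<open>h0\<close>, so \<open>U\<close> no longer appears. The iterated form is the one to
  which Fubini is applied.\<close>

definition cone_int :: "(real \<Rightarrow> real) \<Rightarrow> real \<Rightarrow> real \<Rightarrow> ennreal" where
  "cone_int g \<delta> x = (\<integral>\<^sup>+t. (\<integral>\<^sup>+s. (if \<bar>s - x\<bar> < t \<and> t < \<delta> then ennreal ((Delta2 g s t)\<^sup>2 / t\<^sup>2) else 0) \<partial>lborel) \<partial>lborel)"

lemma borel_measurable_cone_int [measurable]:
  assumes [measurable]: "g \<in> borel_measurable borel"
  shows "cone_int g \<delta> \<in> borel_measurable borel"
  unfolding cone_int_def by measurable

lemma AE_Delta2_cong:
  assumes "N \<in> null_sets lborel" "\<And>x. x \<notin> N \<Longrightarrow> f x = g x"
  shows "AE s in lborel. Delta2 f s t = Delta2 g s t"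
  using AE_lborel_affine_notin[OF assms(1), where c=1 and a=0, simplified]
    AE_lborel_affine_notin[OF assms(1), where c=1 and a=t, simplified]
    AE_lborel_affine_notin[OF assms(1), where c=1 and a="-t", simplified]
  by eventually_elim (simp add: Delta2_def assms(2) add.commute)

lemma AE_Delta2_cong_pair:
  assumes "N \<in> null_sets lborel" "\<And>x. x \<notin> N \<Longrightarrow> f x = g x"
  shows "AE p in lborel. Delta2 f (fst p) (snd p) = Delta2 g (fst p) (snd p)"
proof -
  have N[measurable]: "N \<in> sets borel" using assms by auto
  have "AE p in lborel \<Otimes>\<^sub>M lborel. fst p \<notin> N \<and> fst p + snd p \<notin> N \<and> fst p - snd p \<notin> N"
  proof (rule lborel_pair.AE_pair_measure)
    show "{x \<in> space (lborel \<Otimes>\<^sub>M lborel). fst x \<notin> N \<and> fst x + snd x \<notin> N \<and> fst x - snd x \<notin> N} \<in> sets (lborel \<Otimes>\<^sub>M lborel)"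
      by measurable
    show "AE x in lborel. AE y in lborel. fst (x, y) \<notin> N \<and> fst (x, y) + snd (x, y) \<notin> N \<and> fst (x, y) - snd (x, y) \<notin> N"
      using AE_not_in[OF assms(1)]
    proof eventually_elim
      fix x assume "x \<notin> N"
      show "AE y in lborel. fst (x, y) \<notin> N \<and> fst (x, y) + snd (x, y) \<notin> N \<and> fst (x, y) - snd (x, y) \<notin> N"
        using AE_lborel_affine_notin[OF assms(1), where c=1 and a=x, simplified]
          AE_lborel_affine_notin[OF assms(1), where c="-1" and a=x, simplified]
        by eventually_elim (use \<open>x \<notin> N\<close> in simp)
    qed
  qed
  then show ?thesis
    unfolding lborel_prod by eventually_elim (simp add: Delta2_def assms(2))
qed

text \<open>\<open>Delta2\<close> evaluates the function at three nonzero linear forms of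
  \<open>(s, t)\<close>, and each pulls null sets of the line back to null sets of the plane. So the
  values of \<open>f\<close> on \<open>N\<close> do not affect the integral.\<close>

lemma cone_int_eq_plane_integral:
  assumes "N \<in> null_sets lborel" "\<And>x. x \<notin> N \<Longrightarrow> f x = g x" and [measurable]: "g \<in> borel_measurable borel"
  shows "(\<integral>\<^sup>+p. (if \<bar>fst p - x\<bar> < snd p \<and> snd p < \<delta> then ennreal ((Delta2 f (fst p) (snd p))\<^sup>2 / (snd p)\<^sup>2) else 0) \<partial>lebesgue)
       = cone_int g \<delta> x"
proof -
  have "(\<integral>\<^sup>+p. (if \<bar>fst p - x\<bar> < snd p \<and> snd p < \<delta> then ennreal ((Delta2 f (fst p) (snd p))\<^sup>2 / (snd p)\<^sup>2) else 0) \<partial>lebesgue)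
    = (\<integral>\<^sup>+p. (if \<bar>fst p - x\<bar> < snd p \<and> snd p < \<delta> then ennreal ((Delta2 g (fst p) (snd p))\<^sup>2 / (snd p)\<^sup>2) else 0) \<partial>lborel)"
  proof -
    have "AE p in lborel. Delta2 f (fst p) (snd p) = Delta2 g (fst p) (snd p)"
      by (rule AE_Delta2_cong_pair[OF assms(1)]) (rule assms(2))
    then show ?thesis
      unfolding nn_integral_completion
      by - (rule nn_integral_cong_AE, erule eventually_mono, simp)
  qed
  also have "\<dots> = cone_int g \<delta> x"
    unfolding lborel_prod[symmetric] cone_int_def
    by (subst lborel_pair.nn_integral_snd[symmetric]) (measurable, simp only: fst_conv snd_conv)
  finally show ?thesis .
qed

section \<open>Marcinkiewicz integrals and the square function at Lipschitz points\<close>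

text \<open>After the shift \<open>y = s + a * t\<close> and Fubini, the integral of
  \<open>(D y)^2 / t^3\<close> over \<open>t > D y / 2\<close> is 2, independently of
  \<open>D y\<close>. The parameter \<open>a\<close> covers the three evaluation points
  \<open>s + t\<close>, \<open>s - t\<close> and \<open>s\<close>.\<close>

lemma marcinkiewicz_integral_le:
  fixes D :: "real \<Rightarrow> real"
  assumes [measurable]: "D \<in> borel_measurable borel" and "\<And>y. D y \<ge> 0" "p \<le> q"
  shows "(\<integral>\<^sup>+t. \<integral>\<^sup>+s. (if s + a * t \<in> {p..q} \<and> D (s + a * t) < 2 * t then ennreal ((D (s + a * t))\<^sup>2 / t ^ 3) else 0) \<partial>lborel \<partial>lborel)
       \<le> ennreal (2 * (q - p))"
proof -
  let ?h = "\<lambda>y t. if y \<in> {p..q} \<and> D y < 2 * t then ennreal ((D y)\<^sup>2 / t ^ 3) else 0"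
  have "(\<integral>\<^sup>+t. \<integral>\<^sup>+s. ?h (s + a * t) t \<partial>lborel \<partial>lborel) = (\<integral>\<^sup>+t. \<integral>\<^sup>+y. ?h y t \<partial>lborel \<partial>lborel)"
    by (intro nn_integral_cong nn_integral_shift) measurable
  also have "\<dots> = (\<integral>\<^sup>+y. \<integral>\<^sup>+t. ?h y t \<partial>lborel \<partial>lborel)"
    by (rule lborel_pair.Fubini') measurable
  also have "\<dots> \<le> (\<integral>\<^sup>+y. ennreal 2 * indicator {p..q} y \<partial>lborel)"
  proof (rule nn_integral_mono)
    fix y :: real
    show "(\<integral>\<^sup>+t. ?h y t \<partial>lborel) \<le> ennreal 2 * indicator {p..q} y"
    proof (cases "y \<in> {p..q} \<and> D y > 0")
      case True
      define F where "F = (\<lambda>t. - ((D y)\<^sup>2 / (2 * t\<^sup>2)))"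
      have "(\<integral>\<^sup>+t. ?h y t \<partial>lborel) \<le> (\<integral>\<^sup>+t. ennreal ((D y)\<^sup>2 / t ^ 3) * indicator {D y / 2..} t \<partial>lborel)"
        by (intro nn_integral_mono) (auto simp: indicator_def)
      also have "\<dots> = ennreal (0 - F (D y / 2))"
      proof (rule nn_integral_FTC_atLeast)
        fix t assume "D y / 2 \<le> t"
        then have "t > 0" using True by auto
        then show "(F has_real_derivative (D y)\<^sup>2 / t ^ 3) (at t)"
          unfolding F_def by (auto intro!: derivative_eq_intros simp: field_simps power2_eq_square power3_eq_cube)
        show "0 \<le> (D y)\<^sup>2 / t ^ 3" using \<open>t > 0\<close> by simp
      next
        have "((\<lambda>t. (D y)\<^sup>2 / (2 * t\<^sup>2)) \<longlongrightarrow> 0) at_top"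
          by (intro tendsto_divide_0[OF tendsto_const] filterlim_at_top_imp_at_infinity
              filterlim_tendsto_pos_mult_at_top[OF tendsto_const] filterlim_pow_at_top filterlim_ident) auto
        then show "(F \<longlongrightarrow> 0) at_top"
          unfolding F_def using tendsto_minus by fastforce
      qed auto
      also have "\<dots> = ennreal 2" using True by (simp add: F_def power2_eq_square)
      finally show ?thesis using True by simp
    next
      case False
      then have "?h y t = 0" for t using assms(2)[of y] by (auto simp: less_le)
      then show ?thesis by simp
    qed
  qed
  also have "\<dots> = ennreal (2 * (q - p))"
    using assms(3) ennreal_mult[of 2 "q - p"] by (simp add: nn_integral_cmult_indicator)
  finally show ?thesis .
qed

text \<open>In the application \<open>u\<close>, \<open>v\<close>, \<open>w\<close> are the
  distances of \<open>s + t\<close>, \<open>s - t\<close>, \<open>s\<close> to the good set, and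
  \<open>2 * t\<close> is the length of the set of vertices \<open>x\<close> whose cone contains
  \<open>(s, t)\<close>. The constant 48 is \<open>2 * 2 * 12\<close>: the factor
  \<open>2 * t / t^2\<close>, the splitting of the square, and a generous bound for
  \<open>(u + v + 2 * w)^2\<close>.\<close>

lemma diff2_square_split_le:
  fixes \<Delta>f \<Delta>g M t u v w :: real
  assumes "\<bar>\<Delta>f - \<Delta>g\<bar> \<le> M * (u + v + 2 * w) / t" "t > 0" 
  shows "2 * t * (\<Delta>f\<^sup>2 / t\<^sup>2) \<le> 4 * (\<Delta>g\<^sup>2 * (1 / t)) + 48 * M\<^sup>2 * (u\<^sup>2 / t ^ 3 + v\<^sup>2 / t ^ 3 + w\<^sup>2 / t ^ 3)"
proof -
  have sq: "2 * x * y \<le> x\<^sup>2 + y\<^sup>2" for x y :: real using sum_squares_bound[of x y] by simp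
  have "\<Delta>f\<^sup>2 = (\<Delta>g + (\<Delta>f - \<Delta>g))\<^sup>2" by simp
  also have "\<dots> \<le> 2 * \<Delta>g\<^sup>2 + 2 * (\<Delta>f - \<Delta>g)\<^sup>2"
    using sq[of \<Delta>g "\<Delta>f - \<Delta>g"] unfolding power2_sum by linarith
  also have "\<bar>\<Delta>f - \<Delta>g\<bar>\<^sup>2 \<le> (M * (u + v + 2 * w) / t)\<^sup>2"
    using assms by (intro power_mono) auto
  then have "(\<Delta>f - \<Delta>g)\<^sup>2 \<le> M\<^sup>2 * (u + v + 2 * w)\<^sup>2 / t\<^sup>2"
    by (simp add: power_mult_distrib power_divide)
  also have "(u + v + 2 * w)\<^sup>2 \<le> 12 * (u\<^sup>2 + v\<^sup>2 + w\<^sup>2)"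
  proof -
    have "(u + v + 2 * w)\<^sup>2 = u\<^sup>2 + v\<^sup>2 + 4 * w\<^sup>2 + 2 * u * v + 2 * (2 * u * w) + 2 * (2 * v * w)"
      by (simp add: power2_eq_square algebra_simps)
    then show ?thesis
      using sq[of u v] sq[of u w] sq[of v w] zero_le_power2[of u] zero_le_power2[of v] zero_le_power2[of w]
      unfolding distrib_left by linarith
  qed
  finally have "\<Delta>f\<^sup>2 \<le> 2 * \<Delta>g\<^sup>2 + 2 * (M\<^sup>2 * (12 * (u\<^sup>2 + v\<^sup>2 + w\<^sup>2)) / t\<^sup>2)"
    using assms(2) by (simp add: mult_left_mono divide_right_mono)
  then have "(2 / t) * \<Delta>f\<^sup>2 \<le> (2 / t) * (2 * \<Delta>g\<^sup>2 + 2 * (M\<^sup>2 * (12 * (u\<^sup>2 + v\<^sup>2 + w\<^sup>2)) / t\<^sup>2))"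
    using assms(2) by (intro mult_left_mono) auto
  also have "(2 / t) * \<Delta>f\<^sup>2 = 2 * t * (\<Delta>f\<^sup>2 / t\<^sup>2)"
    using assms(2) by (simp add: field_simps power2_eq_square)
  also have "(2 / t) * (2 * \<Delta>g\<^sup>2 + 2 * (M\<^sup>2 * (12 * (u\<^sup>2 + v\<^sup>2 + w\<^sup>2)) / t\<^sup>2))
     = 4 * (\<Delta>g\<^sup>2 * (1 / t)) + 48 * M\<^sup>2 * (u\<^sup>2 / t ^ 3 + v\<^sup>2 / t ^ 3 + w\<^sup>2 / t ^ 3)"
    using assms(2) by (simp add: field_simps power2_eq_square power3_eq_cube)
  finally show ?thesis .
qed

text \<open>The cone integrals are integrated over all vertices in \<open>F\<close>. By Fubini,
  \<open>(s, t)\<close> is then counted with weight at most \<open>2 * t\<close>, and only if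
  \<open>D s < t\<close>. On this region the Lipschitz part \<open>g\<close> has finite energy, and
  the error \<open>f - g\<close>, at most \<open>2 * M * D\<close>, gives three Marcinkiewicz
  integrals.\<close>

lemma local_lip_points_cone_int_finite:
  fixes f :: "real \<Rightarrow> real"
  assumes "d > 0" "M \<ge> 0" "N \<in> null_sets lborel" "\<And>x. x \<notin> N \<Longrightarrow> f x = h x"
    and [measurable]: "h \<in> borel_measurable borel"
  shows "AE x in lborel. x \<in> lip_points f M d \<inter> {c..c + d/2} \<longrightarrow> (\<exists>\<delta>>0. cone_int h \<delta> x < \<infinity>)"
proof (cases "lip_points f M d \<inter> {c..c + d/2} = {}")
  case False
  define F where "F = lip_points f M d \<inter> {c..c + d/2}"
  define e where "e = c + d/2"
  have "c \<le> e" using assms(1) by (simp add: e_def)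
  have "closed F" unfolding F_def using assms by (intro closed_Int closed_lip_points) auto
  then have [measurable]: "F \<in> sets borel" by (rule borel_closed)
  have "F \<noteq> {}" using False by (simp add: F_def)
  have Fsub: "F \<subseteq> {c..e}" by (auto simp: F_def e_def)
  \<comment> \<open>For \<open>D s < t < d / 4\<close> the points \<open>s\<close>,
    \<open>s + t\<close>, \<open>s - t\<close> are closer to \<open>F\<close> than \<open>d\<close>,
    so the bounds at their nearest points of \<open>F\<close> apply; \<open>t < 1\<close> keeps them
    within 2 of \<open>[c, e]\<close>.\<close>
  define \<delta> where "\<delta> = min (d / 4) 1"
  have \<delta>: "\<delta> > 0" "\<delta> \<le> d / 4" "\<delta> \<le> 1" using assms(1) by (auto simp: \<delta>_def)
  obtain g0 where g0: "\<And>x. x \<in> F \<Longrightarrow> g0 x = f x" "\<And>x y. \<bar>g0 x - g0 y\<bar> \<le> M * \<bar>x - y\<bar>"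
    unfolding F_def using lip_points_interval_extension[OF assms(1,2)] by metis
  \<comment> \<open>Clamping the argument to \<open>[c, e]\<close> keeps the Lipschitz constant and
    makes \<open>g\<close> constant outside, as the energy bound requires.\<close>
  define g where "g = (\<lambda>y. g0 (max c (min e y)))"
  have gF: "g x = f x" if "x \<in> F" for x using that Fsub g0(1)[of x] by (auto simp: g_def max_absorb2 min_absorb2)
  have glip: "\<bar>g x - g y\<bar> \<le> M * \<bar>x - y\<bar>" for x y
  proof -
    have mx: "\<bar>max c a - max c b\<bar> \<le> \<bar>a - b\<bar>" for a b :: real by (simp add: max_def)
    have mn: "\<bar>min e a - min e b\<bar> \<le> \<bar>a - b\<bar>" for a b :: real by (simp add: min_def)
    show ?thesis unfolding g_def
      by (rule order_trans[OF g0(2) mult_left_mono[OF order_trans[OF mx mn] \<open>M \<ge> 0\<close>]])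
  qed
  have "M-lipschitz_on UNIV g" using glip \<open>M \<ge> 0\<close> by (intro lipschitz_onI) (auto simp: dist_real_def)
  then have "continuous_on UNIV g" by (rule lipschitz_on_continuous_on)
  then have g[measurable]: "g \<in> borel_measurable borel" by (rule borel_measurable_continuous_onI)
  define D where "D = (\<lambda>y. infdist y F)"
  have [measurable]: "D \<in> borel_measurable borel"
    unfolding D_def by (intro borel_measurable_continuous_onI continuous_on_infdist continuous_on_id)
  have D0: "D y \<ge> 0" for y by (simp add: D_def infdist_nonneg)
  have Ddist: "D y \<le> \<bar>y - z\<bar>" if "z \<in> F" for y z
    using infdist_le[OF that, of y] by (simp add: D_def dist_real_def)
  have Dtri: "D y \<le> D z + \<bar>y - z\<bar>" for y z
    using infdist_triangle[of y F z] by (simp add: D_def dist_real_def)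
  obtain near where near: "\<And>y. near y \<in> F" "\<And>y. D y = \<bar>y - near y\<bar>"
  proof -
    have "\<exists>z. z \<in> F \<and> D y = \<bar>y - z\<bar>" for y
      using infdist_attains_inf[OF \<open>closed F\<close> \<open>F \<noteq> {}\<close>, of y] unfolding D_def dist_real_def by blast
    then show thesis using that by metis
  qed
  have b: "\<bar>f y - g y\<bar> \<le> 2 * M * D y" if "D y < d" for y
  proof -
    have "\<bar>f y - f (near y)\<bar> \<le> M * \<bar>y - near y\<bar>"
      using near[of y] that by (intro lip_points_local_lipschitz[of _ _ _ d]) (auto simp: F_def)
    then show ?thesis using glip[of y "near y"] gF[OF near(1), of y] near(2)[of y] by simp
  qed
  let ?p = "c - 2" and ?q = "e + 2"
  define W where "W = (\<lambda>a s t. if s + a * t \<in> {?p..?q} \<and> D (s + a * t) < 2 * t then (D (s + a * t))\<^sup>2 / t ^ 3 else 0)"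
  have W0: "W a s t \<ge> 0" if "t > 0" for a s t using that by (auto simp: W_def)
  have Wmeas[measurable]: "(\<lambda>x. W a (u x) (v x)) \<in> borel_measurable R"
    if [measurable]: "u \<in> borel_measurable R" "v \<in> borel_measurable R" for a u v and R :: "'z measure"
    unfolding W_def by measurable
  have pw: "2 * t * ((Delta2 f s t)\<^sup>2 / t\<^sup>2) \<le> 4 * ((Delta2 g s t)\<^sup>2 * (1 / t)) + 48 * M\<^sup>2 * (W 1 s t + W (-1) s t + W 0 s t)"
    if "D s < t" "t < \<delta>" for s t
  proof -
    have "t > 0" using that D0[of s] by simp
    have Dd: "D (s + t) < 2 * t" "D (s - t) < 2 * t" "D s < 2 * t"
      using Dtri[of "s + t" s] Dtri[of "s - t" s] that \<open>t > 0\<close> by auto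
    have "s \<in> {c - 1..e + 1}" using near[of s] Fsub that \<delta> by (auto simp: abs_if split: if_splits) 
    then have box: "s + t \<in> {?p..?q}" "s - t \<in> {?p..?q}" "s \<in> {?p..?q}" using that \<delta> \<open>t > 0\<close> by auto
    have tri: "\<bar>a + b - 2 * c\<bar> \<le> \<bar>a\<bar> + \<bar>b\<bar> + 2 * \<bar>c\<bar>" for a b c :: real by linarith
    have "\<bar>Delta2 f s t - Delta2 g s t\<bar> = \<bar>(f (s + t) - g (s + t)) + (f (s - t) - g (s - t)) - 2 * (f s - g s)\<bar> / (2 * t)"
    proof -
      have "Delta2 f s t - Delta2 g s t = ((f (s + t) - g (s + t)) + (f (s - t) - g (s - t)) - 2 * (f s - g s)) / (2 * t)"
        using \<open>t > 0\<close> by (simp add: Delta2_def diff_divide_distrib[symmetric])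
      then show ?thesis using \<open>t > 0\<close> by (simp only: abs_divide)
    qed
    also have "\<dots> \<le> (2 * M * D (s + t) + 2 * M * D (s - t) + 2 * (2 * M * D s)) / (2 * t)"
    proof (rule divide_right_mono[OF order_trans[OF tri]])
      have "D (s + t) < d" "D (s - t) < d" "D s < d" using Dd that \<delta> \<open>t > 0\<close> by linarith+
      then have "\<bar>f (s + t) - g (s + t)\<bar> \<le> 2 * M * D (s + t)" "\<bar>f (s - t) - g (s - t)\<bar> \<le> 2 * M * D (s - t)"
        "\<bar>f s - g s\<bar> \<le> 2 * M * D s" by (auto intro: b)
      then show "\<bar>f (s + t) - g (s + t)\<bar> + \<bar>f (s - t) - g (s - t)\<bar> + 2 * \<bar>f s - g s\<bar>
          \<le> 2 * M * D (s + t) + 2 * M * D (s - t) + 2 * (2 * M * D s)"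
        by (intro add_mono mult_left_mono) auto
    qed (use \<open>t > 0\<close> in simp)
    also have "\<dots> = M * (D (s + t) + D (s - t) + 2 * D s) / t"
      using \<open>t > 0\<close> by (simp add: field_simps)
    finally have "2 * t * ((Delta2 f s t)\<^sup>2 / t\<^sup>2) \<le> 4 * ((Delta2 g s t)\<^sup>2 * (1 / t)) +
        48 * M\<^sup>2 * ((D (s + t))\<^sup>2 / t ^ 3 + (D (s - t))\<^sup>2 / t ^ 3 + (D s)\<^sup>2 / t ^ 3)"
      using \<open>t > 0\<close> by (rule diff2_square_split_le)
    then show ?thesis using Dd box by (simp add: W_def)
  qed
  \<comment> \<open>The pointwise estimate concerns \<open>f\<close>, the integrals concern
    \<open>h\<close>; for each \<open>t\<close> they are exchanged off a null set of
    \<open>s\<close>.\<close>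
  have eq_AE: "AE s in lborel. Delta2 f s t = Delta2 h s t" for t
    by (rule AE_Delta2_cong[OF assms(3)]) (rule assms(4))
  have split_ennreal: "ennreal (4 * (A * B) + K * (u + v + w)) = 4 * (ennreal A * ennreal B) + ennreal K * (ennreal u + ennreal v + ennreal w)"
    if "A \<ge> 0" "B \<ge> 0" "K \<ge> 0" "u \<ge> 0" "v \<ge> 0" "w \<ge> 0" for A B K u v w :: real
    using that by (simp add: ennreal_mult)
  let ?H = "\<lambda>s t. (Delta2 h s t)\<^sup>2 / t\<^sup>2"
  let ?I = "\<lambda>x s t. if x \<in> F \<and> \<bar>s - x\<bar> < t \<and> t < \<delta> then ennreal (?H s t) else 0"
  let ?Eg = "\<integral>\<^sup>+t. diff2_energy g t * ennreal (1 / t) * indicator {0<..<2} t \<partial>lborel"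
  let ?W = "\<lambda>a. \<integral>\<^sup>+t. \<integral>\<^sup>+s. ennreal (W a s t) \<partial>lborel \<partial>lborel"
  have "(\<integral>\<^sup>+x. (if x \<in> F then cone_int h \<delta> x else 0) \<partial>lborel) = (\<integral>\<^sup>+x. \<integral>\<^sup>+t. \<integral>\<^sup>+s. ?I x s t \<partial>lborel \<partial>lborel \<partial>lborel)"
    unfolding cone_int_def by (intro nn_integral_cong) auto
  also have "\<dots> = (\<integral>\<^sup>+t. \<integral>\<^sup>+x. \<integral>\<^sup>+s. ?I x s t \<partial>lborel \<partial>lborel \<partial>lborel)"
    by (rule lborel_pair.Fubini'[symmetric]) measurable
  also have "\<dots> = (\<integral>\<^sup>+t. \<integral>\<^sup>+s. \<integral>\<^sup>+x. ?I x s t \<partial>lborel \<partial>lborel \<partial>lborel)"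
    by (intro nn_integral_cong lborel_pair.Fubini'[symmetric]) measurable
  also have "\<dots> \<le> (\<integral>\<^sup>+t. \<integral>\<^sup>+s. (if D s < t \<and> t < \<delta> then ennreal (2 * t * ?H s t) else 0) \<partial>lborel \<partial>lborel)"
  proof (intro nn_integral_mono)
    fix t s :: real
    show "(\<integral>\<^sup>+x. ?I x s t \<partial>lborel) \<le> (if D s < t \<and> t < \<delta> then ennreal (2 * t * ?H s t) else 0)"
    proof (cases "D s < t \<and> t < \<delta>")
      case True
      then have "t > 0" using D0[of s] by simp
      have "(\<integral>\<^sup>+x. ?I x s t \<partial>lborel) \<le> (\<integral>\<^sup>+x. ennreal (?H s t) * indicator {s - t..s + t} x \<partial>lborel)"
        by (intro nn_integral_mono) (auto simp: indicator_def)
      also have "\<dots> = ennreal (?H s t) * ennreal (2 * t)"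
        using \<open>t > 0\<close> by (simp add: nn_integral_cmult_indicator)
      also have "\<dots> = ennreal (2 * t * ?H s t)"
        using \<open>t > 0\<close> by (subst ennreal_mult[symmetric]) (auto simp: mult.commute)
      finally show ?thesis using True by simp
    next
      case False
      then have "?I x s t = 0" for x using Ddist[of x s] by auto
      then show ?thesis using False by simp
    qed
  qed
  also have "\<dots> \<le> (\<integral>\<^sup>+t. \<integral>\<^sup>+s. 4 * (ennreal ((Delta2 g s t)\<^sup>2) * ennreal (1 / t) * indicator {0<..<2} t) +
        ennreal (48 * M\<^sup>2) * (ennreal (W 1 s t) + ennreal (W (-1) s t) + ennreal (W 0 s t)) \<partial>lborel \<partial>lborel)"
  proof (rule nn_integral_mono)
    fix t :: real
    show "(\<integral>\<^sup>+s. (if D s < t \<and> t < \<delta> then ennreal (2 * t * ?H s t) else 0) \<partial>lborel) \<le>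
      (\<integral>\<^sup>+s. 4 * (ennreal ((Delta2 g s t)\<^sup>2) * ennreal (1 / t) * indicator {0<..<2} t) +
        ennreal (48 * M\<^sup>2) * (ennreal (W 1 s t) + ennreal (W (-1) s t) + ennreal (W 0 s t)) \<partial>lborel)"
      using eq_AE[of t]
    proof (intro nn_integral_mono_AE, eventually_elim)
      fix s assume eq: "Delta2 f s t = Delta2 h s t"
      show "(if D s < t \<and> t < \<delta> then ennreal (2 * t * ?H s t) else 0) \<le>
        4 * (ennreal ((Delta2 g s t)\<^sup>2) * ennreal (1 / t) * indicator {0<..<2} t) +
        ennreal (48 * M\<^sup>2) * (ennreal (W 1 s t) + ennreal (W (-1) s t) + ennreal (W 0 s t))"
      proof (cases "D s < t \<and> t < \<delta>")
        case True
        then have "0 < t" "t < 2" using D0[of s] \<delta> by auto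
        have "ennreal (2 * t * ?H s t) \<le> ennreal (4 * ((Delta2 g s t)\<^sup>2 * (1 / t)) + 48 * M\<^sup>2 * (W 1 s t + W (-1) s t + W 0 s t))"
          using pw[of s t] True eq by (intro ennreal_leI) simp
        also have "\<dots> = 4 * (ennreal ((Delta2 g s t)\<^sup>2) * ennreal (1 / t)) +
          ennreal (48 * M\<^sup>2) * (ennreal (W 1 s t) + ennreal (W (-1) s t) + ennreal (W 0 s t))"
          using \<open>0 < t\<close> W0[OF \<open>0 < t\<close>]
          by (intro split_ennreal) auto
        finally show ?thesis using True \<open>0 < t\<close> \<open>t < 2\<close> by simp
      qed auto
    qed
  qed
  also have "\<dots> = 4 * ?Eg + ennreal (48 * M\<^sup>2) * (?W 1 + ?W (-1) + ?W 0)"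
    unfolding diff2_energy_def by (simp add: nn_integral_add nn_integral_cmult nn_integral_multc)
  also have "\<dots> < \<infinity>"
  proof -
    have "?Eg \<le> ennreal (M\<^sup>2 * (e - c + 4))"
    proof (rule lipschitz_square_integral[OF glip _ _ \<open>c \<le> e\<close>])
      show "g y = g c" if "y \<le> c" for y using that \<open>c \<le> e\<close> by (simp add: g_def)
      show "g y = g e" if "e \<le> y" for y using that \<open>c \<le> e\<close> by (simp add: g_def)
    qed
    then have 1: "?Eg < \<infinity>" by (rule le_less_trans) simp
    have 2: "?W a < \<infinity>" for a
    proof -
      have "?W a = (\<integral>\<^sup>+t. \<integral>\<^sup>+s. (if s + a * t \<in> {?p..?q} \<and> D (s + a * t) < 2 * t then ennreal ((D (s + a * t))\<^sup>2 / t ^ 3) else 0) \<partial>lborel \<partial>lborel)"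
        unfolding W_def by (intro nn_integral_cong) simp
      also have "\<dots> \<le> ennreal (2 * (?q - ?p))"
        using \<open>c \<le> e\<close> D0 by (intro marcinkiewicz_integral_le) auto
      finally show ?thesis by (rule le_less_trans) simp
    qed
    show ?thesis using 1 2 by (simp add: ennreal_mult_less_top)
  qed
  finally have "(\<integral>\<^sup>+x. (if x \<in> F then cone_int h \<delta> x else 0) \<partial>lborel) \<noteq> \<infinity>" by simp
  then have "AE x in lborel. (if x \<in> F then cone_int h \<delta> x else 0) \<noteq> \<infinity>"
    by (intro nn_integral_PInf_AE) auto
  then show ?thesis
    by eventually_elim (use \<delta>(1) in \<open>auto simp: F_def less_top intro!: exI[of _ \<delta>]\<close>)
qed simp

lemma lip_points_cone_int_finite:
  fixes f :: "real \<Rightarrow> real"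
  assumes "d > 0" "M \<ge> 0" "N \<in> null_sets lborel" "\<And>x. x \<notin> N \<Longrightarrow> f x = h x"
    and "h \<in> borel_measurable borel"
  shows "AE x in lborel. x \<in> lip_points f M d \<longrightarrow> (\<exists>\<delta>>0. cone_int h \<delta> x < \<infinity>)"
proof -
  have "AE x in lborel. \<forall>n::int. x \<in> lip_points f M d \<inter> {of_int n * (d/2)..of_int n * (d/2) + d/2} \<longrightarrow>
      (\<exists>\<delta>>0. cone_int h \<delta> x < \<infinity>)"
    by (intro AE_all_countable[THEN iffD2] allI local_lip_points_cone_int_finite[OF assms])
  then show ?thesis
  proof eventually_elim
    fix x assume *: "\<forall>n::int. x \<in> lip_points f M d \<inter> {of_int n * (d/2)..of_int n * (d/2) + d/2} \<longrightarrow>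
      (\<exists>\<delta>>0. cone_int h \<delta> x < \<infinity>)"
    define n where "n = \<lfloor>x / (d/2)\<rfloor>"
    have "of_int n \<le> x / (d/2)" "x / (d/2) \<le> of_int n + 1" unfolding n_def by linarith+
    then have "x \<in> {of_int n * (d/2)..of_int n * (d/2) + d/2}" using assms(1) by (auto simp: field_simps)
    then show "x \<in> lip_points f M d \<longrightarrow> (\<exists>\<delta>>0. cone_int h \<delta> x < \<infinity>)" using * by blast
  qed
qed

section \<open>The dyadic slope martingale\<close>

definition rmod :: "real \<Rightarrow> real \<Rightarrow> real" where
  "rmod d y = y - d * of_int \<lfloor>y / d\<rfloor>"

lemma rmod_bounds: "d > 0 \<Longrightarrow> 0 \<le> rmod d y" "d > 0 \<Longrightarrow> rmod d y < d"
proof -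
  assume "d > 0"
  then show "0 \<le> rmod d y" "rmod d y < d"
    using floor_divide_lower[of d y] floor_divide_upper[of d y] by (auto simp: rmod_def algebra_simps)
qed

lemma rmod_add_mult: "d > 0 \<Longrightarrow> rmod d (y + of_int m * d) = rmod d y"
  by (simp add: rmod_def add_divide_distrib algebra_simps)

lemma rmod_eq_self: "0 \<le> y \<Longrightarrow> y < d \<Longrightarrow> rmod d y = y"
  by (simp add: rmod_def floor_eq_iff field_simps)

lemma borel_measurable_rmod [measurable]:
  assumes [measurable]: "u \<in> borel_measurable M"
  shows "(\<lambda>x. rmod d (u x)) \<in> borel_measurable M"
  unfolding rmod_def by measurable

text \<open>With \<open>d = l / 2 ^ n\<close>, the point \<open>x - rmod d y\<close> is the left end of the cell containing \<open>x\<close> in the grid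
  of mesh \<open>d\<close> through \<open>x - y\<close>, so \<open>y\<close> parametrises the translates of the dyadic grid.\<close>

definition cell_slope :: "(real \<Rightarrow> real) \<Rightarrow> real \<Rightarrow> nat \<Rightarrow> real \<Rightarrow> real \<Rightarrow> real" where
  "cell_slope g l n x y = (g (x - rmod (l / 2 ^ n) y + l / 2 ^ n) - g (x - rmod (l / 2 ^ n) y)) / (l / 2 ^ n)"

definition cell_diff2 :: "(real \<Rightarrow> real) \<Rightarrow> real \<Rightarrow> nat \<Rightarrow> real \<Rightarrow> real \<Rightarrow> real" where
  "cell_diff2 g l n x y = Delta2 g (x - rmod (l / 2 ^ n) y + l / 2 ^ n / 2) (l / 2 ^ n / 2)"

lemma borel_measurable_cell [measurable]:
  assumes [measurable]: "g \<in> borel_measurable borel" "u \<in> borel_measurable M" "v \<in> borel_measurable M"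
  shows "(\<lambda>x. cell_slope g l n (u x) (v x)) \<in> borel_measurable M"
    "(\<lambda>x. cell_diff2 g l n (u x) (v x)) \<in> borel_measurable M"
  unfolding cell_slope_def cell_diff2_def by measurable

text \<open>The slopes of \<open>g\<close> over the dyadic cells of \<open>[a, a + l)\<close> around \<open>x\<close> form a martingale with increments
  \<open>\<plusminus> cell_diff2\<close>. The estimate is Chebyshev's inequality for that martingale, stopped before its square function
  exceeds \<open>\<beta>\<close>.\<close>

lemma cell_slope_maximal:
  fixes g :: "real \<Rightarrow> real"
  assumes "K > 0" "l > 0" "\<beta> \<ge> 0"
  shows "\<exists>B \<in> sets borel.
     {x. a \<le> x \<and> x < a + l \<and> (\<Sum>k<n. (cell_diff2 g l k x (x - a))\<^sup>2) \<le> \<beta> \<and> (\<exists>k\<le>n. K < \<bar>cell_slope g l k x (x - a)\<bar>)} \<subseteq> B \<and>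
     emeasure lborel B \<le> ennreal (l * (((g (a + l) - g a) / l)\<^sup>2 + \<beta>) / K\<^sup>2)"
  using assms(2,3)
proof (induction n arbitrary: a l \<beta>)
  case (0 a l \<beta>)
  define s where "s = (g (a + l) - g a) / l"
  show ?case
  proof (cases "K < \<bar>s\<bar>")
    case True
    then have "K\<^sup>2 \<le> \<bar>s\<bar>\<^sup>2" using \<open>K > 0\<close> by (intro power_mono) auto
    then have "K\<^sup>2 \<le> s\<^sup>2 + \<beta>" using 0 by simp
    then have "l * K\<^sup>2 \<le> l * (s\<^sup>2 + \<beta>)" using 0 by (intro mult_left_mono) auto
    then have "l \<le> l * (s\<^sup>2 + \<beta>) / K\<^sup>2" using \<open>K > 0\<close> by (simp add: pos_le_divide_eq)
    then show ?thesis using 0 unfolding s_def[symmetric]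
      by (intro bexI[of _ "{a..<a + l}"]) (auto intro: ennreal_leI)
  next
    case False
    have "cell_slope g l 0 x (x - a) = s" if "a \<le> x" "x < a + l" for x
      using that by (simp add: cell_slope_def s_def rmod_eq_self)
    then have "{x. a \<le> x \<and> x < a + l \<and> (\<Sum>k<0. (cell_diff2 g l k x (x - a))\<^sup>2) \<le> \<beta> \<and>
        (\<exists>k\<le>0. K < \<bar>cell_slope g l k x (x - a)\<bar>)} = {}"
      using False by auto
    then show ?thesis by (intro bexI[of _ "{}"]) auto
  qed
next
  case (Suc n a l \<beta>)
  define s where "s = (g (a + l) - g a) / l"
  define \<Delta> where "\<Delta> = Delta2 g (a + l / 2) (l / 2)"
  let ?A = "{x. a \<le> x \<and> x < a + l \<and> (\<Sum>k<Suc n. (cell_diff2 g l k x (x - a))\<^sup>2) \<le> \<beta> \<and>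
        (\<exists>k\<le>Suc n. K < \<bar>cell_slope g l k x (x - a)\<bar>)}"
  have cs0: "cell_slope g l 0 x (x - a) = s" if "a \<le> x" "x < a + l" for x
    using that by (simp add: cell_slope_def s_def rmod_eq_self)
  have cd0: "cell_diff2 g l 0 x (x - a) = \<Delta>" if "a \<le> x" "x < a + l" for x
    using that by (simp add: cell_diff2_def \<Delta>_def rmod_eq_self)
  \<comment> \<open>The stopping rule. If the slope already exceeds \<open>K\<close>, the whole
    interval is taken, with \<open>l \<le> l * s^2 / K^2\<close>. If the first increment exhausts
    \<open>\<beta>\<close>, the set is empty. Otherwise the two halves continue with the remaining
    budget \<open>\<beta> - \<Delta>^2\<close>.\<close>
  consider "K < \<bar>s\<bar>" | "\<bar>s\<bar> \<le> K" "\<Delta>\<^sup>2 > \<beta>" | "\<bar>s\<bar> \<le> K" "\<Delta>\<^sup>2 \<le> \<beta>" by linarith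
  then show ?case
  proof cases
    case 1
    then have "K\<^sup>2 \<le> \<bar>s\<bar>\<^sup>2" using \<open>K > 0\<close> by (intro power_mono) auto
    then have "K\<^sup>2 \<le> s\<^sup>2 + \<beta>" using Suc.prems by simp
    then have "l * K\<^sup>2 \<le> l * (s\<^sup>2 + \<beta>)" using Suc.prems by (intro mult_left_mono) auto
    then have "l \<le> l * (s\<^sup>2 + \<beta>) / K\<^sup>2" using \<open>K > 0\<close> by (simp add: pos_le_divide_eq)
    then show ?thesis using Suc.prems unfolding s_def[symmetric]
      by (intro bexI[of _ "{a..<a + l}"]) (auto intro: ennreal_leI)
  next
    case 2
    have "\<not> (\<Sum>k<Suc n. (cell_diff2 g l k x (x - a))\<^sup>2) \<le> \<beta>" if "a \<le> x" "x < a + l" for x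
    proof -
      have "\<Delta>\<^sup>2 \<le> (\<Sum>k<Suc n. (cell_diff2 g l k x (x - a))\<^sup>2)"
        using cd0[OF that] by (subst sum.lessThan_Suc_shift) (simp add: sum_nonneg)
      then show ?thesis using 2 by simp
    qed
    then have "?A = {}" by auto
    then show ?thesis by (intro bexI[of _ "{}"]) auto
  next
    case 3
    define l' where "l' = l / 2"
    have l': "l' > 0" "\<beta> - \<Delta>\<^sup>2 \<ge> 0" using Suc.prems 3 by (auto simp: l'_def)
    define s1 where "s1 = (g (a + l') - g a) / l'"
    define s2 where "s2 = (g (a + l' + l') - g (a + l')) / l'"
    have half: "l' / 2 ^ k = l / 2 ^ Suc k" for k by (simp add: l'_def)
    \<comment> \<open>The origins \<open>a\<close> and \<open>a + l'\<close> differ by a multiple of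
      every finer mesh, so the grids of both halves are those of the parent.\<close>
    have rm: "rmod (l / 2 ^ Suc k) (x - (a + l')) = rmod (l / 2 ^ Suc k) (x - a)" for k x
    proof -
      have "x - a = (x - (a + l')) + of_int (2 ^ k) * (l / 2 ^ Suc k)" by (simp add: l'_def)
      then show ?thesis using Suc.prems rmod_add_mult[of "l / 2 ^ Suc k" "x - (a + l')" "2 ^ k"] by simp
    qed
    have sh: "cell_slope g l' k x (x - a) = cell_slope g l (Suc k) x (x - a)"
        "cell_diff2 g l' k x (x - a) = cell_diff2 g l (Suc k) x (x - a)"
        "cell_slope g l' k x (x - (a + l')) = cell_slope g l (Suc k) x (x - a)"
        "cell_diff2 g l' k x (x - (a + l')) = cell_diff2 g l (Suc k) x (x - a)" for k x
      unfolding cell_slope_def cell_diff2_def half rm by auto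
    obtain B1 where B1: "B1 \<in> sets borel"
      "{x. a \<le> x \<and> x < a + l' \<and> (\<Sum>k<n. (cell_diff2 g l (Suc k) x (x - a))\<^sup>2) \<le> \<beta> - \<Delta>\<^sup>2 \<and> (\<exists>k\<le>n. K < \<bar>cell_slope g l (Suc k) x (x - a)\<bar>)} \<subseteq> B1"
      "emeasure lborel B1 \<le> ennreal (l' * (s1\<^sup>2 + (\<beta> - \<Delta>\<^sup>2)) / K\<^sup>2)"
      using Suc.IH[OF l', of a] unfolding sh s1_def by blast
    obtain B2 where B2: "B2 \<in> sets borel"
      "{x. a + l' \<le> x \<and> x < a + l' + l' \<and> (\<Sum>k<n. (cell_diff2 g l (Suc k) x (x - a))\<^sup>2) \<le> \<beta> - \<Delta>\<^sup>2 \<and> (\<exists>k\<le>n. K < \<bar>cell_slope g l (Suc k) x (x - a)\<bar>)} \<subseteq> B2"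
      "emeasure lborel B2 \<le> ennreal (l' * (s2\<^sup>2 + (\<beta> - \<Delta>\<^sup>2)) / K\<^sup>2)"
      using Suc.IH[OF l', of "a + l'"] unfolding sh s2_def by blast
    show ?thesis
    proof (intro bexI[of _ "B1 \<union> B2"] conjI subsetI)
      fix x assume x: "x \<in> ?A"
      then have ax: "a \<le> x" "x < a + l" by auto
      have "\<Delta>\<^sup>2 + (\<Sum>k<n. (cell_diff2 g l (Suc k) x (x - a))\<^sup>2) \<le> \<beta>"
        using x cd0[OF ax] by (auto simp: sum.lessThan_Suc_shift simp del: sum.lessThan_Suc)
      then have S: "(\<Sum>k<n. (cell_diff2 g l (Suc k) x (x - a))\<^sup>2) \<le> \<beta> - \<Delta>\<^sup>2" by simp
      obtain k where k: "k \<le> Suc n" "K < \<bar>cell_slope g l k x (x - a)\<bar>" using x by auto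
      then obtain k' where "k = Suc k'" using cs0[OF ax] 3 by (cases k) auto
      then have k': "\<exists>k\<le>n. K < \<bar>cell_slope g l (Suc k) x (x - a)\<bar>" using k by auto
      show "x \<in> B1 \<union> B2"
      proof (cases "x < a + l'")
        case True
        have "x \<in> B1" by (rule subsetD[OF B1(2)]) (intro CollectI conjI ax True S k')
        then show ?thesis by simp
      next
        case False
        then have "a + l' \<le> x" "x < a + l' + l'" using ax by (auto simp: l'_def)
        then have "x \<in> B2" by (intro subsetD[OF B2(2)] CollectI conjI S k')
        then show ?thesis by simp
      qed
    next
      have "emeasure lborel (B1 \<union> B2) \<le> emeasure lborel B1 + emeasure lborel B2"
        using B1 B2 by (intro emeasure_subadditive) auto
      also have "\<dots> \<le> ennreal (l' * (s1\<^sup>2 + (\<beta> - \<Delta>\<^sup>2)) / K\<^sup>2) + ennreal (l' * (s2\<^sup>2 + (\<beta> - \<Delta>\<^sup>2)) / K\<^sup>2)"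
        using B1 B2 by (intro add_mono) auto
      also have "\<dots> = ennreal (l' * (s1\<^sup>2 + (\<beta> - \<Delta>\<^sup>2)) / K\<^sup>2 + l' * (s2\<^sup>2 + (\<beta> - \<Delta>\<^sup>2)) / K\<^sup>2)"
        using l' by (intro ennreal_plus[symmetric]) auto
      \<comment> \<open>The mean of \<open>s1^2\<close> and \<open>s2^2\<close> is
        \<open>s^2 + \<Delta>^2\<close>. The growth \<open>\<Delta>^2\<close> is exactly what the
        budget has lost, so the bound is reproduced without loss.\<close>
      also have "l' * (s1\<^sup>2 + (\<beta> - \<Delta>\<^sup>2)) / K\<^sup>2 + l' * (s2\<^sup>2 + (\<beta> - \<Delta>\<^sup>2)) / K\<^sup>2 = l * (s\<^sup>2 + \<beta>) / K\<^sup>2"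
      proof -
        have sd: "s = (s1 + s2) / 2" "\<Delta> = (s2 - s1) / 2"
        proof -
          have mid: "a + l / 2 + l / 2 = a + l" "a + l / 2 - l / 2 = a" by auto
          show "s = (s1 + s2) / 2" "\<Delta> = (s2 - s1) / 2"
            unfolding s_def s1_def s2_def \<Delta>_def l'_def Delta2_def mid
            using Suc.prems by (auto simp: field_simps)
        qed
        have "l' * (s1\<^sup>2 + (\<beta> - \<Delta>\<^sup>2)) + l' * (s2\<^sup>2 + (\<beta> - \<Delta>\<^sup>2)) = l * (s\<^sup>2 + \<beta>)"
          unfolding sd by (simp add: l'_def power2_eq_square field_simps)
        then show ?thesis by (simp add: add_divide_distrib[symmetric])
      qed
      finally show "emeasure lborel (B1 \<union> B2) \<le> ennreal (l * (((g (a + l) - g a) / l)\<^sup>2 + \<beta>) / K\<^sup>2)"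
        by (simp add: s_def)
    qed (use B1 B2 in auto)
  qed
qed

text \<open>The maximal estimate does not depend on the depth \<open>n\<close>, so it passes to the
  union over all depths. Where the square function is at most \<open>m\<close>, the points with some
  slope above \<open>K\<close> have measure at most \<open>c m / K^2\<close>, which tends to 0 as
  \<open>K\<close> grows.\<close>

lemma AE_cell_slope_bounded:
  fixes g :: "real \<Rightarrow> real"
  assumes [measurable]: "g \<in> borel_measurable borel" and "l > 0"
  shows "AE x in lborel. a \<le> x \<and> x < a + l \<and> (\<Sum>n. ennreal ((cell_diff2 g l n x (x - a))\<^sup>2)) < \<infinity> \<longrightarrow>
     (\<exists>C::nat. \<forall>n. \<bar>cell_slope g l n x (x - a)\<bar> \<le> C)"
proof -
  define Y where "Y = (\<lambda>m K n::nat. {x. a \<le> x \<and> x < a + l \<and> (\<Sum>n. ennreal ((cell_diff2 g l n x (x - a))\<^sup>2)) \<le> ennreal (real m) \<and>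
     (\<exists>k\<le>n. real K < \<bar>cell_slope g l k x (x - a)\<bar>)})"
  define c where "c = (\<lambda>m. l * (((g (a + l) - g a) / l)\<^sup>2 + real m))"
  have Ym[measurable]: "Y m K n \<in> sets borel" for m K n unfolding Y_def by measurable
  have "emeasure lborel (Y m K n) \<le> ennreal (c m / (real K)\<^sup>2)" if "K > 0" for m K n :: nat
  proof -
    have "real K > 0" using that by simp
    obtain B where B: "B \<in> sets borel" "{x. a \<le> x \<and> x < a + l \<and> (\<Sum>k<n. (cell_diff2 g l k x (x - a))\<^sup>2) \<le> real m \<and>
        (\<exists>k\<le>n. real K < \<bar>cell_slope g l k x (x - a)\<bar>)} \<subseteq> B" "emeasure lborel B \<le> ennreal (c m / (real K)\<^sup>2)"
      using cell_slope_maximal[where K="real K" and l=l and \<beta>="real m" and a=a and n=n and g=g,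
          OF \<open>real K > 0\<close> \<open>l > 0\<close> of_nat_0_le_iff] unfolding c_def by blast
    have "Y m K n \<subseteq> B"
    proof
      fix x assume x: "x \<in> Y m K n"
      have "ennreal (\<Sum>k<n. (cell_diff2 g l k x (x - a))\<^sup>2) = (\<Sum>k<n. ennreal ((cell_diff2 g l k x (x - a))\<^sup>2))"
        by (rule sum_ennreal[symmetric]) auto
      also have "\<dots> \<le> (\<Sum>k. ennreal ((cell_diff2 g l k x (x - a))\<^sup>2))"
        by (rule sum_le_suminf) auto
      also have "\<dots> \<le> ennreal (real m)" using x by (simp add: Y_def)
      finally have "(\<Sum>k<n. (cell_diff2 g l k x (x - a))\<^sup>2) \<le> real m" by (simp add: ennreal_le_iff)
      then show "x \<in> B" using x B(2) by (auto simp: Y_def)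
    qed
    then have "emeasure lborel (Y m K n) \<le> emeasure lborel B" using B(1) by (intro emeasure_mono) auto
    then show ?thesis using B(3) by simp
  qed
  note Y_le = this
  have YU: "emeasure lborel (\<Union>n. Y m K n) \<le> ennreal (c m / (real K)\<^sup>2)" if "K > 0" for m K :: nat
  proof -
    have "incseq (Y m K)"
    proof (rule incseq_SucI, rule subsetI)
      fix n x assume x: "x \<in> Y m K n"
      then obtain k where k: "k \<le> n" "real K < \<bar>cell_slope g l k x (x - a)\<bar>" unfolding Y_def by blast
      have "\<exists>k\<le>Suc n. real K < \<bar>cell_slope g l k x (x - a)\<bar>"
        using k by (intro exI[of _ k]) simp
      then show "x \<in> Y m K (Suc n)" using x unfolding Y_def by blast
    qed
    then have "emeasure lborel (\<Union>n. Y m K n) = (SUP n. emeasure lborel (Y m K n))"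
      by (intro SUP_emeasure_incseq[symmetric]) auto
    also have "\<dots> \<le> ennreal (c m / (real K)\<^sup>2)" using Y_le[OF that] by (rule SUP_least)
    finally show ?thesis .
  qed
  have null: "(\<Inter>K. \<Union>n. Y m K n) \<in> null_sets lborel" for m
  proof -
    define Z where "Z = (\<Inter>K. \<Union>n. Y m K n)"
    have Zm: "Z \<in> sets borel" unfolding Z_def by measurable
    have "emeasure lborel Z \<le> 0 + ennreal e" if "e > 0" for e
    proof -
      obtain K :: nat where "max 1 (c m / e) \<le> real K" using real_arch_simple by blast
      then have K: "1 \<le> real K" "c m / e \<le> real K" by auto
      have "c m \<le> e * real K" using K(2) that by (simp add: field_simps)
      also have "\<dots> \<le> e * (real K)\<^sup>2" using K(1) that by (intro mult_left_mono) (auto simp: power2_eq_square)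
      finally have "c m / (real K)\<^sup>2 \<le> e" using K(1) by (simp add: field_simps)
      have "Z \<subseteq> (\<Union>n. Y m K n)" unfolding Z_def by blast
      then have "emeasure lborel Z \<le> emeasure lborel (\<Union>n. Y m K n)"
        by (rule emeasure_mono) simp
      also have "\<dots> \<le> ennreal (c m / (real K)\<^sup>2)" using K(1) by (intro YU) auto
      also have "\<dots> \<le> ennreal e" by (intro ennreal_leI) fact
      finally show ?thesis by simp
    qed
    then have "emeasure lborel Z \<le> 0" by (rule ennreal_le_epsilon) simp
    then have "Z \<in> null_sets lborel" using Zm by (intro null_setsI) auto
    then show ?thesis unfolding Z_def .
  qed
  have "AE x in lborel. \<forall>m. x \<notin> (\<Inter>K. \<Union>n. Y m K n)"
    unfolding AE_all_countable by (intro allI AE_not_in null)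
  then show ?thesis
  proof eventually_elim
    fix x assume x: "\<forall>m. x \<notin> (\<Inter>K. \<Union>n. Y m K n)"
    show "a \<le> x \<and> x < a + l \<and> (\<Sum>n. ennreal ((cell_diff2 g l n x (x - a))\<^sup>2)) < \<infinity> \<longrightarrow>
     (\<exists>C::nat. \<forall>n. \<bar>cell_slope g l n x (x - a)\<bar> \<le> C)"
    proof (intro impI, elim conjE)
      assume ax: "a \<le> x" "x < a + l" and fin: "(\<Sum>n. ennreal ((cell_diff2 g l n x (x - a))\<^sup>2)) < \<infinity>"
      obtain r where r: "(\<Sum>n. ennreal ((cell_diff2 g l n x (x - a))\<^sup>2)) = ennreal r" "r \<ge> 0"
      proof -
        define S where "S = (\<Sum>n. ennreal ((cell_diff2 g l n x (x - a))\<^sup>2))"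
        have "S < \<infinity>" using fin by (simp only: S_def)
        then obtain r where "S = ennreal r" "r \<ge> 0" by (cases S) auto
        then show thesis using that by (simp only: S_def)
      qed
      obtain m :: nat where m: "r \<le> real m" using real_arch_simple by blast
      have "\<exists>K. \<forall>n. x \<notin> Y m K n" using x by auto
      then obtain K where "\<And>n. x \<notin> Y m K n" by blast
      moreover have "(\<Sum>n. ennreal ((cell_diff2 g l n x (x - a))\<^sup>2)) \<le> ennreal (real m)"
        unfolding r(1) by (rule ennreal_leI[OF m])
      ultimately have no: "\<not> (\<exists>k\<le>n. real K < \<bar>cell_slope g l k x (x - a)\<bar>)" for n
        using ax unfolding Y_def by blast
      have "\<bar>cell_slope g l n x (x - a)\<bar> \<le> real K" for n
        using no[of n] by (meson not_less order_refl)
      then show "\<exists>C::nat. \<forall>n. \<bar>cell_slope g l n x (x - a)\<bar> \<le> C" by blast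
    qed
  qed
qed

section \<open>Averages over translates and scales of the dyadic grid\<close>

lemma nn_integral_rmod:
  fixes h :: "real \<Rightarrow> ennreal"
  assumes [measurable]: "h \<in> borel_measurable borel" and "d > 0"
  shows "(\<integral>\<^sup>+y. h (rmod d y) * indicator {0..<real N * d} y \<partial>lborel) = of_nat N * (\<integral>\<^sup>+u. h u * indicator {0..<d} u \<partial>lborel)"
proof (induction N)
  case (Suc N)
  have ind: "indicator {0..<real (Suc N) * d} y = indicator {0..<real N * d} y + (indicator {real N * d..<real (Suc N) * d} y :: ennreal)" for y
  proof -
    have "0 \<le> real N * d" "real N * d \<le> real (Suc N) * d" using \<open>d > 0\<close> by (auto simp: distrib_right)
    then show ?thesis by (auto simp: indicator_def)
  qed
  have "(\<integral>\<^sup>+y. h (rmod d y) * indicator {real N * d..<real (Suc N) * d} y \<partial>lborel)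
     = (\<integral>\<^sup>+y. h (rmod d (y + real N * d)) * indicator {real N * d..<real (Suc N) * d} (y + real N * d) \<partial>lborel)"
    by (rule nn_integral_shift[symmetric]) measurable
  also have "\<dots> = (\<integral>\<^sup>+u. h u * indicator {0..<d} u \<partial>lborel)"
  proof (intro nn_integral_cong)
    fix u :: real
    have "u + real N * d \<in> {real N * d..<real (Suc N) * d} \<longleftrightarrow> u \<in> {0..<d}" by (auto simp: distrib_right)
    moreover have "rmod d (u + real N * d) = u" if "u \<in> {0..<d}"
      using rmod_add_mult[OF \<open>d > 0\<close>, of u "int N"] that by (simp add: rmod_eq_self)
    ultimately show "h (rmod d (u + real N * d)) * indicator {real N * d..<real (Suc N) * d} (u + real N * d) = h u * indicator {0..<d} u"
      by (auto simp: indicator_def)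
  qed
  finally have "(\<integral>\<^sup>+y. h (rmod d y) * indicator {real N * d..<real (Suc N) * d} y \<partial>lborel) = (\<integral>\<^sup>+u. h u * indicator {0..<d} u \<partial>lborel)" .
  then show ?case
    unfolding ind by (simp add: distrib_left nn_integral_add Suc distrib_right add.commute)
qed simp

text \<open>The slice of the cone at height \<open>t\<close>, still without the weight
  \<open>1 / t^2\<close>.\<close>

definition window_int :: "(real \<Rightarrow> real) \<Rightarrow> real \<Rightarrow> real \<Rightarrow> ennreal" where
  "window_int g x t = (\<integral>\<^sup>+s. (if \<bar>s - x\<bar> < t then ennreal ((Delta2 g s t)\<^sup>2) else 0) \<partial>lborel)"

lemma borel_measurable_window_int [measurable]:
  assumes [measurable]: "g \<in> borel_measurable borel" "u \<in> borel_measurable M" "v \<in> borel_measurable M"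
  shows "(\<lambda>x. window_int g (u x) (v x)) \<in> borel_measurable M"
  unfolding window_int_def by measurable

text \<open>A cell of half-length \<open>t\<close> contains \<open>x\<close> if and only if its
  midpoint lies within \<open>t\<close> of \<open>x\<close>, up to one endpoint. As \<open>y\<close>
  runs through \<open>[0, l)\<close>, the midpoint of the cell around \<open>x\<close> sweeps this
  window \<open>2 ^ n\<close> times at unit speed.\<close>

lemma nn_integral_cell_diff2:
  fixes g :: "real \<Rightarrow> real"
  assumes [measurable]: "g \<in> borel_measurable borel" and "l > 0"
  shows "(\<integral>\<^sup>+y. ennreal ((cell_diff2 g l n x y)\<^sup>2) * indicator {0..<l} y \<partial>lborel) = 2 ^ n * window_int g x (l / 2 ^ n / 2)"
proof -
  define d where "d = l / 2 ^ n"
  define t where "t = d / 2"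
  have d: "d > 0" "real (2 ^ n) * d = l" "d = 2 * t" "t > 0" using \<open>l > 0\<close> by (auto simp: d_def t_def)
  let ?h = "\<lambda>u. ennreal ((Delta2 g (x - u + t) t)\<^sup>2)"
  have "(\<integral>\<^sup>+y. ennreal ((cell_diff2 g l n x y)\<^sup>2) * indicator {0..<l} y \<partial>lborel)
     = (\<integral>\<^sup>+y. ?h (rmod d y) * indicator {0..<real (2 ^ n) * d} y \<partial>lborel)"
    unfolding cell_diff2_def d(2) by (simp add: d_def t_def)
  also have "\<dots> = of_nat (2 ^ n) * (\<integral>\<^sup>+u. ?h u * indicator {0..<d} u \<partial>lborel)"
    by (rule nn_integral_rmod) (use d in auto)
  also have "(\<integral>\<^sup>+u. ?h u * indicator {0..<d} u \<partial>lborel)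
     = (\<integral>\<^sup>+u. ennreal ((Delta2 g (x + t + -1 * u) t)\<^sup>2) * indicator {x - t<..x + t} (x + t + -1 * u) \<partial>lborel)"
    by (intro nn_integral_cong) (auto simp: indicator_def d(3) algebra_simps)
  also have "\<dots> = (\<integral>\<^sup>+s. ennreal ((Delta2 g s t)\<^sup>2) * indicator {x - t<..x + t} s \<partial>lborel)"
    by (subst nn_integral_real_affine[where c="-1" and t="x + t"]) auto
  also have "\<dots> = window_int g x t"
    unfolding window_int_def
  proof (rule nn_integral_cong_AE)
    show "AE s in lborel. ennreal ((Delta2 g s t)\<^sup>2) * indicator {x - t<..x + t} s = (if \<bar>s - x\<bar> < t then ennreal ((Delta2 g s t)\<^sup>2) else 0)"
      using AE_lborel_singleton[of "x + t"]
      by eventually_elim (auto simp: indicator_def abs_less_iff)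
  qed
  finally show ?thesis by (simp add: t_def d_def)
qed

text \<open>One factor of the weight \<open>1 / t^2\<close> joins \<open>dt\<close> to form the
  dilation-invariant measure, which folds onto one octave; the other remains as the normalisation of
  the window. A finite integral over the octave has an almost everywhere finite integrand.\<close>

lemma AE_scale_window_sum_finite:
  fixes g :: "real \<Rightarrow> real"
  assumes [measurable]: "g \<in> borel_measurable borel" and fin: "cone_int g \<delta> x < \<infinity>"
  shows "AE \<tau> in lborel. \<tau> \<in> {1..<2} \<longrightarrow>
     (\<Sum>n. if \<tau> / 2 ^ n < \<delta> then window_int g x (\<tau> / 2 ^ n) * ennreal (1 / (\<tau> / 2 ^ n)) else 0) < \<infinity>"
proof -
  let ?h = "\<lambda>t. if t < \<delta> then window_int g x t * ennreal (1 / t) else 0"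
  have "(\<integral>\<^sup>+\<tau>. (\<Sum>n. ?h (\<tau> / 2 ^ n)) * ennreal (1 / \<tau>) * indicator {1..<2} \<tau> \<partial>lborel)
       = (\<integral>\<^sup>+t. ?h t * ennreal (1 / t) * indicator {0<..<2} t \<partial>lborel)"
    by (rule nn_integral_dyadic) measurable
  also have "\<dots> \<le> cone_int g \<delta> x"
    unfolding cone_int_def
  proof (rule nn_integral_mono)
    fix t :: real
    have "?h t * ennreal (1 / t) = (\<integral>\<^sup>+s. (if \<bar>s - x\<bar> < t \<and> t < \<delta> then ennreal ((Delta2 g s t)\<^sup>2 / t\<^sup>2) else 0) \<partial>lborel)"
      if "t < \<delta>" "t > 0"
    proof -
      have "?h t * ennreal (1 / t) = window_int g x t * (ennreal (1 / t) * ennreal (1 / t))"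
        using that by (simp only: if_True mult.assoc)
      also have "ennreal (1 / t) * ennreal (1 / t) = ennreal (1 / t\<^sup>2)"
        using that by (subst ennreal_mult[symmetric]) (auto simp: power2_eq_square)
      also have "window_int g x t * ennreal (1 / t\<^sup>2) =
         (\<integral>\<^sup>+s. (if \<bar>s - x\<bar> < t then ennreal ((Delta2 g s t)\<^sup>2) else 0) * ennreal (1 / t\<^sup>2) \<partial>lborel)"
        unfolding window_int_def by (rule nn_integral_multc[symmetric]) measurable
      also have "\<dots> = (\<integral>\<^sup>+s. (if \<bar>s - x\<bar> < t \<and> t < \<delta> then ennreal ((Delta2 g s t)\<^sup>2 / t\<^sup>2) else 0) \<partial>lborel)"
        using that by (intro nn_integral_cong) (auto simp: ennreal_mult[symmetric])
      finally show ?thesis .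
    qed
    then show "?h t * ennreal (1 / t) * indicator {0<..<2} t \<le> (\<integral>\<^sup>+s. (if \<bar>s - x\<bar> < t \<and> t < \<delta> then ennreal ((Delta2 g s t)\<^sup>2 / t\<^sup>2) else 0) \<partial>lborel)"
      by (cases "t < \<delta> \<and> t > 0") (auto simp: indicator_def)
  qed
  also have "\<dots> < \<infinity>" by fact
  finally have "AE \<tau> in lborel. (\<Sum>n. ?h (\<tau> / 2 ^ n)) * ennreal (1 / \<tau>) * indicator {1..<2} \<tau> \<noteq> \<infinity>"
    by (intro nn_integral_PInf_AE) auto
  then show ?thesis
  proof eventually_elim
    fix \<tau> :: real
    define S where "S = (\<Sum>n. ?h (\<tau> / 2 ^ n))"
    assume "(\<Sum>n. ?h (\<tau> / 2 ^ n)) * ennreal (1 / \<tau>) * indicator {1..<2} \<tau> \<noteq> \<infinity>"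
    then have *: "S * ennreal (1 / \<tau>) * indicator {1..<2} \<tau> \<noteq> \<infinity>" unfolding S_def .
    have "S < \<infinity>" if "\<tau> \<in> {1..<2}"
    proof (rule ccontr)
      assume "\<not> S < \<infinity>"
      then have "S = top" by (simp add: less_top[symmetric])
      moreover have "ennreal (1 / \<tau>) \<noteq> 0" using that by auto
      ultimately have "S * ennreal (1 / \<tau>) = top" by (simp add: ennreal_top_mult)
      then show False using * that by simp
    qed
    then show "\<tau> \<in> {1..<2} \<longrightarrow> (\<Sum>n. ?h (\<tau> / 2 ^ n)) < \<infinity>" unfolding S_def by blast
  qed
qed

lemma suminf_finite_of_tail:
  fixes a :: "nat \<Rightarrow> ennreal"
  assumes "\<And>n. a n < \<infinity>" "\<And>n. n \<ge> n0 \<Longrightarrow> P n" "(\<Sum>n. if P n then a n else 0) < \<infinity>"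
  shows "(\<Sum>n. a n) < \<infinity>"
proof -
  have "(\<Sum>n. a n) \<le> (\<Sum>n. (if P n then a n else 0) + (if n < n0 then a n else 0))"
    using assms(2) by (intro suminf_le) (auto simp: not_less)
  also have "\<dots> = (\<Sum>n. if P n then a n else 0) + (\<Sum>n. if n < n0 then a n else 0)"
    by (rule suminf_add[symmetric]) auto
  also have "(\<Sum>n. if n < n0 then a n else 0) = (\<Sum>n<n0. if n < n0 then a n else 0)"
    by (rule suminf_finite) auto
  also have "(\<Sum>n. if P n then a n else 0) + (\<Sum>n<n0. if n < n0 then a n else 0) < \<infinity>"
    using assms(1,3) by (simp add: ennreal_add_less_top sum_eq_0_iff)
  finally show ?thesis .
qed

text \<open>Integrating over the translates \<open>y\<close> turns the square function into a sum of
  windows, with \<open>l = 2 * \<tau>\<close> because half-length \<open>\<tau> / 2 ^ n\<close>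
  means mesh \<open>l / 2 ^ n\<close>. The \<open>2 ^ n\<close> sweeps of a window are
  \<open>\<tau>\<close> times its normalisation \<open>1 / (\<tau> / 2 ^ n)\<close>. The scales
  above \<open>\<delta>\<close> contribute finitely many finite terms.\<close>

lemma AE_cell_diff2_sum_finite:
  fixes g :: "real \<Rightarrow> real"
  assumes [measurable]: "g \<in> borel_measurable borel" and "\<tau> > 0" "\<delta> > 0"
    and fin: "(\<Sum>n. if \<tau> / 2 ^ n < \<delta> then window_int g x (\<tau> / 2 ^ n) * ennreal (1 / (\<tau> / 2 ^ n)) else 0) < \<infinity>"
  shows "AE y in lborel. y \<in> {0..<2 * \<tau>} \<longrightarrow> (\<Sum>n. ennreal ((cell_diff2 g (2 * \<tau>) n x y)\<^sup>2)) < \<infinity>"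
proof -
  let ?a = "\<lambda>n y. ennreal ((cell_diff2 g (2 * \<tau>) n x y)\<^sup>2)"
  let ?b = "\<lambda>n y. if \<tau> / 2 ^ n < \<delta> then ?a n y * indicator {0..<2 * \<tau>} y else 0"
  have "(\<integral>\<^sup>+y. (\<Sum>n. ?b n y) \<partial>lborel) = (\<Sum>n. \<integral>\<^sup>+y. ?b n y \<partial>lborel)"
    by (rule nn_integral_suminf) measurable
  also have "\<dots> = (\<Sum>n. ennreal \<tau> * (if \<tau> / 2 ^ n < \<delta> then window_int g x (\<tau> / 2 ^ n) * ennreal (1 / (\<tau> / 2 ^ n)) else 0))"
  proof (intro suminf_cong)
    fix n
    have "ennreal \<tau> * ennreal (1 / (\<tau> / 2 ^ n)) = ennreal (2 ^ n)"
      using \<open>\<tau> > 0\<close> by (subst ennreal_mult[symmetric]) auto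
    then have "2 ^ n * window_int g x (\<tau> / 2 ^ n) = ennreal \<tau> * (window_int g x (\<tau> / 2 ^ n) * ennreal (1 / (\<tau> / 2 ^ n)))"
    proof -
      assume eq: "ennreal \<tau> * ennreal (1 / (\<tau> / 2 ^ n)) = ennreal (2 ^ n)"
      have "(2::ennreal) ^ n = ennreal (2 ^ n)" by (simp add: ennreal_power[symmetric])
      then have "2 ^ n * window_int g x (\<tau> / 2 ^ n) = window_int g x (\<tau> / 2 ^ n) * (ennreal \<tau> * ennreal (1 / (\<tau> / 2 ^ n)))"
        unfolding eq by (simp only: mult.commute)
      then show ?thesis by (simp only: mult.left_commute)
    qed
    moreover have "(\<integral>\<^sup>+y. ?a n y * indicator {0..<2 * \<tau>} y \<partial>lborel) = 2 ^ n * window_int g x (\<tau> / 2 ^ n)"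
      using \<open>\<tau> > 0\<close> nn_integral_cell_diff2[OF assms(1), of "2 * \<tau>" n x] by simp
    ultimately show "(\<integral>\<^sup>+y. ?b n y \<partial>lborel) = ennreal \<tau> * (if \<tau> / 2 ^ n < \<delta> then window_int g x (\<tau> / 2 ^ n) * ennreal (1 / (\<tau> / 2 ^ n)) else 0)"
      by (cases "\<tau> / 2 ^ n < \<delta>") (simp_all only: if_True if_False nn_integral_const mult_zero_right mult_zero_left)
  qed
  also have "\<dots> = ennreal \<tau> * (\<Sum>n. if \<tau> / 2 ^ n < \<delta> then window_int g x (\<tau> / 2 ^ n) * ennreal (1 / (\<tau> / 2 ^ n)) else 0)"
    by (rule ennreal_suminf_cmult)
  also have "\<dots> < \<infinity>"
  proof -
    have "ennreal \<tau> * S < \<infinity>" if "S < \<infinity>" for S :: ennreal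
      using that by (simp add: ennreal_mult_less_top)
    then show ?thesis using fin by blast
  qed
  finally have lt: "(\<integral>\<^sup>+y. (\<Sum>n. ?b n y) \<partial>lborel) < \<infinity>" .
  have "AE y in lborel. (\<Sum>n. ?b n y) \<noteq> \<infinity>"
    by (rule nn_integral_PInf_AE[OF _ less_imp_neq[OF lt]]) measurable
  then show ?thesis
  proof eventually_elim
    fix y
    assume A: "(\<Sum>n. ?b n y) \<noteq> \<infinity>"
    obtain n0 :: nat where n0: "(1/2) ^ n0 < \<delta> / \<tau>" using real_arch_pow_inv[of "\<delta> / \<tau>" "1/2"] assms(2,3) by auto
    have small: "\<tau> / 2 ^ n < \<delta>" if "n0 \<le> n" for n
    proof -
      have "(1/2) ^ n \<le> (1/2::real) ^ n0" using that by (intro power_decreasing) auto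
      then have "(1/2) ^ n < \<delta> / \<tau>" using n0 by (rule le_less_trans)
      then show ?thesis using \<open>\<tau> > 0\<close> by (simp add: field_simps)
    qed
    show "y \<in> {0..<2 * \<tau>} \<longrightarrow> (\<Sum>n. ?a n y) < \<infinity>"
    proof
      assume y: "y \<in> {0..<2 * \<tau>}"
      have "(\<Sum>n. ?b n y) = (\<Sum>n. if \<tau> / 2 ^ n < \<delta> then ?a n y else 0)"
        using y by (intro suminf_cong) simp
      then have B: "(\<Sum>n. if \<tau> / 2 ^ n < \<delta> then ?a n y else 0) < \<infinity>" using A by (simp only: less_top infinity_ennreal_def)
      show "(\<Sum>n. ?a n y) < \<infinity>"
        by (rule suminf_finite_of_tail[where P="\<lambda>n. \<tau> / 2 ^ n < \<delta>", OF _ small B]) (simp_all only: infinity_ennreal_def ennreal_less_top)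
    qed
  qed
qed

lemma cone_int_mono:
  assumes "\<delta> \<le> \<delta>'"
  shows "cone_int g \<delta> x \<le> cone_int g \<delta>' x"
  unfolding cone_int_def using assms by (intro nn_integral_mono) auto

text \<open>The exceptional scales depend on \<open>x\<close>, whereas the martingale estimates need
  one \<open>l\<close> for almost all \<open>x\<close>. Fubini in \<open>(x, \<tau>)\<close>
  exchanges the two, and the octave \<open>[1, 2)\<close> is not null, so it contains a good
  scale.\<close>

lemma exists_scale_cell_diff2_sum_finite:
  fixes g :: "real \<Rightarrow> real"
  assumes g[measurable]: "g \<in> borel_measurable borel"
  obtains l where "l > 0" "AE x in lborel. (\<exists>\<delta>>0. cone_int g \<delta> x < \<infinity>) \<longrightarrow>
     (AE y in lborel. y \<in> {0..<l} \<longrightarrow> (\<Sum>n. ennreal ((cell_diff2 g l n x y)\<^sup>2)) < \<infinity>)"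
proof -
  \<comment> \<open>The heights \<open>1 / real (Suc k)\<close> replace all \<open>\<delta>\<close>:
    countably many conditions remain, so that \<open>P\<close> is jointly measurable and still holds
    for almost every \<open>\<tau>\<close>.\<close>
  define P where "P = (\<lambda>x \<tau>. \<forall>k. cone_int g (1 / real (Suc k)) x < \<infinity> \<longrightarrow> \<tau> \<in> {1..<2} \<longrightarrow>
     (\<Sum>n. if \<tau> / 2 ^ n < 1 / real (Suc k) then window_int g x (\<tau> / 2 ^ n) * ennreal (1 / (\<tau> / 2 ^ n)) else 0) < \<infinity>)"
  have "AE x in lborel. AE \<tau> in lborel. P x \<tau>"
  proof (rule AE_I2)
    fix x
    show "AE \<tau> in lborel. P x \<tau>"
      unfolding P_def AE_all_countable
    proof
      fix k
      show "AE \<tau> in lborel. cone_int g (1 / real (Suc k)) x < \<infinity> \<longrightarrow> \<tau> \<in> {1..<2} \<longrightarrow>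
        (\<Sum>n. if \<tau> / 2 ^ n < 1 / real (Suc k) then window_int g x (\<tau> / 2 ^ n) * ennreal (1 / (\<tau> / 2 ^ n)) else 0) < \<infinity>"
      proof (cases "cone_int g (1 / real (Suc k)) x < \<infinity>")
        case True
        show ?thesis using AE_scale_window_sum_finite[OF g True] by (rule eventually_mono) blast
      next
        case False
        then show ?thesis by (intro AE_I2) blast
      qed
    qed
  qed
  moreover have "{p \<in> space (lborel \<Otimes>\<^sub>M lborel). P (fst p) (snd p)} \<in> sets (lborel \<Otimes>\<^sub>M lborel)"
    unfolding P_def by measurable
  ultimately have "AE \<tau> in lborel. AE x in lborel. P x \<tau>"
    by (subst (asm) lborel_pair.AE_commute) auto
  moreover have "\<not> (AE \<tau> in lborel. \<tau> \<notin> {1..<2::real})"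
  proof
    assume "AE \<tau> in lborel. \<tau> \<notin> {1..<2::real}"
    then have "emeasure lborel {1..<2::real} = 0"
      by (subst (asm) AE_iff_measurable[where N="{1..<2}"]) auto
    then show False by simp
  qed
  ultimately obtain \<tau> where \<tau>: "\<tau> \<in> {1..<2}" "AE x in lborel. P x \<tau>"
    by (metis (mono_tags, lifting) eventually_mono)
  show thesis
  proof (rule that[of "2 * \<tau>"])
    show "2 * \<tau> > 0" using \<tau> by simp
    show "AE x in lborel. (\<exists>\<delta>>0. cone_int g \<delta> x < \<infinity>) \<longrightarrow>
     (AE y in lborel. y \<in> {0..<2 * \<tau>} \<longrightarrow> (\<Sum>n. ennreal ((cell_diff2 g (2 * \<tau>) n x y)\<^sup>2)) < \<infinity>)"
      using \<tau>(2)
    proof eventually_elim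
      fix x assume P: "P x \<tau>"
      show "(\<exists>\<delta>>0. cone_int g \<delta> x < \<infinity>) \<longrightarrow>
        (AE y in lborel. y \<in> {0..<2 * \<tau>} \<longrightarrow> (\<Sum>n. ennreal ((cell_diff2 g (2 * \<tau>) n x y)\<^sup>2)) < \<infinity>)"
      proof (intro impI, elim exE conjE)
        fix \<delta> :: real assume \<delta>: "\<delta> > 0" "cone_int g \<delta> x < \<infinity>"
        obtain k where k: "inverse (real (Suc k)) < \<delta>" using reals_Archimedean[OF \<delta>(1)] by blast
        then have "1 / real (Suc k) \<le> \<delta>" by (simp add: inverse_eq_divide)
        then have "cone_int g (1 / real (Suc k)) x < \<infinity>" using le_less_trans[OF cone_int_mono \<delta>(2)] by blast
        then have "(\<Sum>n. if \<tau> / 2 ^ n < 1 / real (Suc k) then window_int g x (\<tau> / 2 ^ n) * ennreal (1 / (\<tau> / 2 ^ n)) else 0) < \<infinity>"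
          using P \<tau>(1) unfolding P_def by blast
        then show "AE y in lborel. y \<in> {0..<2 * \<tau>} \<longrightarrow> (\<Sum>n. ennreal ((cell_diff2 g (2 * \<tau>) n x y)\<^sup>2)) < \<infinity>"
          using \<tau>(1) by (intro AE_cell_diff2_sum_finite[OF g]) auto
      qed
    qed
  qed
qed

section \<open>Approximate Lipschitz bounds\<close>

lemma AE_lborel_affine:
  assumes "AE x in lborel. P x" "c \<noteq> (0::real)"
  shows "AE s in lborel. P (a + c * s)"
proof -
  obtain N where N: "N \<in> null_sets lborel" "{x \<in> space lborel. \<not> P x} \<subseteq> N"
    using assms(1) by (auto simp: eventually_ae_filter)
  show ?thesis
    using AE_lborel_affine_notin[OF N(1) assms(2), of a] by eventually_elim (use N(2) in auto)
qed

text \<open>The martingale estimate fixes the origin \<open>a\<close> of the grid and excludes a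
  null set of \<open>x\<close>. Fubini exchanges these roles; for fixed \<open>x\<close>, the
  reflection \<open>y = x - a\<close> then preserves null sets.\<close>

lemma AE_AE_cell_slope_bounded:
  fixes g :: "real \<Rightarrow> real"
  assumes g[measurable]: "g \<in> borel_measurable borel" and "l > 0"
  shows "AE x in lborel. AE y in lborel. y \<in> {0..<l} \<and> (\<Sum>n. ennreal ((cell_diff2 g l n x y)\<^sup>2)) < \<infinity> \<longrightarrow>
     (\<exists>C::nat. \<forall>n. \<bar>cell_slope g l n x y\<bar> \<le> C)"
proof -
  define R where "R = (\<lambda>a x. a \<le> x \<and> x < a + l \<and> (\<Sum>n. ennreal ((cell_diff2 g l n x (x - a))\<^sup>2)) < \<infinity> \<longrightarrow>
     (\<exists>C::nat. \<forall>n. \<bar>cell_slope g l n x (x - a)\<bar> \<le> C))"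
  have "AE a in lborel. AE x in lborel. R a x"
    unfolding R_def by (rule AE_I2) (rule AE_cell_slope_bounded[OF g \<open>l > 0\<close>])
  moreover have "{p \<in> space (lborel \<Otimes>\<^sub>M lborel). R (fst p) (snd p)} \<in> sets (lborel \<Otimes>\<^sub>M lborel)"
    unfolding R_def by measurable
  ultimately have "AE x in lborel. AE a in lborel. R a x"
    by (subst (asm) lborel_pair.AE_commute) auto
  then show ?thesis
  proof eventually_elim
    fix x assume "AE a in lborel. R a x"
    then have "AE y in lborel. R (x + -1 * y) x" by (rule AE_lborel_affine) simp
    then show "AE y in lborel. y \<in> {0..<l} \<and> (\<Sum>n. ennreal ((cell_diff2 g l n x y)\<^sup>2)) < \<infinity> \<longrightarrow>
     (\<exists>C::nat. \<forall>n. \<bar>cell_slope g l n x y\<bar> \<le> C)"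
    proof eventually_elim
      fix y assume "R (x + -1 * y) x"
      moreover have "x - (x + -1 * y) = y" by simp
      moreover have "x + -1 * y \<le> x \<and> x < x + -1 * y + l" if "y \<in> {0..<l}" using that by auto
      ultimately show "y \<in> {0..<l} \<and> (\<Sum>n. ennreal ((cell_diff2 g l n x y)\<^sup>2)) < \<infinity> \<longrightarrow>
         (\<exists>C::nat. \<forall>n. \<bar>cell_slope g l n x y\<bar> \<le> C)" unfolding R_def by metis
    qed
  qed
qed

lemma rmod_half:
  assumes "d > 0"
  shows "rmod (d / 2) y = rmod d y \<or> rmod (d / 2) y = rmod d y - d / 2"
proof -
  define u where "u = rmod d y"
  have u: "0 \<le> u" "u < d" using rmod_bounds[OF assms] by (auto simp: u_def)
  have "y = u + of_int (2 * \<lfloor>y / d\<rfloor>) * (d / 2)" by (simp add: u_def rmod_def)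
  then have y: "rmod (d / 2) y = rmod (d / 2) u"
    using rmod_add_mult[of "d / 2" u "2 * \<lfloor>y / d\<rfloor>"] assms by simp
  show ?thesis
  proof (cases "u < d / 2")
    case True
    then show ?thesis using y u by (simp add: rmod_eq_self u_def[symmetric])
  next
    case False
    have "rmod (d / 2) u = rmod (d / 2) (u - d / 2)"
      using rmod_add_mult[of "d / 2" "u - d / 2" 1] assms by simp
    also have "\<dots> = u - d / 2" using False u by (intro rmod_eq_self) auto
    finally show ?thesis using y by (simp add: u_def[symmetric])
  qed
qed

text \<open>A cell shares an end with its successor, so passing to the next left end costs at most
  one old and one new cell, bounded by \<open>2 * C * d n\<close>; the geometric series adds up to
  \<open>4 * C * d n\<close>, and the right end costs another \<open>C * d n\<close>. The
  telescoping controls all finer cells at once, so closeness to \<open>g x\<close> along some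
  arbitrarily fine cells identifies the limit.\<close>

lemma cell_endpoint_deviation_le:
  fixes g :: "real \<Rightarrow> real"
  assumes "l > 0" and slope: "\<And>n. \<bar>cell_slope g l n x y\<bar> \<le> C"
    and approx: "\<And>\<epsilon> N. \<epsilon> > 0 \<Longrightarrow> \<exists>n\<ge>N. \<bar>g (x - rmod (l / 2 ^ n) y) - g x\<bar> \<le> \<epsilon>"
  shows "\<bar>g (x - rmod (l / 2 ^ n) y) - g x\<bar> \<le> 4 * C * (l / 2 ^ n)"
    and "\<bar>g (x - rmod (l / 2 ^ n) y + l / 2 ^ n) - g x\<bar> \<le> 5 * C * (l / 2 ^ n)"
proof -
  define d where "d = (\<lambda>n::nat. l / 2 ^ n)"
  define p where "p = (\<lambda>n. x - rmod (d n) y)"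
  have d: "d n > 0" "d (Suc n) = d n / 2" for n using \<open>l > 0\<close> by (auto simp: d_def)
  have sl: "\<bar>g (p n + d n) - g (p n)\<bar> \<le> C * d n" for n
  proof -
    have "\<bar>(g (p n + d n) - g (p n)) / d n\<bar> \<le> C" using slope[of n] by (simp only: cell_slope_def p_def d_def)
    then show ?thesis using d(1)[of n] by (simp only: abs_divide abs_of_pos pos_divide_le_eq)
  qed
  have "0 \<le> C" using order_trans[OF abs_ge_zero slope] .
  have step: "\<bar>g (p (Suc n)) - g (p n)\<bar> \<le> 2 * C * d n" for n
  proof -
    consider "p (Suc n) = p n" | "p (Suc n) + d (Suc n) = p n + d n"
      using rmod_half[OF d(1), of n y] by (auto simp: p_def d(2))
    then show ?thesis
    proof cases
      case 1
      then show ?thesis using \<open>0 \<le> C\<close> d(1)[of n] by simp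
    next
      case 2
      have "\<bar>g (p n + d n) - g (p (Suc n))\<bar> \<le> C * (d n / 2)"
        using sl[of "Suc n", unfolded 2] by (simp add: d(2))
      moreover have "0 \<le> C * d n" using \<open>0 \<le> C\<close> d(1)[of n] by simp
      ultimately show ?thesis using sl[of n] unfolding mult.assoc by linarith
    qed
  qed
  have tele: "\<bar>g (p (n + k)) - g (p n)\<bar> \<le> 4 * C * (d n - d (n + k))" for n k
  proof (induction k)
    case (Suc k)
    have "\<bar>g (p (n + Suc k)) - g (p n)\<bar> \<le> 2 * C * d (n + k) + 4 * C * (d n - d (n + k))"
      using Suc step[of "n + k"] by simp
    also have "\<dots> = 4 * C * (d n - d (n + Suc k))" by (simp add: d(2) algebra_simps)
    finally show ?case .
  qed simp
  have P: "\<bar>g (p n) - g x\<bar> \<le> 4 * C * d n" for n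
  proof (rule field_le_epsilon)
    fix \<epsilon> :: real assume "\<epsilon> > 0"
    then obtain m where m: "m \<ge> n" "\<bar>g (p m) - g x\<bar> \<le> \<epsilon>" using approx[of \<epsilon> n] by (auto simp: p_def d_def)
    have "\<bar>g (p m) - g (p n)\<bar> \<le> 4 * C * (d n - d m)" using tele[of n "m - n"] m(1) by simp
    also have "\<dots> \<le> 4 * C * d n" using \<open>0 \<le> C\<close> d(1)[of m] by (intro mult_left_mono) auto
    finally show "\<bar>g (p n) - g x\<bar> \<le> 4 * C * d n + \<epsilon>" using m(2) by linarith
  qed
  then show "\<bar>g (x - rmod (l / 2 ^ n) y) - g x\<bar> \<le> 4 * C * (l / 2 ^ n)" by (simp add: p_def d_def)
  have "\<bar>g (p n + d n) - g x\<bar> \<le> 5 * C * d n" using P[of n] sl[of n] by linarith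
  then show "\<bar>g (x - rmod (l / 2 ^ n) y + l / 2 ^ n) - g x\<bar> \<le> 5 * C * (l / 2 ^ n)" by (simp add: p_def d_def)
qed

definition approx_continuous :: "(real \<Rightarrow> real) \<Rightarrow> real \<Rightarrow> bool" where
  "approx_continuous g x \<longleftrightarrow> (\<forall>\<epsilon>>0. \<forall>\<kappa>>0. \<exists>r0>0. \<forall>r. 0 < r \<and> r < r0 \<longrightarrow>
     emeasure lborel {v. \<bar>v - x\<bar> \<le> r \<and> \<epsilon> < \<bar>g v - g x\<bar>} \<le> ennreal (\<kappa> * r))"

text \<open>Density is applied to the countably many sets \<open>S q k\<close> of points whose value
  is within \<open>1 / Suc k\<close> of a rational \<open>q\<close>. If \<open>x\<close> lies in
  \<open>S q k\<close> and \<open>1 / Suc k < \<epsilon> / 2\<close>, then points with value farther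
  than \<open>\<epsilon>\<close> from \<open>g x\<close> are outside \<open>S q k\<close>.\<close>

lemma AE_approx_continuous:
  fixes g :: "real \<Rightarrow> real"
  assumes [measurable]: "g \<in> borel_measurable borel"
  shows "AE x in lborel. approx_continuous g x"
proof -
  define S where "S = (\<lambda>q (k::nat). {x. \<bar>g x - q\<bar> < inverse (real (Suc k))})"
  define Z where "Z = (\<lambda>(q, k, j::nat). {x \<in> S q k. \<forall>d>0. \<exists>r D. 0 < r \<and> r < d \<and> D \<in> sets lebesgue \<and> D \<subseteq> cball x r \<and>
        D \<inter> S q k = {} \<and> ennreal (inverse (real (Suc j)) * r) \<le> emeasure lebesgue D})"
  have "negligible (Z i)" for i unfolding Z_def case_prod_beta by (rule negligible_non_density) simp
  then have "negligible (\<Union>i \<in> \<rat> \<times> UNIV. Z i)"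
    by (intro negligible_countable_Union countable_image countable_SIGMA countable_rat) auto
  then have "AE x in lborel. x \<notin> (\<Union>i \<in> \<rat> \<times> UNIV. Z i)"
    unfolding negligible_iff_null_sets by (auto dest: AE_not_in simp: AE_completion_iff)
  then show ?thesis
  proof eventually_elim
    fix x assume x: "x \<notin> (\<Union>i \<in> \<rat> \<times> UNIV. Z i)"
    show "approx_continuous g x"
      unfolding approx_continuous_def
    proof (intro allI impI)
      fix \<epsilon> \<kappa> :: real assume "\<epsilon> > 0" "\<kappa> > 0"
      obtain k where k: "inverse (real (Suc k)) < \<epsilon> / 2" using reals_Archimedean[of "\<epsilon> / 2"] \<open>\<epsilon> > 0\<close> by auto
      obtain j where j: "inverse (real (Suc j)) < \<kappa>" using reals_Archimedean[OF \<open>\<kappa> > 0\<close>] by auto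
      have "(0::real) < inverse (real (Suc k))" by simp
      then obtain q where q: "q \<in> \<rat>" "g x - inverse (real (Suc k)) < q" "q < g x"
        using Rats_dense_in_real[of "g x - inverse (real (Suc k))" "g x"] by auto
      then have xS: "x \<in> S q k" by (auto simp: S_def)
      have "x \<notin> Z (q, k, j)" using x q(1) by blast
      then have "\<not> (\<forall>d>0. \<exists>r D. 0 < r \<and> r < d \<and> D \<in> sets lebesgue \<and> D \<subseteq> cball x r \<and>
        D \<inter> S q k = {} \<and> ennreal (inverse (real (Suc j)) * r) \<le> emeasure lebesgue D)"
        using xS unfolding Z_def case_prod_conv by blast
      then obtain d where d: "d > 0" "\<And>r D. 0 < r \<Longrightarrow> r < d \<Longrightarrow> D \<in> sets lebesgue \<Longrightarrow> D \<subseteq> cball x r \<Longrightarrow>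
        D \<inter> S q k = {} \<Longrightarrow> \<not> ennreal (inverse (real (Suc j)) * r) \<le> emeasure lebesgue D" by blast
      show "\<exists>r0>0. \<forall>r. 0 < r \<and> r < r0 \<longrightarrow>
         emeasure lborel {v. \<bar>v - x\<bar> \<le> r \<and> \<epsilon> < \<bar>g v - g x\<bar>} \<le> ennreal (\<kappa> * r)"
      proof (intro exI[of _ d] conjI allI impI d(1))
        fix r assume r: "0 < r \<and> r < d"
        define D where "D = {v. \<bar>v - x\<bar> \<le> r \<and> \<epsilon> < \<bar>g v - g x\<bar>}"
        have Dm: "D \<in> sets borel" unfolding D_def by measurable
        have "\<not> ennreal (inverse (real (Suc j)) * r) \<le> emeasure lebesgue D"
        proof (rule d(2))
          show "D \<in> sets lebesgue" using Dm by simp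
          show "D \<subseteq> cball x r" by (auto simp: D_def dist_real_def)
          have "v \<notin> S q k" if "v \<in> D" for v
          proof
            assume "v \<in> S q k"
            then have "\<bar>g v - q\<bar> < \<epsilon> / 2" "\<bar>g x - q\<bar> < \<epsilon> / 2" using xS k by (auto simp: S_def)
            then show False using that unfolding D_def mem_Collect_eq by linarith
          qed
          then show "D \<inter> S q k = {}" by blast
        qed (use r in auto)
        then have "emeasure lborel D \<le> ennreal (inverse (real (Suc j)) * r)" using Dm by simp
        also have "\<dots> \<le> ennreal (\<kappa> * r)" using j r by (intro ennreal_leI mult_right_mono) auto
        finally show "emeasure lborel {v. \<bar>v - x\<bar> \<le> r \<and> \<epsilon> < \<bar>g v - g x\<bar>} \<le> ennreal (\<kappa> * r)" unfolding D_def .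
      qed
    qed
  qed
qed

lemma emeasure_rmod_vimage:
  assumes [measurable]: "A \<in> sets borel" and "l > 0"
  shows "emeasure lborel {y \<in> {0..<l}. rmod (l / 2 ^ n) y \<in> A} = 2 ^ n * emeasure lborel {u \<in> {0..<l / 2 ^ n}. u \<in> A}"
proof -
  have l: "real (2 ^ n) * (l / 2 ^ n) = l" by simp
  have "emeasure lborel {y \<in> {0..<l}. rmod (l / 2 ^ n) y \<in> A}
     = (\<integral>\<^sup>+y. indicator {y \<in> {0..<l}. rmod (l / 2 ^ n) y \<in> A} y \<partial>lborel)"
    by (rule nn_integral_indicator[symmetric]) measurable
  also have "\<dots> = (\<integral>\<^sup>+y. indicator A (rmod (l / 2 ^ n) y) * indicator {0..<real (2 ^ n) * (l / 2 ^ n)} y \<partial>lborel)"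
    unfolding l by (intro nn_integral_cong) (auto simp: indicator_def)
  also have "\<dots> = of_nat (2 ^ n) * (\<integral>\<^sup>+u. indicator A u * indicator {0..<l / 2 ^ n} u \<partial>lborel)"
    by (rule nn_integral_rmod) (use \<open>l > 0\<close> in auto)
  also have "(\<integral>\<^sup>+u. indicator A u * indicator {0..<l / 2 ^ n} u \<partial>lborel) = (\<integral>\<^sup>+u. indicator {u \<in> {0..<l / 2 ^ n}. u \<in> A} u \<partial>lborel)"
    by (intro nn_integral_cong) (auto simp: indicator_def)
  also have "\<dots> = emeasure lborel {u \<in> {0..<l / 2 ^ n}. u \<in> A}"
    by (rule nn_integral_indicator) measurable
  finally show ?thesis by simp
qed

lemma emeasure_lborel_reflect:
  assumes "A \<in> sets borel"
  shows "emeasure lborel {u. (c::real) - u \<in> A} = emeasure lborel A"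
proof -
  have "emeasure lborel A = (\<integral>\<^sup>+u. indicator A (c + -1 * u) \<partial>lborel)"
    using assms by (subst nn_integral_indicator[symmetric], simp, subst nn_integral_real_affine[where c="-1" and t=c]) auto
  also have "\<dots> = (\<integral>\<^sup>+u. indicator {u. c - u \<in> A} u \<partial>lborel)"
    by (intro nn_integral_cong) (simp add: indicator_def)
  also have "\<dots> = emeasure lborel {u. c - u \<in> A}"
  proof (rule nn_integral_indicator)
    have "(\<lambda>u. c - u) -` A \<inter> space lborel \<in> sets lborel"
      using assms by (intro measurable_sets[of _ _ borel]) auto
    then show "{u. c - u \<in> A} \<in> sets lborel" by (simp add: vimage_def)
  qed
  finally show ?thesis by simp
qed

text \<open>For fixed \<open>n\<close> the left end of the cell is uniformly distributed over one
  mesh length to the left of \<open>x\<close>, so by approximate continuity the \<open>y\<close>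
  that are bad at this \<open>n\<close> have small measure once \<open>n\<close> is large. Being bad
  at all \<open>n \<ge> N\<close> is therefore null. Good ends are claimed for infinitely many
  \<open>n\<close> only: these small measures need not be summable, so Borel-Cantelli would not give
  all large \<open>n\<close>.\<close>

lemma AE_cell_endpoint_approx:
  fixes g :: "real \<Rightarrow> real"
  assumes g[measurable]: "g \<in> borel_measurable borel" and "l > 0" and ac: "approx_continuous g x"
  shows "AE y in lborel. y \<in> {0..<l} \<longrightarrow> (\<forall>k N. \<exists>n\<ge>N. \<bar>g (x - rmod (l / 2 ^ n) y) - g x\<bar> \<le> inverse (real (Suc k)))"
proof -
  have ae: "AE y in lborel. y \<notin> {y \<in> {0..<l}. \<forall>n\<ge>N. inverse (real (Suc k)) < \<bar>g (x - rmod (l / 2 ^ n) y) - g x\<bar>}" for k N :: nat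
  proof (rule AE_not_in)
    define \<epsilon> where "\<epsilon> = inverse (real (Suc k))"
    have "\<epsilon> > 0" by (simp add: \<epsilon>_def)
    define T where "T = {y \<in> {0..<l}. \<forall>n\<ge>N. \<epsilon> < \<bar>g (x - rmod (l / 2 ^ n) y) - g x\<bar>}"
    have Tm: "T \<in> sets borel" unfolding T_def by measurable
    have le: "emeasure lborel T \<le> 0 + ennreal e" if "e > 0" for e
    proof -
      \<comment> \<open>Chosen so that \<open>2 ^ n\<close> cells, each with bad measure at most
        \<open>\<kappa> * (l / 2 ^ n)\<close>, contribute \<open>e\<close> in total.\<close>
      define \<kappa> where "\<kappa> = e / l"
      have "\<kappa> > 0" using that \<open>l > 0\<close> by (simp add: \<kappa>_def)
      then obtain r0 where r0: "r0 > 0" "\<And>r. 0 < r \<Longrightarrow> r < r0 \<Longrightarrow>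
          emeasure lborel {v. \<bar>v - x\<bar> \<le> r \<and> \<epsilon> < \<bar>g v - g x\<bar>} \<le> ennreal (\<kappa> * r)"
        using ac[unfolded approx_continuous_def, rule_format, OF \<open>\<epsilon> > 0\<close> \<open>\<kappa> > 0\<close>] by blast
      obtain n0 :: nat where n0: "(1/2) ^ n0 < r0 / l" using real_arch_pow_inv[of "r0 / l" "1/2"] r0(1) \<open>l > 0\<close> by auto
      define n where "n = max n0 N"
      have "(1/2) ^ n \<le> (1/2::real) ^ n0" by (intro power_decreasing) (auto simp: n_def)
      then have "(1/2) ^ n < r0 / l" using n0 by (rule le_less_trans)
      then have small: "l / 2 ^ n < r0" using \<open>l > 0\<close> by (simp add: field_simps)
      define d where "d = l / 2 ^ n"
      define A where "A = {u. \<epsilon> < \<bar>g (x - u) - g x\<bar>}"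
      define V where "V = {v. \<bar>v - x\<bar> \<le> d \<and> \<epsilon> < \<bar>g v - g x\<bar>}"
      have meas[measurable]: "A \<in> sets borel" "V \<in> sets borel" unfolding A_def V_def by measurable
      have "n \<ge> N" by (simp add: n_def)
      have "emeasure lborel {u \<in> {0..<d}. u \<in> A} \<le> emeasure lborel {u. x - u \<in> V}"
      proof (rule emeasure_mono)
        show "{u \<in> {0..<d}. u \<in> A} \<subseteq> {u. x - u \<in> V}" by (auto simp: A_def V_def)
        have "(\<lambda>u. x - u) -` V \<inter> space lborel \<in> sets lborel"
          using meas by (intro measurable_sets[of _ _ borel]) auto
        then show "{u. x - u \<in> V} \<in> sets lborel" by (simp add: vimage_def)
      qed
      also have "emeasure lborel {u. x - u \<in> V} = emeasure lborel V"
        by (rule emeasure_lborel_reflect) fact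
      also have "\<dots> \<le> ennreal (\<kappa> * d)"
        unfolding V_def using small \<open>l > 0\<close> by (intro r0(2)) (auto simp: d_def)
      finally have cell: "emeasure lborel {u \<in> {0..<d}. u \<in> A} \<le> ennreal (\<kappa> * d)" .
      have "emeasure lborel T \<le> emeasure lborel {y \<in> {0..<l}. rmod (l / 2 ^ n) y \<in> A}"
      proof (rule emeasure_mono)
        show "T \<subseteq> {y \<in> {0..<l}. rmod (l / 2 ^ n) y \<in> A}" using \<open>n \<ge> N\<close> by (auto simp: T_def A_def)
        show "{y \<in> {0..<l}. rmod (l / 2 ^ n) y \<in> A} \<in> sets lborel" by measurable
      qed
      also have "\<dots> = 2 ^ n * emeasure lborel {u \<in> {0..<d}. u \<in> A}"
        unfolding d_def by (rule emeasure_rmod_vimage[OF meas(1) \<open>l > 0\<close>])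
      also have "\<dots> \<le> 2 ^ n * ennreal (\<kappa> * d)" by (rule mult_left_mono[OF cell]) simp
      also have "2 ^ n * ennreal (\<kappa> * d) = ennreal (2 ^ n) * ennreal (\<kappa> * d)"
        by (simp add: ennreal_power[symmetric])
      also have "\<dots> = ennreal (2 ^ n * (\<kappa> * d))"
        by (subst ennreal_mult) (use \<open>\<kappa> > 0\<close> \<open>l > 0\<close> in \<open>auto simp: d_def\<close>)
      also have "2 ^ n * (\<kappa> * d) = e" using \<open>l > 0\<close> by (simp add: d_def \<kappa>_def)
      finally show ?thesis by simp
    qed
    have "emeasure lborel T \<le> 0" by (rule ennreal_le_epsilon) (rule le)
    then have "T \<in> null_sets lborel" using Tm by (intro null_setsI) auto
    then show "{y \<in> {0..<l}. \<forall>n\<ge>N. inverse (real (Suc k)) < \<bar>g (x - rmod (l / 2 ^ n) y) - g x\<bar>} \<in> null_sets lborel"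
      unfolding T_def \<epsilon>_def .
  qed
  then have "AE y in lborel. \<forall>k N. y \<notin> {y \<in> {0..<l}. \<forall>n\<ge>N. inverse (real (Suc k)) < \<bar>g (x - rmod (l / 2 ^ n) y) - g x\<bar>}"
    unfolding AE_all_countable by (intro allI ae)
  then show ?thesis
  proof eventually_elim
    fix y assume *: "\<forall>k N. y \<notin> {y \<in> {0..<l}. \<forall>n\<ge>N. inverse (real (Suc k)) < \<bar>g (x - rmod (l / 2 ^ n) y) - g x\<bar>}"
    show "y \<in> {0..<l} \<longrightarrow> (\<forall>k N. \<exists>n\<ge>N. \<bar>g (x - rmod (l / 2 ^ n) y) - g x\<bar> \<le> inverse (real (Suc k)))"
    proof (intro impI allI)
      fix k N assume "y \<in> {0..<l}"
      then have "\<not> (\<forall>n\<ge>N. inverse (real (Suc k)) < \<bar>g (x - rmod (l / 2 ^ n) y) - g x\<bar>)" using * by blast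
      then show "\<exists>n\<ge>N. \<bar>g (x - rmod (l / 2 ^ n) y) - g x\<bar> \<le> inverse (real (Suc k))" by (meson not_less)
    qed
  qed
qed

lemma AE_cell_endpoints_lipschitz:
  fixes g :: "real \<Rightarrow> real"
  assumes g[measurable]: "g \<in> borel_measurable borel" and "l > 0" and ac: "approx_continuous g x"
    and "AE y in lborel. y \<in> {0..<l} \<longrightarrow> (\<exists>C::nat. \<forall>n. \<bar>cell_slope g l n x y\<bar> \<le> C)"
  shows "AE y in lborel. y \<in> {0..<l} \<longrightarrow> (\<exists>K::nat. \<forall>n. \<bar>g (x - rmod (l / 2 ^ n) y) - g x\<bar> \<le> real K * (l / 2 ^ n) \<and>
     \<bar>g (x - rmod (l / 2 ^ n) y + l / 2 ^ n) - g x\<bar> \<le> real K * (l / 2 ^ n))"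
  using assms(4) AE_cell_endpoint_approx[OF g \<open>l > 0\<close> ac]
proof eventually_elim
  fix y
  assume A: "y \<in> {0..<l} \<longrightarrow> (\<exists>C::nat. \<forall>n. \<bar>cell_slope g l n x y\<bar> \<le> C)"
    and B: "y \<in> {0..<l} \<longrightarrow> (\<forall>k N. \<exists>n\<ge>N. \<bar>g (x - rmod (l / 2 ^ n) y) - g x\<bar> \<le> inverse (real (Suc k)))"
  show "y \<in> {0..<l} \<longrightarrow> (\<exists>K::nat. \<forall>n. \<bar>g (x - rmod (l / 2 ^ n) y) - g x\<bar> \<le> real K * (l / 2 ^ n) \<and>
     \<bar>g (x - rmod (l / 2 ^ n) y + l / 2 ^ n) - g x\<bar> \<le> real K * (l / 2 ^ n))"
  proof
    assume y: "y \<in> {0..<l}"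
    obtain C :: nat where C: "\<And>n. \<bar>cell_slope g l n x y\<bar> \<le> real C" using A y by blast
    have approx: "\<exists>n\<ge>N. \<bar>g (x - rmod (l / 2 ^ n) y) - g x\<bar> \<le> \<epsilon>" if "\<epsilon> > 0" for \<epsilon> N
    proof -
      obtain k where "inverse (real (Suc k)) < \<epsilon>" using reals_Archimedean[OF \<open>\<epsilon> > 0\<close>] by blast
      then show ?thesis using B y by (meson less_imp_le order_trans)
    qed
    have "\<bar>g (x - rmod (l / 2 ^ n) y) - g x\<bar> \<le> real (5 * C) * (l / 2 ^ n)" for n
    proof -
      have "4 * real C * (l / 2 ^ n) \<le> real (5 * C) * (l / 2 ^ n)" using \<open>l > 0\<close> by (intro mult_right_mono) auto
      then show ?thesis using cell_endpoint_deviation_le(1)[OF \<open>l > 0\<close> C approx, of n] by linarith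
    qed
    moreover have "\<bar>g (x - rmod (l / 2 ^ n) y + l / 2 ^ n) - g x\<bar> \<le> real (5 * C) * (l / 2 ^ n)" for n
      using cell_endpoint_deviation_le(2)[OF \<open>l > 0\<close> C approx, of n] by simp
    ultimately show "\<exists>K::nat. \<forall>n. \<bar>g (x - rmod (l / 2 ^ n) y) - g x\<bar> \<le> real K * (l / 2 ^ n) \<and>
     \<bar>g (x - rmod (l / 2 ^ n) y + l / 2 ^ n) - g x\<bar> \<le> real K * (l / 2 ^ n)" by blast
  qed
qed

text \<open>With mesh \<open>d\<close>, every \<open>v\<close> in \<open>(x - d, x]\<close> is the
  left end and every \<open>v\<close> in \<open>(x, x + d]\<close> the right end of a cell around
  \<open>x\<close>, for the \<open>y\<close> with \<open>rmod d y\<close> equal to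
  \<open>x - v\<close> or \<open>x + d - v\<close>. Bad \<open>v\<close> thus correspond to bad
  \<open>y\<close>. Since \<open>Bad K\<close> collects the failures at all meshes, one large
  \<open>K\<close> makes their proportion small at every mesh.\<close>

lemma approx_lipschitz_from_cells:
  fixes g :: "real \<Rightarrow> real"
  assumes g[measurable]: "g \<in> borel_measurable borel" and "l > 0" and "\<eta> > 0"
    and ae: "AE y in lborel. y \<in> {0..<l} \<longrightarrow> (\<exists>K::nat. \<forall>n. \<bar>g (x - rmod (l / 2 ^ n) y) - g x\<bar> \<le> real K * (l / 2 ^ n) \<and>
     \<bar>g (x - rmod (l / 2 ^ n) y + l / 2 ^ n) - g x\<bar> \<le> real K * (l / 2 ^ n))"
  shows "\<exists>K::nat. \<forall>r. 0 < r \<and> r < l \<longrightarrow> emeasure lborel {v. \<bar>v - x\<bar> < r \<and> real K * r < \<bar>g v - g x\<bar>} \<le> ennreal (\<eta> * r)"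
proof -
  define Bad where "Bad = (\<lambda>K::nat. {y \<in> {0..<l}. \<exists>n. real K * (l / 2 ^ n) < \<bar>g (x - rmod (l / 2 ^ n) y) - g x\<bar> \<or>
     real K * (l / 2 ^ n) < \<bar>g (x - rmod (l / 2 ^ n) y + l / 2 ^ n) - g x\<bar>})"
  have Bm[measurable]: "Bad K \<in> sets borel" for K unfolding Bad_def by measurable
  have "decseq Bad"
  proof (rule decseq_SucI, rule subsetI)
    fix K y assume "y \<in> Bad (Suc K)"
    then obtain n where n: "y \<in> {0..<l}" "real (Suc K) * (l / 2 ^ n) < \<bar>g (x - rmod (l / 2 ^ n) y) - g x\<bar> \<or>
     real (Suc K) * (l / 2 ^ n) < \<bar>g (x - rmod (l / 2 ^ n) y + l / 2 ^ n) - g x\<bar>" unfolding Bad_def by blast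
    have "real K * (l / 2 ^ n) \<le> real (Suc K) * (l / 2 ^ n)" using \<open>l > 0\<close> by (intro mult_right_mono) auto
    then have "real K * (l / 2 ^ n) < \<bar>g (x - rmod (l / 2 ^ n) y) - g x\<bar> \<or>
     real K * (l / 2 ^ n) < \<bar>g (x - rmod (l / 2 ^ n) y + l / 2 ^ n) - g x\<bar>" using n(2) by linarith
    then show "y \<in> Bad K" using n(1) unfolding Bad_def by blast
  qed
  moreover have "emeasure lborel (Bad K) \<noteq> \<infinity>" for K
  proof -
    have "emeasure lborel (Bad K) \<le> emeasure lborel {0..<l}" by (intro emeasure_mono) (auto simp: Bad_def)
    also have "\<dots> < \<infinity>" using \<open>l > 0\<close> by simp
    finally show ?thesis by simp
  qed
  ultimately have lim: "(\<lambda>K. emeasure lborel (Bad K)) \<longlonglongrightarrow> emeasure lborel (\<Inter>K. Bad K)"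
    using Bm by (intro Lim_emeasure_decseq) auto
  have "AE y in lborel. y \<notin> (\<Inter>K. Bad K)"
    using ae
  proof eventually_elim
    fix y assume A: "y \<in> {0..<l} \<longrightarrow> (\<exists>K::nat. \<forall>n. \<bar>g (x - rmod (l / 2 ^ n) y) - g x\<bar> \<le> real K * (l / 2 ^ n) \<and>
     \<bar>g (x - rmod (l / 2 ^ n) y + l / 2 ^ n) - g x\<bar> \<le> real K * (l / 2 ^ n))"
    show "y \<notin> (\<Inter>K. Bad K)"
    proof
      assume B: "y \<in> (\<Inter>K. Bad K)"
      then have "y \<in> Bad 0" by blast
      then have "y \<in> {0..<l}" unfolding Bad_def by blast
      then obtain K :: nat where "\<forall>n. \<bar>g (x - rmod (l / 2 ^ n) y) - g x\<bar> \<le> real K * (l / 2 ^ n) \<and>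
         \<bar>g (x - rmod (l / 2 ^ n) y + l / 2 ^ n) - g x\<bar> \<le> real K * (l / 2 ^ n)" using A by blast
      then have "y \<notin> Bad K" unfolding Bad_def by (simp add: not_less)
      then show False using B by blast
    qed
  qed
  then have "(\<Inter>K. Bad K) \<in> null_sets lborel" using Bm by (subst (asm) AE_iff_null_sets[symmetric]) auto
  then have "emeasure lborel (\<Inter>K. Bad K) = 0" by (rule null_setsD1)
  with lim have "(\<lambda>K. emeasure lborel (Bad K)) \<longlonglongrightarrow> 0" by (simp only:)
  \<comment> \<open>The factor 4 pays for the two sides of \<open>x\<close> and for the mesh, which
    may be as large as \<open>2 * r\<close>.\<close>
  moreover have "(0::ennreal) < ennreal (\<eta> / 4 * l)" using \<open>\<eta> > 0\<close> \<open>l > 0\<close> by simp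
  ultimately have "eventually (\<lambda>K. emeasure lborel (Bad K) < ennreal (\<eta> / 4 * l)) sequentially"
    by (rule order_tendstoD)
  then obtain K where K: "emeasure lborel (Bad K) < ennreal (\<eta> / 4 * l)"
    by (auto simp: eventually_sequentially)
  have cell: "emeasure lborel {u \<in> {0..<l / 2 ^ n}. u \<in> A} \<le> ennreal (\<eta> / 4 * (l / 2 ^ n))"
    if [measurable]: "A \<in> sets borel" and sub: "{y \<in> {0..<l}. rmod (l / 2 ^ n) y \<in> A} \<subseteq> Bad K" for n A
  proof -
    have "ennreal (2 ^ n) * emeasure lborel {u \<in> {0..<l / 2 ^ n}. u \<in> A} = emeasure lborel {y \<in> {0..<l}. rmod (l / 2 ^ n) y \<in> A}"
      using emeasure_rmod_vimage[OF that(1) \<open>l > 0\<close>] by (simp add: ennreal_power[symmetric])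
    also have "\<dots> \<le> emeasure lborel (Bad K)" using sub Bm by (intro emeasure_mono) auto
    also have "\<dots> \<le> ennreal (\<eta> / 4 * l)" using K by (rule less_imp_le)
    finally have "ennreal (1 / 2 ^ n) * (ennreal (2 ^ n) * emeasure lborel {u \<in> {0..<l / 2 ^ n}. u \<in> A}) \<le> ennreal (1 / 2 ^ n) * ennreal (\<eta> / 4 * l)"
      by (rule mult_left_mono) simp
    moreover have "ennreal (1 / 2 ^ n) * ennreal (2 ^ n) = 1" by (subst ennreal_mult[symmetric]) auto
    moreover have "ennreal (1 / 2 ^ n) * ennreal (\<eta> / 4 * l) = ennreal (\<eta> / 4 * (l / 2 ^ n))"
      using \<open>\<eta> > 0\<close> \<open>l > 0\<close> by (subst ennreal_mult[symmetric]) auto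
    ultimately show ?thesis by (simp only: mult.assoc[symmetric] mult_1_left)
  qed
  have "emeasure lborel {v. \<bar>v - x\<bar> < r \<and> real (2 * K) * r < \<bar>g v - g x\<bar>} \<le> ennreal (\<eta> * r)" if r: "0 < r" "r < l" for r
  proof -
    \<comment> \<open>Selects the dyadic mesh \<open>d\<close> with
      \<open>r < d \<le> 2 * r\<close>, so that the cells around \<open>x\<close> reach every
      \<open>v\<close> within \<open>r\<close>.\<close>
    have "2 * r / l \<in> {0<..<2}" using r \<open>l > 0\<close> by (auto simp: field_simps)
    then obtain n :: nat where n: "1 / 2 ^ n \<le> 2 * r / l" "2 * r / l < 2 / 2 ^ n"
      unfolding dyadic_interval_cover[symmetric] by auto
    define d where "d = l / 2 ^ n"
    have d: "d \<le> 2 * r" "r < d" "d > 0" using n \<open>l > 0\<close> by (auto simp: d_def field_simps)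
    define W where "W = {v. real K * d < \<bar>g v - g x\<bar>}"
    have Wm[measurable]: "W \<in> sets borel" unfolding W_def by measurable
    define A1 where "A1 = {u. x - u \<in> W}"
    define A2 where "A2 = {u. (x + d) - u \<in> W}"
    have Am[measurable]: "A1 \<in> sets borel" "A2 \<in> sets borel" unfolding A1_def A2_def W_def by measurable
    define V1 where "V1 = {v. x - v \<in> {u \<in> {0..<d}. u \<in> A1}}"
    define V2 where "V2 = {v. (x + d) - v \<in> {u \<in> {0..<d}. u \<in> A2}}"
    have Vm[measurable]: "V1 \<in> sets borel" "V2 \<in> sets borel"
      unfolding V1_def V2_def A1_def A2_def W_def by measurable
    have "real (2 * K) * r \<ge> real K * d" using mult_left_mono[OF d(1), of "real K"] by simp
    then have sub: "{v. \<bar>v - x\<bar> < r \<and> real (2 * K) * r < \<bar>g v - g x\<bar>} \<subseteq> V1 \<union> V2"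
      using d by (auto simp: V1_def V2_def A1_def A2_def W_def)
    have "{y \<in> {0..<l}. rmod (l / 2 ^ n) y \<in> A1} \<subseteq> Bad K"
      unfolding A1_def W_def d_def Bad_def by blast
    then have 1: "emeasure lborel V1 \<le> ennreal (\<eta> / 4 * d)"
      unfolding V1_def using cell[OF Am(1)] by (subst emeasure_lborel_reflect) (measurable, simp only: d_def)
    have sw: "x + d - u = x - u + d" for u by simp
    have "{y \<in> {0..<l}. rmod (l / 2 ^ n) y \<in> A2} \<subseteq> Bad K"
      unfolding A2_def sw W_def unfolding d_def Bad_def by blast
    then have 2: "emeasure lborel V2 \<le> ennreal (\<eta> / 4 * d)"
      unfolding V2_def using cell[OF Am(2)] by (subst emeasure_lborel_reflect) (measurable, simp only: d_def)
    have "emeasure lborel {v. \<bar>v - x\<bar> < r \<and> real (2 * K) * r < \<bar>g v - g x\<bar>} \<le> emeasure lborel (V1 \<union> V2)"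
      using sub by (rule emeasure_mono) simp
    also have "\<dots> \<le> emeasure lborel V1 + emeasure lborel V2" by (rule emeasure_subadditive) auto
    also have "\<dots> \<le> ennreal (\<eta> / 4 * d) + ennreal (\<eta> / 4 * d)" by (rule add_mono[OF 1 2])
    also have "\<dots> = ennreal (\<eta> / 4 * d + \<eta> / 4 * d)" using \<open>\<eta> > 0\<close> d(3) by (intro ennreal_plus[symmetric]) auto
    also have "\<dots> \<le> ennreal (\<eta> * r)" 
    proof (rule ennreal_leI)
      have "\<eta> * d \<le> \<eta> * (2 * r)" using d(1) \<open>\<eta> > 0\<close> by (intro mult_left_mono) auto
      then show "\<eta> / 4 * d + \<eta> / 4 * d \<le> \<eta> * r" by simp
    qed
    finally show ?thesis .
  qed
  then show ?thesis by blast
qed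

lemma AE_approx_lipschitz:
  fixes g :: "real \<Rightarrow> real"
  assumes g: "g \<in> borel_measurable borel" and "\<eta> > 0"
  shows "AE x in lborel. (\<exists>\<delta>>0. cone_int g \<delta> x < \<infinity>) \<longrightarrow>
    (\<exists>r0>0. \<exists>K::nat. \<forall>r. 0 < r \<and> r < r0 \<longrightarrow> emeasure lborel {v. \<bar>v - x\<bar> < r \<and> real K * r < \<bar>g v - g x\<bar>} \<le> ennreal (\<eta> * r))"
proof -
  obtain l where l: "l > 0" "AE x in lborel. (\<exists>\<delta>>0. cone_int g \<delta> x < \<infinity>) \<longrightarrow>
     (AE y in lborel. y \<in> {0..<l} \<longrightarrow> (\<Sum>n. ennreal ((cell_diff2 g l n x y)\<^sup>2)) < \<infinity>)"
    using exists_scale_cell_diff2_sum_finite[OF g] by blast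
  show ?thesis
    using l(2) AE_AE_cell_slope_bounded[OF g l(1)] AE_approx_continuous[OF g]
  proof eventually_elim
    fix x
    assume 1: "(\<exists>\<delta>>0. cone_int g \<delta> x < \<infinity>) \<longrightarrow>
        (AE y in lborel. y \<in> {0..<l} \<longrightarrow> (\<Sum>n. ennreal ((cell_diff2 g l n x y)\<^sup>2)) < \<infinity>)"
      and 2: "AE y in lborel. y \<in> {0..<l} \<and> (\<Sum>n. ennreal ((cell_diff2 g l n x y)\<^sup>2)) < \<infinity> \<longrightarrow>
        (\<exists>C::nat. \<forall>n. \<bar>cell_slope g l n x y\<bar> \<le> C)"
      and ac: "approx_continuous g x"
    show "(\<exists>\<delta>>0. cone_int g \<delta> x < \<infinity>) \<longrightarrow>
      (\<exists>r0>0. \<exists>K::nat. \<forall>r. 0 < r \<and> r < r0 \<longrightarrow> emeasure lborel {v. \<bar>v - x\<bar> < r \<and> real K * r < \<bar>g v - g x\<bar>} \<le> ennreal (\<eta> * r))"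
    proof
      assume "\<exists>\<delta>>0. cone_int g \<delta> x < \<infinity>"
      with 1 have "AE y in lborel. y \<in> {0..<l} \<longrightarrow> (\<Sum>n. ennreal ((cell_diff2 g l n x y)\<^sup>2)) < \<infinity>" by blast
      with 2 have "AE y in lborel. y \<in> {0..<l} \<longrightarrow> (\<exists>C::nat. \<forall>n. \<bar>cell_slope g l n x y\<bar> \<le> C)"
        by eventually_elim blast
      then have "AE y in lborel. y \<in> {0..<l} \<longrightarrow> (\<exists>K::nat. \<forall>n. \<bar>g (x - rmod (l / 2 ^ n) y) - g x\<bar> \<le> real K * (l / 2 ^ n) \<and>
         \<bar>g (x - rmod (l / 2 ^ n) y + l / 2 ^ n) - g x\<bar> \<le> real K * (l / 2 ^ n))"
        by (rule AE_cell_endpoints_lipschitz[OF g l(1) ac])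
      then have "\<exists>K::nat. \<forall>r. 0 < r \<and> r < l \<longrightarrow> emeasure lborel {v. \<bar>v - x\<bar> < r \<and> real K * r < \<bar>g v - g x\<bar>} \<le> ennreal (\<eta> * r)"
        by (rule approx_lipschitz_from_cells[OF g l(1) \<open>\<eta> > 0\<close>])
      then show "\<exists>r0>0. \<exists>K::nat. \<forall>r. 0 < r \<and> r < r0 \<longrightarrow> emeasure lborel {v. \<bar>v - x\<bar> < r \<and> real K * r < \<bar>g v - g x\<bar>} \<le> ennreal (\<eta> * r)"
        using l(1) by blast
    qed
  qed
qed

section \<open>From approximate to pointwise bounds\<close>

lemma second_difference_lip_points_AE:
  fixes f g :: "real \<Rightarrow> real"
  assumes N: "N \<in> null_sets lborel" "\<And>x. x \<notin> N \<Longrightarrow> f x = g x" and g[measurable]: "g \<in> borel_measurable borel"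
  shows "AE x in lborel. (\<exists>\<delta>>0. (\<exists>C. \<forall>h. \<bar>h\<bar> < \<delta> \<longrightarrow> \<bar>f (x + h) + f (x - h) - 2 * f x\<bar> \<le> C * \<bar>h\<bar>) \<and> cone_int g \<delta> x < \<infinity>) \<longrightarrow>
     (\<exists>m::nat. x \<in> lip_points f (real (Suc m)) (inverse (real (Suc m))))"
proof -
  have Nm[measurable]: "N \<in> sets borel" using N by auto
  \<comment> \<open>The points with uniform constants. The second differences involve all
    \<open>h\<close> and the actual values of \<open>f\<close>, which is why \<open>S m\<close> may
    fail to be measurable. Leaving out \<open>N\<close> ensures \<open>f x = g x\<close>.\<close>
  define S where "S = (\<lambda>m::nat. {x. x \<notin> N \<and> (\<forall>h. \<bar>h\<bar> < inverse (real (Suc m)) \<longrightarrow> \<bar>f (x + h) + f (x - h) - 2 * f x\<bar> \<le> real (Suc m) * \<bar>h\<bar>) \<and>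
     (\<forall>r. 0 < r \<and> r < inverse (real (Suc m)) \<longrightarrow> emeasure lborel {v. \<bar>v - x\<bar> < r \<and> real (Suc m) * r < \<bar>g v - g x\<bar>} \<le> ennreal (1/16 * r))})"
  define Z where "Z = (\<lambda>m. {x \<in> S m. \<forall>d>0. \<exists>r D. 0 < r \<and> r < d \<and> D \<in> sets lebesgue \<and> D \<subseteq> cball x r \<and>
      D \<inter> S m = {} \<and> ennreal (1 * r) \<le> emeasure lebesgue D})"
  have "negligible (Z m)" for m unfolding Z_def by (rule negligible_non_density) simp
  then have "AE x in lborel. x \<notin> Z m" for m
    using AE_not_in[of "Z m" lebesgue] by (simp add: negligible_iff_null_sets AE_completion_iff)
  then have AEZ: "AE x in lborel. \<forall>m. x \<notin> Z m"
    unfolding AE_all_countable by (rule allI)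
  have "0 < (1/16 :: real)" by simp
  from AEZ show ?thesis
    using AE_not_in[OF N(1)] AE_approx_lipschitz[OF g \<open>0 < (1/16 :: real)\<close>]
  proof eventually_elim
    fix x
    assume Z: "\<forall>m. x \<notin> Z m" and "x \<notin> N" and ap: "(\<exists>\<delta>>0. cone_int g \<delta> x < \<infinity>) \<longrightarrow>
      (\<exists>r0>0. \<exists>K::nat. \<forall>r. 0 < r \<and> r < r0 \<longrightarrow> emeasure lborel {v. \<bar>v - x\<bar> < r \<and> real K * r < \<bar>g v - g x\<bar>} \<le> ennreal (1/16 * r))"
    show "(\<exists>\<delta>>0. (\<exists>C. \<forall>h. \<bar>h\<bar> < \<delta> \<longrightarrow> \<bar>f (x + h) + f (x - h) - 2 * f x\<bar> \<le> C * \<bar>h\<bar>) \<and> cone_int g \<delta> x < \<infinity>) \<longrightarrow>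
     (\<exists>m::nat. x \<in> lip_points f (real (Suc m)) (inverse (real (Suc m))))"
    proof (intro impI, elim exE conjE)
      fix \<delta> C
      assume \<delta>: "\<delta> > 0" "\<forall>h. \<bar>h\<bar> < \<delta> \<longrightarrow> \<bar>f (x + h) + f (x - h) - 2 * f x\<bar> \<le> C * \<bar>h\<bar>" "cone_int g \<delta> x < \<infinity>"
      obtain r0 :: real and K :: nat where r0: "r0 > 0" "\<And>r. 0 < r \<Longrightarrow> r < r0 \<Longrightarrow>
          emeasure lborel {v. \<bar>v - x\<bar> < r \<and> real K * r < \<bar>g v - g x\<bar>} \<le> ennreal (1/16 * r)"
        using ap \<delta>(1,3) by blast
      obtain m :: nat where "max (max (1 / \<delta>) (1 / r0)) (max C (real K)) \<le> real m" using real_arch_simple by blast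
      then have m': "1 / \<delta> \<le> real m" "1 / r0 \<le> real m" "C \<le> real m" "real K \<le> real m" by auto
      define M where "M = real (Suc m)"
      define \<rho> where "\<rho> = inverse M"
      have "M > 0" "\<rho> > 0" by (auto simp: M_def \<rho>_def)
      have "1 \<le> M * \<delta>" "1 \<le> M * r0" using m'(1,2) \<delta>(1) r0(1) by (auto simp: M_def field_simps)
      then have \<rho>: "\<rho> \<le> \<delta>" "\<rho> \<le> r0" using \<open>M > 0\<close> by (auto simp: \<rho>_def field_simps)
      have MK: "C \<le> M" "real K \<le> M" using m' by (auto simp: M_def)
      have xS: "x \<in> S m"
        unfolding S_def M_def[symmetric] \<rho>_def[symmetric]
      proof (intro CollectI conjI allI impI)
        fix h assume "\<bar>h\<bar> < \<rho>"
        then have "\<bar>f (x + h) + f (x - h) - 2 * f x\<bar> \<le> C * \<bar>h\<bar>" using \<delta>(2) \<rho> by auto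
        also have "\<dots> \<le> M * \<bar>h\<bar>" using MK by (intro mult_right_mono) auto
        finally show "\<bar>f (x + h) + f (x - h) - 2 * f x\<bar> \<le> M * \<bar>h\<bar>" .
      next
        fix r assume r: "0 < r \<and> r < \<rho>"
        have "{v. \<bar>v - x\<bar> < r \<and> M * r < \<bar>g v - g x\<bar>} \<subseteq> {v. \<bar>v - x\<bar> < r \<and> real K * r < \<bar>g v - g x\<bar>}"
        proof -
          have "real K * r \<le> M * r" using MK(2) r by (intro mult_right_mono) auto
          then show ?thesis by auto
        qed
        then have "emeasure lborel {v. \<bar>v - x\<bar> < r \<and> M * r < \<bar>g v - g x\<bar>} \<le> emeasure lborel {v. \<bar>v - x\<bar> < r \<and> real K * r < \<bar>g v - g x\<bar>}"
          by (rule emeasure_mono) measurable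
        also have "\<dots> \<le> ennreal (1/16 * r)" using r \<rho> by (intro r0(2)) auto
        finally show "emeasure lborel {v. \<bar>v - x\<bar> < r \<and> M * r < \<bar>g v - g x\<bar>} \<le> ennreal (1/16 * r)" .
      qed (fact \<open>x \<notin> N\<close>)
      have "x \<notin> Z m" using Z by blast
      then have "\<not> (\<forall>d>0. \<exists>r D. 0 < r \<and> r < d \<and> D \<in> sets lebesgue \<and> D \<subseteq> cball x r \<and>
          D \<inter> S m = {} \<and> ennreal (1 * r) \<le> emeasure lebesgue D)" using xS unfolding Z_def by blast
      then obtain d where d: "d > 0" "\<And>r D. 0 < r \<Longrightarrow> r < d \<Longrightarrow> D \<in> sets lebesgue \<Longrightarrow> D \<subseteq> cball x r \<Longrightarrow>
          ennreal (1 * r) \<le> emeasure lebesgue D \<Longrightarrow> D \<inter> S m \<noteq> {}" by blast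
      have main: "\<bar>f y - f x\<bar> \<le> 14 * M * \<bar>y - x\<bar>" if y: "y \<noteq> x" "\<bar>y - x\<bar> < d" "4 * \<bar>y - x\<bar> < \<rho>" for y
      proof -
        define r where "r = \<bar>y - x\<bar>"
        have r: "0 < r" "r < d" "4 * r < \<rho>" using y by (auto simp: r_def)
        \<comment> \<open>The reflected point satisfies
          \<open>\<bar>2 * u - y - x\<bar> \<le> 3 * r\<close>, so radius \<open>4 * r\<close>
          covers both \<open>u\<close> and its reflection; \<open>1/16\<close> of it leaves a bad
          set of measure at most \<open>r / 4\<close>. Adjoining \<open>N\<close> below turns bounds
          for \<open>g\<close> into bounds for \<open>f\<close>.\<close>
        define W where "W = {v. \<bar>v - x\<bar> < 4 * r \<and> M * (4 * r) < \<bar>g v - g x\<bar>}"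
        have Wm[measurable]: "W \<in> sets borel" unfolding W_def by measurable
        have "\<forall>r. 0 < r \<and> r < \<rho> \<longrightarrow> emeasure lborel {v. \<bar>v - x\<bar> < r \<and> M * r < \<bar>g v - g x\<bar>} \<le> ennreal (1/16 * r)"
          using xS unfolding S_def M_def[symmetric] \<rho>_def[symmetric] by blast
        then have "emeasure lborel W \<le> ennreal (1/16 * (4 * r))"
          using r unfolding W_def by (elim allE[of _ "4 * r"]) simp
        then have We: "emeasure lborel W \<le> ennreal (r / 4)" by simp
        define W' where "W' = W \<union> N"
        have W'm[measurable]: "W' \<in> sets borel" unfolding W'_def by measurable
        have "emeasure lborel W' = emeasure lborel W"
          unfolding W'_def using N(1) by (intro emeasure_Un_null_set) auto
        then have W'e: "emeasure lborel W' \<le> ennreal (r / 4)" using We by simp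
        have W'2m: "{u. 2 * u - y \<in> W'} \<in> sets borel"
        proof -
          have "(\<lambda>u. 2 * u - y) -` W' \<inter> space borel \<in> sets borel"
            by (intro measurable_sets[of _ _ borel]) auto
          then show ?thesis by (simp add: vimage_def)
        qed
        have W'2e: "emeasure lborel {u. 2 * u - y \<in> W'} \<le> ennreal (r / 4)"
        proof -
          have "emeasure lborel W' = (\<integral>\<^sup>+s. indicator W' s \<partial>lborel)" by simp
          also have "\<dots> = ennreal \<bar>2\<bar> * (\<integral>\<^sup>+u. indicator W' (- y + 2 * u) \<partial>lborel)"
            by (rule nn_integral_real_affine) auto
          also have "(\<integral>\<^sup>+u. indicator W' (- y + 2 * u) \<partial>lborel) = (\<integral>\<^sup>+u. indicator {u. 2 * u - y \<in> W'} u \<partial>lborel)"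
            by (intro nn_integral_cong) (auto simp: indicator_def)
          also have "\<dots> = emeasure lborel {u. 2 * u - y \<in> W'}"
            using W'2m by (intro nn_integral_indicator) simp
          finally have eq: "emeasure lborel W' = ennreal \<bar>2\<bar> * emeasure lborel {u. 2 * u - y \<in> W'}" .
          have "1 * emeasure lborel {u. 2 * u - y \<in> W'} \<le> ennreal \<bar>2\<bar> * emeasure lborel {u. 2 * u - y \<in> W'}"
            by (rule mult_right_mono) auto
          then show ?thesis using eq W'e by simp
        qed
        \<comment> \<open>The admissible centres of reflection: from length \<open>2 * r\<close>, at
          most \<open>r / 4\<close> is lost for \<open>u\<close> and at most \<open>r / 4\<close>
          for \<open>2 * u - y\<close>. More than \<open>r\<close> remains, so the density of
          \<open>S m\<close> at \<open>x\<close>, used with proportion 1, yields a centre in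
          \<open>S m\<close>.\<close>
        define D where "D = {x - r..x + r} - (W' \<union> {u. 2 * u - y \<in> W'})"
        have Dm: "D \<in> sets borel" unfolding D_def using W'2m by auto
        have "ennreal (2 * r) = emeasure lborel {x - r..x + r}" using r by simp
        also have "\<dots> \<le> emeasure lborel (D \<union> (W' \<union> {u. 2 * u - y \<in> W'}))"
          using W'2m Dm by (intro emeasure_mono) (auto simp: D_def)
        also have "\<dots> \<le> emeasure lborel D + emeasure lborel (W' \<union> {u. 2 * u - y \<in> W'})"
          using W'2m Dm by (intro emeasure_subadditive) auto
        also have "\<dots> \<le> emeasure lborel D + ennreal (r / 4 + r / 4)"
        proof (rule add_left_mono)
          have "emeasure lborel (W' \<union> {u. 2 * u - y \<in> W'}) \<le> emeasure lborel W' + emeasure lborel {u. 2 * u - y \<in> W'}"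
            using W'2m by (intro emeasure_subadditive) auto
          also have "\<dots> \<le> ennreal (r / 4) + ennreal (r / 4)" by (rule add_mono[OF W'e W'2e])
          also have "\<dots> = ennreal (r / 4 + r / 4)" using r by (intro ennreal_plus[symmetric]) auto
          finally show "emeasure lborel (W' \<union> {u. 2 * u - y \<in> W'}) \<le> ennreal (r / 4 + r / 4)" .
        qed
        finally have big: "ennreal (2 * r) \<le> emeasure lborel D + ennreal (r / 4 + r / 4)" .
        have "ennreal r \<le> emeasure lborel D"
        proof (cases "emeasure lborel D")
          case (real q)
          then have "2 * r \<le> q + (r / 4 + r / 4)"
            using big r by (simp add: ennreal_plus[symmetric] del: ennreal_plus)
          then show ?thesis using real r by (auto intro: ennreal_leI)
        qed simp
        then have "D \<inter> S m \<noteq> {}"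
          using Dm r by (intro d(2)[of r]) (auto simp: D_def dist_real_def)
        then obtain u where u: "u \<in> D" "u \<in> S m" by blast
        have notW: "u \<notin> W'" "2 * u - y \<notin> W'" and ur: "\<bar>u - x\<bar> \<le> r" using u(1) by (auto simp: D_def)
        have fg: "\<bar>f v - f x\<bar> \<le> M * (4 * r)" if "v \<notin> W'" "\<bar>v - x\<bar> < 4 * r" for v
          using that N(2)[of v] N(2)[OF \<open>x \<notin> N\<close>] by (auto simp: W'_def W_def)
        have 1: "\<bar>f u - f x\<bar> \<le> M * (4 * r)" using notW ur r by (intro fg) auto
        have yr: "\<bar>y - x\<bar> = r" by (simp add: r_def)
        have 2: "\<bar>f (2 * u - y) - f x\<bar> \<le> M * (4 * r)"
        proof (rule fg[OF notW(2)])
          show "\<bar>2 * u - y - x\<bar> < 4 * r" using ur yr r(1) by linarith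
        qed
        have h: "\<bar>y - u\<bar> \<le> 2 * r" using ur yr by linarith
        then have "\<bar>y - u\<bar> < \<rho>" using r by linarith
        then have "\<bar>f (u + (y - u)) + f (u - (y - u)) - 2 * f u\<bar> \<le> M * \<bar>y - u\<bar>"
          using u(2) unfolding S_def M_def[symmetric] \<rho>_def[symmetric] by blast
        also have "\<dots> \<le> M * (2 * r)" using h \<open>M > 0\<close> by (intro mult_left_mono) auto
        finally have 3: "\<bar>f y + f (2 * u - y) - 2 * f u\<bar> \<le> M * (2 * r)" by (simp add: algebra_simps)
        \<comment> \<open>The weights 2 for the second difference, \<open>2 * 4\<close> for the
          centre and 4 for the reflected point add up to 14.\<close>
        have "f y - f x = (f y + f (2 * u - y) - 2 * f u) + 2 * (f u - f x) - (f (2 * u - y) - f x)" by simp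
        then have "\<bar>f y - f x\<bar> \<le> M * (2 * r) + 2 * (M * (4 * r)) + M * (4 * r)" using 1 2 3 by linarith
        also have "\<dots> = 14 * M * \<bar>y - x\<bar>" by (simp add: yr algebra_simps)
        finally show ?thesis .
      qed
      obtain n :: nat where "max (14 * M) (max (1 / d) (4 / \<rho>)) \<le> real n" using real_arch_simple by blast
      then have n: "14 * M \<le> real n" "1 / d \<le> real n" "4 / \<rho> \<le> real n" by auto
      have "x \<in> lip_points f (real (Suc n)) (inverse (real (Suc n)))"
        unfolding lip_points_def
      proof (intro CollectI allI impI)
        fix y assume y: "\<bar>y - x\<bar> < inverse (real (Suc n))"
        show "\<bar>f y - f x\<bar> \<le> real (Suc n) * \<bar>y - x\<bar>"
        proof (cases "y = x")
          case False
          have "1 \<le> real (Suc n) * d" using n(2) d(1) by (simp add: field_simps)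
          then have "inverse (real (Suc n)) \<le> d" by (simp add: field_simps)
          moreover have "4 \<le> real (Suc n) * \<rho>" using n(3) \<open>\<rho> > 0\<close> by (simp add: field_simps)
          then have "4 * inverse (real (Suc n)) \<le> \<rho>" by (simp add: field_simps)
          ultimately have "\<bar>f y - f x\<bar> \<le> 14 * M * \<bar>y - x\<bar>" using y False by (intro main) auto
          also have "\<dots> \<le> real (Suc n) * \<bar>y - x\<bar>" using n(1) by (intro mult_right_mono) auto
          finally show ?thesis .
        qed simp
      qed
      then show "\<exists>m::nat. x \<in> lip_points f (real (Suc m)) (inverse (real (Suc m)))" by blast
    qed
  qed
qed

section \<open>Localisation to \<open>U\<close> and conclusion\<close>

lemma Delta2_SUP_finite_iff:
  assumes "\<delta> > 0" "\<And>h. \<bar>h\<bar> < \<delta> \<Longrightarrow> x + h \<in> U"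
  shows "(SUP h\<in>{h \<in> Delta2_dom U x. \<bar>h\<bar> < \<delta>}. ereal \<bar>Delta2 f x h\<bar>) < \<infinity> \<longleftrightarrow>
    (\<exists>C. \<forall>h. \<bar>h\<bar> < \<delta> \<longrightarrow> \<bar>f (x + h) + f (x - h) - 2 * f x\<bar> \<le> C * \<bar>h\<bar>)"
    (is "?S < \<infinity> \<longleftrightarrow> ?R")
proof
  have dom: "h \<in> Delta2_dom U x" if "\<bar>h\<bar> < \<delta>" "h \<noteq> 0" for h
    using assms(2)[of h] assms(2)[of "-h"] assms(2)[of 0] that \<open>\<delta> > 0\<close> by (simp add: Delta2_dom_def)
  assume "?S < \<infinity>"
  then have "?S \<noteq> \<infinity>" by (rule less_imp_neq)
  then obtain c :: nat where c: "?S < ereal (real c)" unfolding less_PInf_Ex_of_nat by blast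
  have "\<bar>f (x + h) + f (x - h) - 2 * f x\<bar> \<le> 2 * real c * \<bar>h\<bar>" if "\<bar>h\<bar> < \<delta>" for h
  proof (cases "h = 0")
    case False
    have "ereal \<bar>Delta2 f x h\<bar> \<le> ?S" using dom[OF that False] that by (intro SUP_upper) auto
    also have "\<dots> < ereal (real c)" by (rule c)
    finally have "\<bar>Delta2 f x h\<bar> < c" by simp
    then show ?thesis using False by (simp add: Delta2_def field_simps)
  qed simp
  then show ?R by blast
next
  assume ?R
  then obtain C where C: "\<And>h. \<bar>h\<bar> < \<delta> \<Longrightarrow> \<bar>f (x + h) + f (x - h) - 2 * f x\<bar> \<le> C * \<bar>h\<bar>" by blast
  have "?S \<le> ereal (C / 2)"
  proof (rule SUP_least)
    fix h assume "h \<in> {h \<in> Delta2_dom U x. \<bar>h\<bar> < \<delta>}"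
    then have "h \<noteq> 0" "\<bar>h\<bar> < \<delta>" by (auto simp: Delta2_dom_def)
    then show "ereal \<bar>Delta2 f x h\<bar> \<le> ereal (C / 2)" using C[of h] by (simp add: Delta2_def field_simps)
  qed
  then show "?S < \<infinity>" by (rule le_less_trans) simp
qed

lemma h0_pos:
  assumes "open U" "x \<in> U"
  shows "h0 U x > 0"
proof (cases "U = UNIV")
  case False
  then have "infdist x (- U) > 0"
    using assms by (subst infdist_pos_not_in_closed) (auto simp: closed_Compl)
  then show ?thesis using False by (simp add: h0_def)
qed (simp add: h0_def)

lemma h0_subset:
  assumes "x \<in> U" "\<bar>y - x\<bar> < 2 * h0 U x"
  shows "y \<in> U"
proof (rule ccontr)
  assume "y \<notin> U"
  then have "U \<noteq> UNIV" by blast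
  then have "2 * h0 U x \<le> infdist x (- U)" by (simp add: h0_def)
  also have "\<dots> \<le> dist x y" using \<open>y \<notin> U\<close> by (intro infdist_le) auto
  finally show False using assms(2) by (simp add: dist_real_def)
qed

text \<open>Below height \<open>h0 U x\<close> the points \<open>s\<close>, \<open>s + t\<close>,
  \<open>s - t\<close> all lie in \<open>U\<close>, so the integral does not depend on the extension
  \<open>F\<close> of \<open>f\<close>.\<close>

lemma square_integral_eq_cone_int:
  assumes "N \<in> null_sets lborel" "\<And>y. y \<notin> N \<Longrightarrow> F y = g y" "g \<in> borel_measurable borel"
    and "\<And>y. y \<in> U \<Longrightarrow> F y = f y" "x \<in> U"
  shows "(\<integral>\<^sup>+(s, t)\<in>Gamma_cone U x \<inter> {(s, t). 0 < t \<and> t < \<delta>}. ennreal ((Delta2 f s t)\<^sup>2 / t\<^sup>2) \<partial>lebesgue)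
     = cone_int g (min \<delta> (h0 U x)) x"
proof -
  have "(\<integral>\<^sup>+(s, t)\<in>Gamma_cone U x \<inter> {(s, t). 0 < t \<and> t < \<delta>}. ennreal ((Delta2 f s t)\<^sup>2 / t\<^sup>2) \<partial>lebesgue)
    = (\<integral>\<^sup>+p. (if \<bar>fst p - x\<bar> < snd p \<and> snd p < min \<delta> (h0 U x) then ennreal ((Delta2 F (fst p) (snd p))\<^sup>2 / (snd p)\<^sup>2) else 0) \<partial>lebesgue)"
  proof (rule nn_integral_cong)
    fix p :: "real \<times> real"
    obtain s t where p: "p = (s, t)" by (cases p)
    have "Delta2 F s t = Delta2 f s t" if "\<bar>s - x\<bar> < t" "t < h0 U x"
    proof -
      have "s \<in> U" "s + t \<in> U" "s - t \<in> U"
        using that by (auto intro!: h0_subset[OF \<open>x \<in> U\<close>] simp: abs_less_iff)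
      then show ?thesis by (simp add: Delta2_def assms(4))
    qed
    then show "(case p of (s, t) \<Rightarrow> ennreal ((Delta2 f s t)\<^sup>2 / t\<^sup>2)) * indicator (Gamma_cone U x \<inter> {(s, t). 0 < t \<and> t < \<delta>}) p =
       (if \<bar>fst p - x\<bar> < snd p \<and> snd p < min \<delta> (h0 U x) then ennreal ((Delta2 F (fst p) (snd p))\<^sup>2 / (snd p)\<^sup>2) else 0)"
      by (auto simp: p Gamma_cone_def indicator_def)
  qed
  also have "\<dots> = cone_int g (min \<delta> (h0 U x)) x"
    by (rule cone_int_eq_plane_integral[OF assms(1) _ assms(3)]) (rule assms(2))
  finally show ?thesis .
qed

text \<open>Both conditions are inherited by smaller \<open>\<delta>\<close>, so
  \<open>\<delta>\<close> may be cut down to \<open>h0 U x\<close>, below which only points of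
  \<open>U\<close> are evaluated. After this step \<open>U\<close> has left the problem.\<close>

lemma square_points_iff:
  assumes "open U" "N \<in> null_sets lborel" "\<And>y. y \<notin> N \<Longrightarrow> F y = g y" "g \<in> borel_measurable borel"
    and F: "\<And>y. y \<in> U \<Longrightarrow> F y = f y" and "x \<in> U"
  shows "x \<in> square_points U f \<longleftrightarrow>
    (\<exists>\<delta>>0. (\<exists>C. \<forall>h. \<bar>h\<bar> < \<delta> \<longrightarrow> \<bar>F (x + h) + F (x - h) - 2 * F x\<bar> \<le> C * \<bar>h\<bar>) \<and> cone_int g \<delta> x < \<infinity>)"
    (is "_ \<longleftrightarrow> (\<exists>\<delta>>0. ?Q \<delta>)")
proof -
  define e where "e = h0 U x"
  have "e > 0" using h0_pos[OF \<open>open U\<close> \<open>x \<in> U\<close>] by (simp add: e_def)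
  let ?I = "\<lambda>\<delta>. \<integral>\<^sup>+(s, t)\<in>Gamma_cone U x \<inter> {(s, t). 0 < t \<and> t < \<delta>}. ennreal ((Delta2 f s t)\<^sup>2 / t\<^sup>2) \<partial>lebesgue"
  let ?S = "\<lambda>\<delta>. SUP h\<in>{h \<in> Delta2_dom U x. \<bar>h\<bar> < \<delta>}. ereal \<bar>Delta2 f x h\<bar>"
  have I: "?I \<delta> = cone_int g (min \<delta> e) x" for \<delta>
    unfolding e_def by (rule square_integral_eq_cone_int[OF assms(2) _ assms(4) _ \<open>x \<in> U\<close>]) (rule assms(3), assumption, rule F, assumption)
  have inU: "x + h \<in> U" "x - h \<in> U" if "\<bar>h\<bar> < e" for h
    using that \<open>e > 0\<close> by (auto intro!: h0_subset[OF \<open>x \<in> U\<close>] simp: e_def)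
  have S: "?S \<delta> < \<infinity> \<longleftrightarrow> (\<exists>C. \<forall>h. \<bar>h\<bar> < \<delta> \<longrightarrow> \<bar>F (x + h) + F (x - h) - 2 * F x\<bar> \<le> C * \<bar>h\<bar>)"
    if "0 < \<delta>" "\<delta> \<le> e" for \<delta>
  proof -
    have "F (x + h) = f (x + h)" "F (x - h) = f (x - h)" if "\<bar>h\<bar> < \<delta>" for h
      using inU[of h] that \<open>\<delta> \<le> e\<close> by (auto intro: F)
    moreover have "?S \<delta> < \<infinity> \<longleftrightarrow> (\<exists>C. \<forall>h. \<bar>h\<bar> < \<delta> \<longrightarrow> \<bar>f (x + h) + f (x - h) - 2 * f x\<bar> \<le> C * \<bar>h\<bar>)"
      using that inU by (intro Delta2_SUP_finite_iff) auto
    ultimately show ?thesis using F[OF \<open>x \<in> U\<close>] by simp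
  qed
  have Smono: "?S \<delta>' \<le> ?S \<delta>" if "\<delta>' \<le> \<delta>" for \<delta> \<delta>' using that by (intro SUP_subset_mono) auto
  show ?thesis
  proof
    assume "x \<in> square_points U f"
    then obtain \<delta> where \<delta>: "\<delta> > 0" "?S \<delta> < \<infinity>" "?I \<delta> < \<infinity>" unfolding square_points_def by blast
    have "?S (min \<delta> e) < \<infinity>" using le_less_trans[OF Smono \<delta>(2), of "min \<delta> e"] by simp
    then have "?Q (min \<delta> e)" using S[of "min \<delta> e"] \<delta>(1,3) \<open>e > 0\<close> unfolding I by simp
    then show "\<exists>\<delta>>0. ?Q \<delta>" using \<delta>(1) \<open>e > 0\<close> by (intro exI[of _ "min \<delta> e"]) simp
  next
    assume "\<exists>\<delta>>0. ?Q \<delta>"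
    then obtain \<delta> C where \<delta>: "\<delta> > 0" "\<And>h. \<bar>h\<bar> < \<delta> \<Longrightarrow> \<bar>F (x + h) + F (x - h) - 2 * F x\<bar> \<le> C * \<bar>h\<bar>" "cone_int g \<delta> x < \<infinity>"
      by blast
    define \<delta>' where "\<delta>' = min \<delta> e"
    have \<delta>': "0 < \<delta>'" "\<delta>' \<le> e" "\<delta>' \<le> \<delta>" using \<delta>(1) \<open>e > 0\<close> by (auto simp: \<delta>'_def)
    have "?S \<delta>' < \<infinity>" unfolding S[OF \<delta>'(1,2)] using \<delta>(2) \<delta>'(3) by (intro exI[of _ C]) auto
    moreover have "?I \<delta>' < \<infinity>"
      unfolding I using \<delta>' by (intro le_less_trans[OF cone_int_mono \<delta>(3)]) auto
    ultimately show "x \<in> square_points U f" unfolding square_points_def using \<delta>'(1) \<open>x \<in> U\<close> by blast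
  qed
qed

lemma differentiable_lip_points:
  fixes f :: "real \<Rightarrow> real"
  assumes "f differentiable (at x)"
  shows "\<exists>m::nat. x \<in> lip_points f (real (Suc m)) (inverse (real (Suc m)))"
proof -
  obtain l where "(f has_real_derivative l) (at x)" using assms real_differentiable_def by blast
  then have lim: "(\<lambda>h. (f (x + h) - f x) / h) \<midarrow>0\<rightarrow> l" by (simp add: DERIV_def)
  obtain s where s0: "s > 0" "\<forall>h. h \<noteq> 0 \<and> norm (h - 0) < s \<longrightarrow> norm ((f (x + h) - f x) / h - l) < 1"
    using LIM_D[OF lim zero_less_one] by blast
  have s: "\<bar>(f (x + h) - f x) / h - l\<bar> < 1" if "h \<noteq> 0" "\<bar>h\<bar> < s" for h
    using s0 that by auto
  obtain m :: nat where "max (\<bar>l\<bar> + 1) (1 / s) \<le> real m" using real_arch_simple by blast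
  then have m: "\<bar>l\<bar> + 1 \<le> real m" "1 / s \<le> real m" by auto
  have "1 \<le> real (Suc m) * s" using m(2) s0(1) by (simp add: field_simps)
  then have ms: "inverse (real (Suc m)) \<le> s" by (simp add: field_simps)
  have "x \<in> lip_points f (real (Suc m)) (inverse (real (Suc m)))"
    unfolding lip_points_def
  proof (intro CollectI allI impI)
    fix y assume y: "\<bar>y - x\<bar> < inverse (real (Suc m))"
    show "\<bar>f y - f x\<bar> \<le> real (Suc m) * \<bar>y - x\<bar>"
    proof (cases "y = x")
      case False
      then have "\<bar>(f (x + (y - x)) - f x) / (y - x) - l\<bar> < 1" using y ms by (intro s) auto
      then have "\<bar>(f y - f x) / (y - x) - l\<bar> < 1" by simp
      then have "\<bar>(f y - f x) / (y - x)\<bar> \<le> \<bar>l\<bar> + 1" by linarith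
      also have "\<dots> \<le> real (Suc m)" using m(1) by simp
      finally have "\<bar>f y - f x\<bar> / \<bar>y - x\<bar> \<le> real (Suc m)" by (simp only: abs_divide)
      moreover have "\<bar>y - x\<bar> > 0" using False by simp
      ultimately show ?thesis by (simp only: pos_divide_le_eq)
    qed simp
  qed
  then show ?thesis by blast
qed

lemma lip_points_second_difference:
  assumes "x \<in> lip_points f M d" "\<bar>h\<bar> < d"
  shows "\<bar>f (x + h) + f (x - h) - 2 * f x\<bar> \<le> 2 * M * \<bar>h\<bar>"
proof -
  have "\<bar>f (x + h) - f x\<bar> \<le> M * \<bar>h\<bar>" "\<bar>f (x - h) - f x\<bar> \<le> M * \<bar>h\<bar>"
    using lip_points_local_lipschitz[OF assms(1), of "x + h"] lip_points_local_lipschitz[OF assms(1), of "x - h"] assms(2) by auto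
  then show ?thesis unfolding mult.assoc by linarith
qed

theorem theorem2:
  fixes U :: "real set" and f :: "real \<Rightarrow> real"
  assumes "open U"
    and "f \<in> borel_measurable (lebesgue_on U)"
  shows "sym_diff (diff_points U f) (square_points U f) \<in> null_sets lebesgue"
proof -
  \<comment> \<open>Extension by 0 is harmless: at points of the open set \<open>U\<close>,
    differentiability and the conditions of \<open>square_points\<close> for small
    \<open>\<delta>\<close> only involve nearby points of \<open>U\<close>.\<close>
  define F where "F = (\<lambda>x. if x \<in> U then f x else 0)"
  have FU: "F y = f y" if "y \<in> U" for y using that by (simp add: F_def)
  have "U \<in> sets lebesgue" using \<open>open U\<close> by auto
  then have "F \<in> borel_measurable lebesgue"
    unfolding F_def using assms(2) borel_measurable_if_I by blast
  \<comment> \<open>Composing a merely Lebesgue measurable function with the affine maps in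
    \<open>Delta2\<close> would leave the Borel setting, so the integrals are computed with
    \<open>g\<close>; the pointwise conditions keep \<open>F\<close>, as they are sensitive to null
    sets.\<close>
  then obtain g where g: "g \<in> borel_measurable lborel" "AE x in lborel. F x = g x"
    using completion_ex_borel_measurable_real[of F lborel] by auto
  have g': "g \<in> borel_measurable borel" using g(1) by simp
  obtain N where N: "N \<in> null_sets lborel" "{x \<in> space lborel. \<not> F x = g x} \<subseteq> N"
    using g(2) by (auto simp: eventually_ae_filter)
  have Ng: "F x = g x" if "x \<notin> N" for x using N(2) that by auto
  have dF: "f differentiable (at x) \<longleftrightarrow> F differentiable (at x)" if "x \<in> U" for x
  proof -
    have ev: "eventually (\<lambda>y. f y = F y) (nhds x)"
      using eventually_nhds_in_open[OF \<open>open U\<close> that] by eventually_elim (simp add: FU)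
    then have "(f has_real_derivative l) (at x) \<longleftrightarrow> (F has_real_derivative l) (at x)" for l
      by (intro DERIV_cong_ev) auto
    then show ?thesis by (simp add: real_differentiable_def)
  qed
  have AE1: "AE x in lborel. \<forall>m. x \<in> lip_points F (real (Suc m)) (inverse (real (Suc m))) \<longrightarrow> (\<exists>\<delta>>0. cone_int g \<delta> x < \<infinity>)"
    unfolding AE_all_countable by (intro allI lip_points_cone_int_finite[OF _ _ N(1) Ng g']) auto
  have AE2: "AE x in lborel. \<forall>m. x \<in> lip_points F (real (Suc m)) (inverse (real (Suc m))) \<longrightarrow> F differentiable (at x)"
    unfolding AE_all_countable
  proof
    fix m
    have "{x \<in> lip_points F (real (Suc m)) (inverse (real (Suc m))). \<not> F differentiable (at x)} \<in> null_sets lebesgue"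
      using lip_points_differentiable_AE[of "inverse (real (Suc m))" "real (Suc m)" F] by (simp add: negligible_iff_null_sets)
    from AE_not_in[OF this]
    show "AE x in lborel. x \<in> lip_points F (real (Suc m)) (inverse (real (Suc m))) \<longrightarrow> F differentiable (at x)"
      unfolding AE_completion_iff by eventually_elim blast
  qed
  have AE3: "AE x in lborel. (\<exists>\<delta>>0. (\<exists>C. \<forall>h. \<bar>h\<bar> < \<delta> \<longrightarrow> \<bar>F (x + h) + F (x - h) - 2 * F x\<bar> \<le> C * \<bar>h\<bar>) \<and> cone_int g \<delta> x < \<infinity>) \<longrightarrow>
     (\<exists>m::nat. x \<in> lip_points F (real (Suc m)) (inverse (real (Suc m))))"
    by (rule second_difference_lip_points_AE[OF N(1) Ng g'])
  have "AE x in lborel. x \<notin> sym_diff (diff_points U f) (square_points U f)"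
    using AE1 AE2 AE3
  proof eventually_elim
    fix x
    assume 1: "\<forall>m. x \<in> lip_points F (real (Suc m)) (inverse (real (Suc m))) \<longrightarrow> (\<exists>\<delta>>0. cone_int g \<delta> x < \<infinity>)"
      and 2: "\<forall>m. x \<in> lip_points F (real (Suc m)) (inverse (real (Suc m))) \<longrightarrow> F differentiable (at x)"
      and 3: "(\<exists>\<delta>>0. (\<exists>C. \<forall>h. \<bar>h\<bar> < \<delta> \<longrightarrow> \<bar>F (x + h) + F (x - h) - 2 * F x\<bar> \<le> C * \<bar>h\<bar>) \<and> cone_int g \<delta> x < \<infinity>) \<longrightarrow>
     (\<exists>m::nat. x \<in> lip_points F (real (Suc m)) (inverse (real (Suc m))))"
    have "x \<in> diff_points U f \<longleftrightarrow> x \<in> square_points U f"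
    proof (cases "x \<in> U")
      case True
      have sq: "x \<in> square_points U f \<longleftrightarrow>
        (\<exists>\<delta>>0. (\<exists>C. \<forall>h. \<bar>h\<bar> < \<delta> \<longrightarrow> \<bar>F (x + h) + F (x - h) - 2 * F x\<bar> \<le> C * \<bar>h\<bar>) \<and> cone_int g \<delta> x < \<infinity>)"
        by (rule square_points_iff[OF \<open>open U\<close> N(1) Ng g' FU True])
      show ?thesis
      proof
        assume "x \<in> diff_points U f"
        then have "F differentiable (at x)" using dF[OF True] by (simp add: diff_points_def)
        then obtain m where m: "x \<in> lip_points F (real (Suc m)) (inverse (real (Suc m)))"
          using differentiable_lip_points by blast
        then obtain \<delta> where \<delta>: "\<delta> > 0" "cone_int g \<delta> x < \<infinity>" using 1 by blast
        define e where "e = min \<delta> (inverse (real (Suc m)))"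
        have "e > 0" using \<delta>(1) by (simp add: e_def)
        moreover have "\<bar>F (x + h) + F (x - h) - 2 * F x\<bar> \<le> 2 * real (Suc m) * \<bar>h\<bar>" if "\<bar>h\<bar> < e" for h
          using that by (intro lip_points_second_difference[OF m]) (simp add: e_def)
        moreover have "cone_int g e x < \<infinity>"
          by (rule le_less_trans[OF cone_int_mono \<delta>(2)]) (simp add: e_def)
        ultimately show "x \<in> square_points U f" unfolding sq by blast
      next
        assume "x \<in> square_points U f"
        then have "\<exists>m::nat. x \<in> lip_points F (real (Suc m)) (inverse (real (Suc m)))" using 3 unfolding sq by (rule rev_mp)
        then have "F differentiable (at x)" using 2 by blast
        then show "x \<in> diff_points U f" using dF[OF True] True by (simp add: diff_points_def)
      qed
    qed (simp add: diff_points_def square_points_def)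
    then show "x \<notin> sym_diff (diff_points U f) (square_points U f)" by blast
  qed
  then obtain Z where "Z \<in> null_sets lborel" "{x \<in> space lborel. \<not> x \<notin> sym_diff (diff_points U f) (square_points U f)} \<subseteq> Z"
    unfolding eventually_ae_filter by blast
  then have "Z \<in> null_sets lebesgue" "sym_diff (diff_points U f) (square_points U f) \<subseteq> Z"
    by (auto intro: null_sets_completionI)
  then show ?thesis by (rule null_sets_completion_subset[rotated])
qed

end
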